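(* Let $G$ be a finite primitive algebraic subgroup of $GL_n(\mathbb{C})$ and let $C\subseteq\mathbb{P}^{n-1}(\mathbb{C})$ be an algebraic $G$-invariant curve of degree $d$ not contained in a projective hyperplane. Let $L_C(y)=0$ be an LODE such that for a fundamental system of solutions $(y_1,\ldots,y_n)$ the image of its Schwarz map is $C$, arising as follows: (1) $C_0$ is a compact Riemann surface such that there is a non-constant morphism of curves $\psi:C_0\setminus S\to C/G\subseteq\mathbb{P}^{n-1}(\mathbb{C})/G$, with $S\subseteq C_0$ finite, and such that $C\to C/G$ is unramified over $\psi(C_0\setminus S)$; (2) $\pi:C_1\to C_0$ is a branched cover, where $C_1$ is a compact Riemann surface and $\mathbb{C}(C_0)\subseteq K=\mathbb{C}(C_1)$ is an abelian extension; (3) $L_C(y)=0$ is a monic LODE of order $n$ with field of definition $K$ (coefficients in $K$), $(y_1,\ldots,y_n)$ is a fundamental system of solutions over an open set $U\subseteq C_1$ such that the closure of the image of its Schwarz map is $C$, and the restriction of $\psi\circ\pi$ to $C_1\setminus\pi^{-1}(S)$ is the quotient Schwarz map of $L_C(y)=0$ associated to $(y_1,\ldots,y_n)$. Let $L(x)=0$ be an LODE of order $n$ such that for a fundamental system of solutions $(x_1,\ldots,x_n)$ the image of its Schwarz map is an algebraic $G$-invariant curve $X\subseteq\mathbb{P}^{n-1}(\mathbb{C})$ not contained in a projective hyperplane. Let $F_0$ be the field of definition of $L$ and $\delta:F_0\to F_0$ a non-trivial derivation. Let $F_0\subseteq E$ be a field extension of degree at most $d$, $f_1,\ldots,f_{n-2}\in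 E$, $E\subseteq E_1$ an abelian extension, $f,h\in E_1$ two functions, and $\Lambda\in\mathbb{Z}_{>0}$, whose existence is guaranteed under these hypotheses, such that, for $i=1,\ldots,n$, $$x_i+f_1\delta(x_i)+\cdots+f_{n-2}\delta^{n-2}(x_i)=f^{1/\Lambda}\cdot y_i\circ h.$$ Then there exist $g_0,\ldots,g_n\in E$ such that $$x_i=g_0f^{1/\Lambda}\cdot y_i\circ h+g_1\delta(f^{1/\Lambda}\cdot y_i\circ h)+\cdots+g_n\delta^n(f^{1/\Lambda}\cdot y_i\circ h).$$ In particular, $L(x)=0$ is gauge equivalent over $E$ to an LODE projectively equivalent to a pullback of $L_C(y)=0$ by a map in $E_1$.
   Context: LODE means linear ordinary differential equation. For a compact Riemann surface $Y$, $\mathbb{C}(Y)$ is its field of meromorphic functions, equipped with a non-trivial derivation $\delta$, which extends to meromorphic functions on open sets and to algebraic extensions. An LODE of order $n$ over $\mathbb{C}(Y)$ is $\delta^n(y)+a_{n-1}\delta^{n-1}(y)+\cdots+a_0y=0$ with $a_i\in\mathbb{C}(Y)$; the field of definition of an LODE is the field $\mathbb{C}(Y)$ containing its coefficients, so $F_0=\mathbb{C}(X_0)$ for a compact Riemann surface $X_0$, and the $x_i$ are functions on an open subset of $X_0$. Standing assumption: the LODEs considered are irreducible and all their solutions are algebraic over the field of coefficients. Schwarz map: given a fundamental system of solutions $\mathbf{y}=(y_1,\ldots,y_n)$ over a neighborhood $U$ of a non-singular point, it is the analytic extension of $[\mathbf{y}]:U\to\mathbb{P}^{n-1}(\mathbb{C})$,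 $z\mapsto[y_1(z):\cdots:y_n(z)]$; statements that its image is a curve are understood up to closure. Its monodromy (the projective monodromy) is a subgroup of $PGL_n(\mathbb{C})$; when it is finite, post-composing the Schwarz map with the quotient of $\mathbb{P}^{n-1}(\mathbb{C})$ by this group gives a single-valued map, the quotient Schwarz map. In (3) the map $\psi\circ\pi$ takes values in $\mathbb{P}^{n-1}(\mathbb{C})/G$, i.e. the quotient is by the action of $G$. $G$ acts on $\mathbb{C}^n$ on the right by $(x_1,\ldots,x_n)\mapsto(\sum_i x_ig_{i1},\ldots,\sum_i x_ig_{in})$ for $(g_{ij})\in G$, hence on $\mathbb{P}^{n-1}(\mathbb{C})$; $C/G$ is the image of $C$ in $\mathbb{P}^{n-1}(\mathbb{C})/G$. "Unramified over" a set means that $C\to C/G$ is a local isomorphism of complex curves over every point of that set. In the composition $y_i\circ h$, where the $y_i$ are functions on an open set of $C_1$, the "function" $h\in E_1$ stands for a morphism to $C_1$ from the compact Riemann surface whose function field is $E_1$; the $x_i$ are viewed on that surface through the inclusion $F_0\subseteq E_1$. Gauge equivalence: an order-$n$ LODE $L'(x)=0$ is gauge equivalent to an order-$n$ LODE $L''(w)=0$ over a field $E$ if there are $c_0,\ldots,c_{n-1}\in E$ such that $x=c_0w+c_1\delta(w)+\cdots+c_{n-1}\delta^{n-1}(w)$ is a solution of $L'(x)=0$ whenever $w$ is a solution of $L''(w)=0$. The pullback of $L_C(y)=0$ by $h$ is the LODE with solutions $y_1\circ h,\ldots,y_n\circ h$. Two LODEs are projectively equivalent if the solutions of one are obtained from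 those of the other by multiplication by a fixed nonzero solution of a first order LODE (here $f^{1/\Lambda}$). *)

theory Defs
  imports "HOL-Complex_Analysis.Complex_Analysis"
begin

no_notation fps_nth (infixl \<open>$\<close> 75)

section \<open>Riemann surfaces and their fields of meromorphic functions\<close>

text \<open>
  A Riemann surface is a connected Hausdorff type with a holomorphic atlas; a chart is a pair of an
  open domain and a coordinate map, whose values outside the domain are irrelevant.
\<close>

class riemann_surface = t2_space +
  fixes atlas :: "('a set \<times> ('a \<Rightarrow> complex)) set"
  assumes chart_open: "(D, \<phi>) \<in> atlas \<Longrightarrow> open D"
    and chart_inj: "(D, \<phi>) \<in> atlas \<Longrightarrow> inj_on \<phi> D"
    and chart_open_iff: "(D, \<phi>) \<in> atlas \<Longrightarrow> A \<subseteq> D \<Longrightarrow> open (\<phi> ` A) \<longleftrightarrow> open A"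
    and chart_transition: "(D, \<phi>) \<in> atlas \<Longrightarrow> (D', \<phi>') \<in> atlas \<Longrightarrow>
          (\<phi>' \<circ> inv_into D \<phi>) holomorphic_on \<phi> ` (D \<inter> D')"
    and chart_cover: "\<exists>D \<phi>. (D, \<phi>) \<in> atlas \<and> p \<in> D"
    and connected_surface: "connected (UNIV :: 'a set)"

class compact_riemann_surface = riemann_surface +
  assumes compact_surface: "compact (UNIV :: 'a set)"

definition rs_holomorphic_on :: "('a::riemann_surface \<Rightarrow> complex) \<Rightarrow> 'a set \<Rightarrow> bool"
  where "rs_holomorphic_on f U \<longleftrightarrow>
    (\<forall>(D, \<phi>)\<in>atlas. (f \<circ> inv_into D \<phi>) holomorphic_on \<phi> ` (D \<inter> U))"

text \<open>
  As for \<^const>\<open>meromorphic_on\<close>, the values at poles and removable singularities are arbitrary, so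
  identities between meromorphic functions on \<open>U\<close> are stated as \<open>\<forall>\<^sub>\<approx>z\<in>U\<close> (off a sparse set).
\<close>

definition rs_meromorphic_on :: "('a::riemann_surface \<Rightarrow> complex) \<Rightarrow> 'a set \<Rightarrow> bool"
  where "rs_meromorphic_on f U \<longleftrightarrow>
    (\<forall>(D, \<phi>)\<in>atlas. (f \<circ> inv_into D \<phi>) meromorphic_on \<phi> ` (D \<inter> U))"

definition rs_morphism :: "('a::riemann_surface \<Rightarrow> 'b::riemann_surface) \<Rightarrow> bool"
  where "rs_morphism q \<longleftrightarrow> continuous_on UNIV q \<and>
    (\<forall>(D, \<phi>)\<in>atlas. \<forall>(D', \<phi>')\<in>atlas.
       (\<phi>' \<circ> q \<circ> inv_into D \<phi>) holomorphic_on \<phi> ` (D \<inter> q -` D'))"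

text \<open>Between compact Riemann surfaces, non-constant morphisms are branched covers.\<close>

definition branched_cover :: "('a::compact_riemann_surface \<Rightarrow> 'b::compact_riemann_surface) \<Rightarrow> bool"
  where "branched_cover q \<longleftrightarrow> rs_morphism q \<and> \<not> q constant_on UNIV"

lemma chart_filtermap:
  fixes p :: "'a::riemann_surface"
  assumes "(D, \<phi>) \<in> atlas" "p \<in> D"
  shows "filtermap (inv_into D \<phi>) (at (\<phi> p)) = at p"
proof -
  let ?\<psi> = "inv_into D \<phi>"
  have inj: "inj_on \<phi> D" and oD: "open D" and oi: "open (\<phi> ` D)"
    and op: "\<And>A. A \<subseteq> D \<Longrightarrow> open (\<phi> ` A) \<longleftrightarrow> open A"
    using assms(1) chart_inj chart_open chart_open_iff by blast+
  show ?thesis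
  proof (rule filter_eqI)
    fix P
    show "eventually P (filtermap ?\<psi> (at (\<phi> p))) \<longleftrightarrow> eventually P (at p)"
    proof
      assume "eventually P (filtermap ?\<psi> (at (\<phi> p)))"
      then obtain S where S: "open S" "\<phi> p \<in> S" "\<And>y. y \<in> S \<Longrightarrow> y \<noteq> \<phi> p \<Longrightarrow> P (?\<psi> y)"
        by (auto simp: eventually_filtermap eventually_at_topological)
      let ?T = "{x \<in> D. \<phi> x \<in> S}"
      have "\<phi> ` ?T = \<phi> ` D \<inter> S" by auto
      then have "open ?T" using op[of ?T] oi S(1) by (metis (no_types, lifting) mem_Collect_eq open_Int subsetI)
      moreover have "P x" if "x \<in> ?T" "x \<noteq> p" for x
        using S(3)[of "\<phi> x"] that inj assms(2) by (auto simp: inj_on_eq_iff)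
      ultimately show "eventually P (at p)"
        unfolding eventually_at_topological using S(2) assms(2) by blast
    next
      assume "eventually P (at p)"
      then obtain S where S: "open S" "p \<in> S" "\<And>y. y \<in> S \<Longrightarrow> y \<noteq> p \<Longrightarrow> P y"
        by (auto simp: eventually_at_topological)
      have "open (\<phi> ` (D \<inter> S))"
        using op[of "D \<inter> S"] oD S(1) by blast
      moreover have "P (?\<psi> y)" if "y \<in> \<phi> ` (D \<inter> S)" "y \<noteq> \<phi> p" for y
        using that S(3)[of "?\<psi> y"] inj by (cases "?\<psi> y = p") auto
      moreover have "\<phi> p \<in> \<phi> ` (D \<inter> S)" using S(2) assms(2) by auto
      ultimately show "eventually P (filtermap ?\<psi> (at (\<phi> p)))"
        unfolding eventually_filtermap eventually_at_topological by blast
    qed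
  qed
qed

lemma at_surface_neq_bot: "at (p :: 'a::riemann_surface) \<noteq> bot"
proof -
  obtain D \<phi> where "(D, \<phi>) \<in> atlas" "p \<in> D" using chart_cover by blast
  from chart_filtermap[OF this] show ?thesis
    by (metis at_neq_bot filtermap_bot_iff)
qed

instance riemann_surface \<subseteq> perfect_space
proof
  fix x :: 'a
  show "\<not> open {x}"
    using at_surface_neq_bot[of x] at_eq_bot_iff by blast
qed

lemma rs_meromorphic_zero_dichotomy:
  fixes p :: "'a::riemann_surface"
  assumes "rs_meromorphic_on f UNIV"
  shows "eventually (\<lambda>z. f z = 0) (at p) \<or> eventually (\<lambda>z. f z \<noteq> 0) (at p)"
proof -
  obtain D \<phi> where D: "(D, \<phi>) \<in> atlas" "p \<in> D" using chart_cover by blast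
  let ?f = "f \<circ> inv_into D \<phi>"
  have "?f meromorphic_on \<phi> ` (D \<inter> UNIV)"
    using assms D(1) unfolding rs_meromorphic_on_def by blast
  then have "?f meromorphic_on {\<phi> p}"
    by (rule meromorphic_on_subset) (use D(2) in blast)
  then have "isolated_singularity_at ?f (\<phi> p)" "not_essential ?f (\<phi> p)"
    by (simp_all add: meromorphic_at_iff)
  then have "eventually (\<lambda>z. ?f z = 0) (at (\<phi> p))" if "frequently (\<lambda>z. ?f z = 0) (at (\<phi> p))"
    using not_essential_frequently_0_imp_eventually_0 that by blast
  then have "eventually (\<lambda>z. ?f z = 0) (at (\<phi> p)) \<or> eventually (\<lambda>z. ?f z \<noteq> 0) (at (\<phi> p))"
    by (auto simp: frequently_def)
  then show ?thesis
    by (simp flip: chart_filtermap[OF D] add: eventually_filtermap)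
qed

lemma open_eventually_at:
  "open {p :: 'a::t1_space. eventually P (at p)}"
proof (subst open_subopen, safe)
  fix p :: 'a assume "eventually P (at p)"
  then obtain S where S: "open S" "p \<in> S" "\<And>y. y \<in> S \<Longrightarrow> y \<noteq> p \<Longrightarrow> P y"
    by (auto simp: eventually_at_topological)
  have "eventually P (at z)" if "z \<in> S" for z
  proof (cases "z = p")
    case True then show ?thesis using \<open>eventually P (at p)\<close> by simp
  next
    case False
    have "open (S - {p})" using S(1) by (simp add: open_delete)
    then show ?thesis
      unfolding eventually_at_topological using S(3) that False by blast
  qed
  then show "\<exists>T. open T \<and> p \<in> T \<and> T \<subseteq> {p. eventually P (at p)}"
    using S by blast
qed

lemma rs_meromorphic_identity:
  fixes f :: "'a::riemann_surface \<Rightarrow> complex"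
  assumes "rs_meromorphic_on f UNIV" "\<not> (\<forall>\<^sub>\<approx>z. f z = 0)"
  shows "\<forall>\<^sub>\<approx>z. f z \<noteq> 0"
proof -
  let ?A = "{p. eventually (\<lambda>z. f z = 0) (at p)}"
  let ?B = "{p. eventually (\<lambda>z. f z \<noteq> 0) (at p)}"
  have "?A \<union> ?B = UNIV" using rs_meromorphic_zero_dichotomy[OF assms(1)] by blast
  moreover have "?A \<inter> ?B = {}"
  proof -
    have False if "eventually (\<lambda>z. f z = 0) (at p)" "eventually (\<lambda>z. f z \<noteq> 0) (at p)" for p
      using eventually_conj[OF that] at_surface_neq_bot[of p] by (simp add: eventually_False)
    then show ?thesis by blast
  qed
  moreover have "open ?A" "open ?B" by (rule open_eventually_at)+
  ultimately have "?A = {} \<or> ?B = {}"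
    using connected_surface[where 'a='a] unfolding connected_def by blast
  moreover have "?A \<noteq> UNIV"
    using assms(2) by (auto simp: eventually_cosparse_open_eq)
  ultimately have "?B = UNIV" using \<open>?A \<union> ?B = UNIV\<close> by blast
  then show ?thesis by (auto simp: eventually_cosparse_open_eq)
qed

lemma rs_meromorphic_on_const:
  "rs_meromorphic_on (\<lambda>_. c) U"
  by (auto simp: rs_meromorphic_on_def o_def)

lemma rs_meromorphic_on_add:
  "rs_meromorphic_on f U \<Longrightarrow> rs_meromorphic_on g U \<Longrightarrow> rs_meromorphic_on (\<lambda>z. f z + g z) U"
  by (auto simp: rs_meromorphic_on_def o_def intro!: meromorphic_on_add)

lemma rs_meromorphic_on_diff:
  "rs_meromorphic_on f U \<Longrightarrow> rs_meromorphic_on g U \<Longrightarrow> rs_meromorphic_on (\<lambda>z. f z - g z) U"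
  by (auto simp: rs_meromorphic_on_def o_def intro!: meromorphic_on_diff)

lemma rs_meromorphic_on_mult:
  "rs_meromorphic_on f U \<Longrightarrow> rs_meromorphic_on g U \<Longrightarrow> rs_meromorphic_on (\<lambda>z. f z * g z) U"
  by (auto simp: rs_meromorphic_on_def o_def intro!: meromorphic_on_mult)

lemma rs_meromorphic_on_divide:
  "rs_meromorphic_on f U \<Longrightarrow> rs_meromorphic_on g U \<Longrightarrow> rs_meromorphic_on (\<lambda>z. f z / g z) U"
  by (auto simp: rs_meromorphic_on_def o_def intro!: meromorphic_on_divide)

lemma rs_meromorphic_on_uminus:
  "rs_meromorphic_on f U \<Longrightarrow> rs_meromorphic_on (\<lambda>z. - f z) U"
  by (auto simp: rs_meromorphic_on_def o_def intro!: meromorphic_on_uminus)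

lemma rs_meromorphic_on_inverse:
  "rs_meromorphic_on f U \<Longrightarrow> rs_meromorphic_on (\<lambda>z. inverse (f z)) U"
  by (auto simp: rs_meromorphic_on_def o_def intro!: meromorphic_on_inverse)

lemmas rs_meromorphic_intros =
  rs_meromorphic_on_const
  rs_meromorphic_on_add
  rs_meromorphic_on_diff
  rs_meromorphic_on_mult
  rs_meromorphic_on_divide
  rs_meromorphic_on_uminus
  rs_meromorphic_on_inverse

quotient_type (overloaded) 'a mero = "'a::riemann_surface \<Rightarrow> complex" / partial:
  "\<lambda>f g. rs_meromorphic_on f UNIV \<and> rs_meromorphic_on g UNIV \<and> (\<forall>\<^sub>\<approx>z. f z = g z)"
proof (rule part_equivpI)
  show "\<exists>f. rs_meromorphic_on f UNIV \<and> rs_meromorphic_on f UNIV \<and> (\<forall>\<^sub>\<approx>z. f z = f z)"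
    using rs_meromorphic_on_const[of 0 UNIV] by auto
  show "symp (\<lambda>f g. rs_meromorphic_on f UNIV \<and> rs_meromorphic_on g UNIV \<and> (\<forall>\<^sub>\<approx>z. f z = g z))"
    by (rule sympI) (auto elim: eventually_mono)
  show "transp (\<lambda>f g. rs_meromorphic_on f UNIV \<and> rs_meromorphic_on g UNIV \<and> (\<forall>\<^sub>\<approx>z. f z = g z))"
    by (rule transpI) (auto elim: eventually_elim2)
qed

instantiation mero :: (riemann_surface) field
begin

lift_definition zero_mero :: "'a mero" is "\<lambda>_. 0"
  by (simp add: rs_meromorphic_intros)
lift_definition one_mero :: "'a mero" is "\<lambda>_. 1"
  by (simp add: rs_meromorphic_intros)
lift_definition plus_mero :: "'a mero \<Rightarrow> 'a mero \<Rightarrow> 'a mero" is "\<lambda>f g z. f z + g z"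
  by (auto intro!: rs_meromorphic_intros elim: eventually_elim2)
lift_definition minus_mero :: "'a mero \<Rightarrow> 'a mero \<Rightarrow> 'a mero" is "\<lambda>f g z. f z - g z"
  by (auto intro!: rs_meromorphic_intros elim: eventually_elim2)
lift_definition times_mero :: "'a mero \<Rightarrow> 'a mero \<Rightarrow> 'a mero" is "\<lambda>f g z. f z * g z"
  by (auto intro!: rs_meromorphic_intros elim: eventually_elim2)
lift_definition uminus_mero :: "'a mero \<Rightarrow> 'a mero" is "\<lambda>f z. - f z"
  by (auto intro!: rs_meromorphic_intros elim: eventually_mono)
lift_definition inverse_mero :: "'a mero \<Rightarrow> 'a mero" is "\<lambda>f z. inverse (f z)"
  by (auto intro!: rs_meromorphic_intros elim: eventually_mono)
definition divide_mero :: "'a mero \<Rightarrow> 'a mero \<Rightarrow> 'a mero" where "divide_mero a b = a * inverse b"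

instance
proof
  fix a b c :: "'a mero"
  show "a * b * c = a * (b * c)"
    by transfer (simp add: rs_meromorphic_intros mult.assoc)
  show "a * b = b * a"
    by transfer (simp add: rs_meromorphic_intros mult.commute)
  show "1 * a = a"
    by transfer (simp add: rs_meromorphic_intros)
  show "a + b + c = a + (b + c)"
    by transfer (simp add: rs_meromorphic_intros add.assoc)
  show "a + b = b + a"
    by transfer (simp add: rs_meromorphic_intros add.commute)
  show "0 + a = a"
    by transfer (simp add: rs_meromorphic_intros)
  show "- a + a = 0"
    by transfer (simp add: rs_meromorphic_intros)
  show "a - b = a + - b"
    by transfer (simp add: rs_meromorphic_intros)
  show "(a + b) * c = a * c + b * c"
    by transfer (simp add: rs_meromorphic_intros distrib_right)
  show "(0 :: 'a mero) \<noteq> 1"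
    by transfer simp
  show "inverse (0 :: 'a mero) = 0"
    by transfer (simp add: rs_meromorphic_intros)
  show "a div b = a * inverse b"
    by (rule divide_mero_def)
  show "inverse a * a = 1" if "a \<noteq> 0"
    using that
  proof transfer
    fix f :: "'a \<Rightarrow> complex"
    assume f: "rs_meromorphic_on f UNIV \<and> rs_meromorphic_on f UNIV \<and> (\<forall>\<^sub>\<approx>z. f z = f z)"
      and "\<not> (rs_meromorphic_on f UNIV \<and> rs_meromorphic_on (\<lambda>_. 0 :: complex) (UNIV :: 'a set) \<and>
              (\<forall>\<^sub>\<approx>z. f z = 0))"
    then have "\<not> (\<forall>\<^sub>\<approx>z. f z = 0)" by (simp add: rs_meromorphic_intros)
    with f have "\<forall>\<^sub>\<approx>z. f z \<noteq> 0" by (simp add: rs_meromorphic_identity)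
    then have "\<forall>\<^sub>\<approx>z. inverse (f z) * f z = 1" by (rule eventually_mono) simp
    with f show "rs_meromorphic_on (\<lambda>z. inverse (f z) * f z) UNIV \<and>
          rs_meromorphic_on (\<lambda>_. 1 :: complex) (UNIV :: 'a set) \<and> (\<forall>\<^sub>\<approx>z. inverse (f z) * f z = 1)"
      by (simp add: rs_meromorphic_intros)
  qed
qed

end

lift_definition mero_const :: "complex \<Rightarrow> 'a::riemann_surface mero" is "\<lambda>c _. c"
  by (simp add: rs_meromorphic_intros)


text \<open>
  The inclusion \<open>\<complex>(N) \<subseteq> \<complex>(M)\<close> given by a branched cover \<open>q : M \<rightarrow> N\<close>. All finite extensions of
  \<open>\<complex>(N)\<close> arise in this way.
\<close>

definition pull :: "('a::riemann_surface \<Rightarrow> 'b::riemann_surface) \<Rightarrow> 'b mero \<Rightarrow> 'a mero"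
  where "pull q a = abs_mero (rep_mero a \<circ> q)"

definition extension_degree_le ::
    "('a::compact_riemann_surface \<Rightarrow> 'b::compact_riemann_surface) \<Rightarrow> nat \<Rightarrow> bool"
  where "extension_degree_le q d \<longleftrightarrow>
    (\<exists>B. finite B \<and> card B \<le> d \<and> (\<forall>u. \<exists>c. u = (\<Sum>b\<in>B. pull q (c b) * b)))"

definition field_automorphisms_over ::
    "('a::compact_riemann_surface \<Rightarrow> 'b::compact_riemann_surface) \<Rightarrow> ('a mero \<Rightarrow> 'a mero) set"
  where "field_automorphisms_over q =
    {\<sigma>. bij \<sigma> \<and> (\<forall>a b. \<sigma> (a + b) = \<sigma> a + \<sigma> b) \<and> (\<forall>a b. \<sigma> (a * b) = \<sigma> a * \<sigma> b) \<and>
        (\<forall>a. \<sigma> (pull q a) = pull q a)}"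

definition abelian_extension ::
    "('a::compact_riemann_surface \<Rightarrow> 'b::compact_riemann_surface) \<Rightarrow> bool"
  where "abelian_extension q \<longleftrightarrow>
    (\<exists>m. extension_degree_le q m) \<and>
    {a. \<forall>\<sigma>\<in>field_automorphisms_over q. \<sigma> a = a} = range (pull q) \<and>
    (\<forall>\<sigma>\<in>field_automorphisms_over q. \<forall>\<tau>\<in>field_automorphisms_over q. \<sigma> \<circ> \<tau> = \<tau> \<circ> \<sigma>)"


section \<open>Derivations\<close>

definition derivation :: "('a::riemann_surface mero \<Rightarrow> 'a mero) \<Rightarrow> bool"
  where "derivation \<delta> \<longleftrightarrow>
    (\<forall>a b. \<delta> (a + b) = \<delta> a + \<delta> b) \<and> (\<forall>a b. \<delta> (a * b) = \<delta> a * b + a * \<delta> b) \<and>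
    (\<forall>c. \<delta> (mero_const c) = 0)"

definition nontrivial_derivation :: "('a::riemann_surface mero \<Rightarrow> 'a mero) \<Rightarrow> bool"
  where "nontrivial_derivation \<delta> \<longleftrightarrow> derivation \<delta> \<and> (\<exists>t. \<delta> t \<noteq> 0)"

text \<open>Depends on the chosen chart, but quotients of two such derivatives do not.\<close>

definition chart_deriv :: "('a::riemann_surface \<Rightarrow> complex) \<Rightarrow> 'a \<Rightarrow> complex"
  where "chart_deriv u z =
    (let (D, \<phi>) = (SOME c. c \<in> atlas \<and> z \<in> fst c) in deriv (u \<circ> inv_into D \<phi>) (\<phi> z))"

text \<open>
  The extension of a non-trivial derivation \<open>\<delta>\<close> of \<open>\<complex>(N)\<close>, along a branched cover \<open>q : M \<rightarrow> N\<close>, to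
  meromorphic functions \<open>u\<close> on open subsets of \<open>M\<close> (in particular to \<open>\<complex>(M)\<close>): if \<open>\<delta> t \<noteq> 0\<close>, then
  \<open>\<delta> u = \<delta> t \<cdot> du / dt\<close>. Since \<open>\<complex>(N)\<close> is algebraic over \<open>\<complex>(t)\<close> for compact \<open>N\<close>, this does not depend
  on \<open>t\<close> and agrees with \<open>\<delta>\<close> on \<open>\<complex>(N)\<close>. The formula may fail on a sparse set.
\<close>

definition extended_derivation ::
    "('a::compact_riemann_surface \<Rightarrow> 'b::compact_riemann_surface) \<Rightarrow> ('b mero \<Rightarrow> 'b mero) \<Rightarrow>
     ('a \<Rightarrow> complex) \<Rightarrow> 'a \<Rightarrow> complex"
  where "extended_derivation q \<delta> u z =
    (let t = (SOME t. \<delta> t \<noteq> 0)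
     in rep_mero (\<delta> t) (q z) * chart_deriv u z / chart_deriv (rep_mero t \<circ> q) z)"


section \<open>Linear ordinary differential equations\<close>

text \<open>
  A monic LODE of order \<open>n\<close> is given by its coefficients \<open>a 0, \<dots>, a (n - 1)\<close> in \<open>\<complex>(M)\<close>. In the
  predicates on local solutions, \<open>D\<close> is the derivation on local meromorphic functions on \<open>M\<close>.
\<close>

definition lode_solution ::
    "(('a::riemann_surface \<Rightarrow> complex) \<Rightarrow> 'a \<Rightarrow> complex) \<Rightarrow> nat \<Rightarrow> (nat \<Rightarrow> 'a mero) \<Rightarrow>
     'a set \<Rightarrow> ('a \<Rightarrow> complex) \<Rightarrow> bool"
  where "lode_solution D n a U u \<longleftrightarrow> open U \<and> rs_meromorphic_on u U \<and>
    (\<forall>\<^sub>\<approx>z\<in>U. (D ^^ n) u z + (\<Sum>k<n. rep_mero (a k) z * (D ^^ k) u z) = 0)"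

definition fundamental_system ::
    "(('a::riemann_surface \<Rightarrow> complex) \<Rightarrow> 'a \<Rightarrow> complex) \<Rightarrow> (nat \<Rightarrow> 'a mero) \<Rightarrow>
     'a set \<Rightarrow> ('a \<Rightarrow> complex ^ 'n) \<Rightarrow> bool"
  where "fundamental_system D a U y \<longleftrightarrow> open U \<and> connected U \<and> U \<noteq> {} \<and>
    (\<forall>i. rs_holomorphic_on (\<lambda>z. y z $ i) U \<and> lode_solution D CARD('n) a U (\<lambda>z. y z $ i)) \<and>
    (\<forall>c :: complex ^ 'n. (\<forall>\<^sub>\<approx>z\<in>U. (\<Sum>i\<in>UNIV. c $ i * y z $ i) = 0) \<longrightarrow> c = 0)"

definition lode_operator ::
    "('a::riemann_surface mero \<Rightarrow> 'a mero) \<Rightarrow> nat \<Rightarrow> (nat \<Rightarrow> 'a mero) \<Rightarrow> 'a mero \<Rightarrow> 'a mero"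
  where "lode_operator \<delta> n a u = (\<delta> ^^ n) u + (\<Sum>k<n. a k * (\<delta> ^^ k) u)"

text \<open>
  Differential operators are identified with the maps they induce on \<open>\<complex>(M)\<close>; this is faithful
  as \<open>\<delta>\<close> is non-trivial. The factors of a monic operator can be taken to be monic.
\<close>

definition lode_irreducible ::
    "('a::riemann_surface mero \<Rightarrow> 'a mero) \<Rightarrow> nat \<Rightarrow> (nat \<Rightarrow> 'a mero) \<Rightarrow> bool"
  where "lode_irreducible \<delta> n a \<longleftrightarrow>
    \<not> (\<exists>k m b c. 0 < k \<and> 0 < m \<and> k + m = n \<and>
          lode_operator \<delta> n a = lode_operator \<delta> k b \<circ> lode_operator \<delta> m c)"

definition lode_solutions_algebraic ::
    "(('a::riemann_surface \<Rightarrow> complex) \<Rightarrow> 'a \<Rightarrow> complex) \<Rightarrow> nat \<Rightarrow> (nat \<Rightarrow> 'a mero) \<Rightarrow> bool"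
  where "lode_solutions_algebraic D n a \<longleftrightarrow>
    (\<forall>U u. connected U \<and> U \<noteq> {} \<and> lode_solution D n a U u \<longrightarrow>
       (\<exists>P :: 'a mero poly. P \<noteq> 0 \<and>
          (\<forall>\<^sub>\<approx>z\<in>U. (\<Sum>k\<le>degree P. rep_mero (coeff P k) z * u z ^ k) = 0)))"

text \<open>
  Gauge equivalence of the LODE \<open>a\<close> to the LODE \<open>b\<close>. The last conjunct, injectivity of the gauge
  transformation on solutions, rules out degenerate choices such as \<open>c = 0\<close>.
\<close>

definition gauge_equivalent ::
    "(('a::riemann_surface \<Rightarrow> complex) \<Rightarrow> 'a \<Rightarrow> complex) \<Rightarrow> nat \<Rightarrow> (nat \<Rightarrow> 'a mero) \<Rightarrow>
     (nat \<Rightarrow> 'a mero) \<Rightarrow> bool"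
  where "gauge_equivalent D n a b \<longleftrightarrow>
    (\<exists>c :: nat \<Rightarrow> 'a mero. \<forall>U w. connected U \<and> lode_solution D n b U w \<longrightarrow>
       (let x = (\<lambda>z. \<Sum>j<n. rep_mero (c j) z * (D ^^ j) w z)
        in lode_solution D n a U x \<and> ((\<forall>\<^sub>\<approx>z\<in>U. x z = 0) \<longrightarrow> (\<forall>\<^sub>\<approx>z\<in>U. w z = 0))))"

text \<open>The LODE \<open>b\<close> on \<open>M\<close> is the pullback of the LODE \<open>a\<close> on \<open>N\<close> by \<open>h : M \<rightarrow> N\<close>.\<close>

definition lode_pullback ::
    "('a::compact_riemann_surface \<Rightarrow> 'b::compact_riemann_surface) \<Rightarrow> nat \<Rightarrow>
     (('a \<Rightarrow> complex) \<Rightarrow> 'a \<Rightarrow> complex) \<Rightarrow> (nat \<Rightarrow> 'a mero) \<Rightarrow>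
     (('b \<Rightarrow> complex) \<Rightarrow> 'b \<Rightarrow> complex) \<Rightarrow> (nat \<Rightarrow> 'b mero) \<Rightarrow> bool"
  where "lode_pullback h n D b D' a \<longleftrightarrow> branched_cover h \<and>
    (\<forall>U u. lode_solution D' n a U u \<longrightarrow> lode_solution D n b (h -` U) (u \<circ> h))"

text \<open>
  The solutions of the LODE \<open>a\<close> are those of \<open>b\<close> multiplied by \<open>r\<close>, a non-zero solution on \<open>V\<close> of
  the first order LODE \<open>D r + e r = 0\<close>.
\<close>

definition projectively_equivalent_by ::
    "(('a::riemann_surface \<Rightarrow> complex) \<Rightarrow> 'a \<Rightarrow> complex) \<Rightarrow> nat \<Rightarrow> 'a set \<Rightarrow> ('a \<Rightarrow> complex) \<Rightarrow>
     (nat \<Rightarrow> 'a mero) \<Rightarrow> (nat \<Rightarrow> 'a mero) \<Rightarrow> bool"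
  where "projectively_equivalent_by D n V r a b \<longleftrightarrow>
    connected V \<and> V \<noteq> {} \<and> (\<exists>e. lode_solution D 1 (\<lambda>_. e) V r) \<and> \<not> (\<forall>\<^sub>\<approx>z\<in>V. r z = 0) \<and>
    (\<forall>W u. open W \<and> W \<subseteq> V \<and> rs_meromorphic_on u W \<longrightarrow>
       (lode_solution D n a W (\<lambda>z. r z * u z) \<longleftrightarrow> lode_solution D n b W u))"


section \<open>Finite linear groups\<close>

definition linear_group :: "(complex ^ 'n ^ 'n) set \<Rightarrow> bool"
  where "linear_group G \<longleftrightarrow> mat 1 \<in> G \<and> (\<forall>A\<in>G. \<forall>B\<in>G. A ** B \<in> G) \<and>
    (\<forall>A\<in>G. \<exists>B\<in>G. A ** B = mat 1 \<and> B ** A = mat 1)"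

definition irreducible_group :: "(complex ^ 'n ^ 'n) set \<Rightarrow> bool"
  where "irreducible_group G \<longleftrightarrow>
    (\<forall>W. vec.subspace W \<and> (\<forall>g\<in>G. \<forall>v\<in>W. v v* g \<in> W) \<longrightarrow> W = {0} \<or> W = UNIV)"

definition direct_sum_decomposition :: "(complex ^ 'n) set set \<Rightarrow> bool"
  where "direct_sum_decomposition \<W> \<longleftrightarrow> finite \<W> \<and> (\<forall>W\<in>\<W>. vec.subspace W \<and> W \<noteq> {0}) \<and>
    (\<forall>v. \<exists>!u. (\<forall>W\<in>\<W>. u W \<in> W) \<and> (\<forall>W. W \<notin> \<W> \<longrightarrow> u W = 0) \<and> v = (\<Sum>W\<in>\<W>. u W))"

definition primitive_group :: "(complex ^ 'n ^ 'n) set \<Rightarrow> bool"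
  where "primitive_group G \<longleftrightarrow> irreducible_group G \<and>
    \<not> (\<exists>\<W>. direct_sum_decomposition \<W> \<and> 2 \<le> card \<W> \<and>
          (\<forall>g\<in>G. \<forall>W\<in>\<W>. (\<lambda>v. v v* g) ` W \<in> \<W>))"


section \<open>Projective space and projective curves\<close>

text \<open>The points of \<open>\<P>\<^sup>n\<^sup>-\<^sup>1(\<complex>)\<close>, with \<open>n = CARD('n)\<close>, are the lines through the origin of \<open>\<complex>\<^sup>n\<close>.\<close>

type_synonym 'n proj_point = "(complex ^ 'n) set"

definition proj_pt :: "complex ^ 'n \<Rightarrow> 'n proj_point"
  where "proj_pt v = vec.span {v}"

definition proj_space :: "'n::finite proj_point set"
  where "proj_space = proj_pt ` {v. v \<noteq> 0}"

definition proj_open :: "'n::finite proj_point set \<Rightarrow> bool"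
  where "proj_open A \<longleftrightarrow> A \<subseteq> proj_space \<and> open {v. v \<noteq> 0 \<and> proj_pt v \<in> A}"

definition proj_closure :: "'n::finite proj_point set \<Rightarrow> 'n proj_point set"
  where "proj_closure B = {p \<in> proj_space. \<forall>A. proj_open A \<and> p \<in> A \<longrightarrow> A \<inter> B \<noteq> {}}"

inductive_set polynomial_functions :: "(complex ^ 'n \<Rightarrow> complex) set"
  where
    const: "(\<lambda>_. c) \<in> polynomial_functions"
  | coord: "(\<lambda>v. v $ i) \<in> polynomial_functions"
  | add: "F \<in> polynomial_functions \<Longrightarrow> F' \<in> polynomial_functions \<Longrightarrow>
      (\<lambda>v. F v + F' v) \<in> polynomial_functions"
  | mult: "F \<in> polynomial_functions \<Longrightarrow> F' \<in> polynomial_functions \<Longrightarrow>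
      (\<lambda>v. F v * F' v) \<in> polynomial_functions"

definition homogeneous :: "nat \<Rightarrow> (complex ^ 'n \<Rightarrow> complex) \<Rightarrow> bool"
  where "homogeneous k F \<longleftrightarrow> F \<in> polynomial_functions \<and> (\<forall>c v. F (c *s v) = c ^ k * F v)"

definition zariski_closed :: "'n::finite proj_point set \<Rightarrow> bool"
  where "zariski_closed Z \<longleftrightarrow>
    (\<exists>\<F>. (\<forall>F\<in>\<F>. \<exists>k. homogeneous k F) \<and> Z = {p \<in> proj_space. \<forall>F\<in>\<F>. \<forall>v\<in>p. F v = 0})"

definition zariski_irreducible :: "'n::finite proj_point set \<Rightarrow> bool"
  where "zariski_irreducible Z \<longleftrightarrow> zariski_closed Z \<and> Z \<noteq> {} \<and>
    (\<forall>A B. zariski_closed A \<and> zariski_closed B \<and> Z = A \<union> B \<longrightarrow> Z = A \<or> Z = B)"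

definition irreducible_chain :: "'n::finite proj_point set \<Rightarrow> nat \<Rightarrow> (nat \<Rightarrow> 'n proj_point set) \<Rightarrow> bool"
  where "irreducible_chain Z k Y \<longleftrightarrow>
    (\<forall>i\<le>k. zariski_irreducible (Y i) \<and> Y i \<subseteq> Z) \<and> (\<forall>i<k. Y i \<subset> Y (Suc i))"

definition has_dimension :: "'n::finite proj_point set \<Rightarrow> nat \<Rightarrow> bool"
  where "has_dimension Z k \<longleftrightarrow>
    (\<exists>Y. irreducible_chain Z k Y) \<and> \<not> (\<exists>Y. irreducible_chain Z (Suc k) Y)"

definition irreducible_component :: "'n::finite proj_point set \<Rightarrow> 'n proj_point set \<Rightarrow> bool"
  where "irreducible_component C Z \<longleftrightarrow> zariski_irreducible Z \<and> Z \<subseteq> C \<and>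
    (\<forall>Z'. zariski_irreducible Z' \<and> Z \<subseteq> Z' \<and> Z' \<subseteq> C \<longrightarrow> Z' = Z)"

definition algebraic_curve :: "'n::finite proj_point set \<Rightarrow> bool"
  where "algebraic_curve C \<longleftrightarrow> zariski_closed C \<and> C \<noteq> {} \<and>
    (\<forall>Z. irreducible_component C Z \<longrightarrow> has_dimension Z 1)"

definition hyperplane :: "complex ^ 'n \<Rightarrow> 'n proj_point set"
  where "hyperplane l = {p \<in> proj_space. \<forall>v\<in>p. (\<Sum>i\<in>UNIV. l $ i * v $ i) = 0}"

text \<open>
  The degree is the number of intersection points with a general hyperplane, i.e. with every
  hyperplane whose coefficients lie in a non-empty Zariski open set.
\<close>

definition curve_degree :: "'n::finite proj_point set \<Rightarrow> nat \<Rightarrow> bool"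
  where "curve_degree C d \<longleftrightarrow>
    (\<exists>Q\<in>polynomial_functions. (\<exists>l. Q l \<noteq> 0) \<and>
       (\<forall>l. Q l \<noteq> 0 \<longrightarrow> finite (C \<inter> hyperplane l) \<and> card (C \<inter> hyperplane l) = d))"

definition nondegenerate :: "'n::finite proj_point set \<Rightarrow> bool"
  where "nondegenerate C \<longleftrightarrow> \<not> (\<exists>l. l \<noteq> 0 \<and> C \<subseteq> hyperplane l)"


section \<open>The quotient of projective space by a finite linear group\<close>

definition proj_act :: "complex ^ 'n ^ 'n \<Rightarrow> 'n proj_point \<Rightarrow> 'n proj_point"
  where "proj_act g p = (\<lambda>v. v v* g) ` p"

definition group_invariant :: "(complex ^ 'n ^ 'n) set \<Rightarrow> 'n proj_point set \<Rightarrow> bool"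
  where "group_invariant G C \<longleftrightarrow> (\<forall>g\<in>G. proj_act g ` C = C)"

type_synonym 'n proj_orbit = "'n proj_point set"

definition proj_orbit :: "(complex ^ 'n ^ 'n) set \<Rightarrow> 'n proj_point \<Rightarrow> 'n proj_orbit"
  where "proj_orbit G p = (\<lambda>g. proj_act g p) ` G"

definition invariant_form :: "(complex ^ 'n ^ 'n) set \<Rightarrow> nat \<Rightarrow> (complex ^ 'n \<Rightarrow> complex) \<Rightarrow> bool"
  where "invariant_form G k F \<longleftrightarrow> homogeneous k F \<and> (\<forall>g\<in>G. \<forall>v. F (v v* g) = F v)"

text \<open>
  The value at an orbit of \<open>F / Q\<close>, for invariant forms \<open>F\<close>, \<open>Q\<close> of the same degree. As
  \<open>\<P>\<^sup>n\<^sup>-\<^sup>1/G = Proj \<complex>[x]\<^sup>G\<close>, these are the regular functions on the basic open sets \<open>Q \<noteq> 0\<close>.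
\<close>

definition form_ratio ::
    "(complex ^ 'n \<Rightarrow> complex) \<Rightarrow> (complex ^ 'n \<Rightarrow> complex) \<Rightarrow> 'n proj_orbit \<Rightarrow> complex"
  where "form_ratio F Q \<Omega> = (let v = (SOME v. v \<noteq> 0 \<and> v \<in> \<Union>\<Omega>) in F v / Q v)"

text \<open>
  A morphism of algebraic curves \<open>M - S \<rightarrow> C/G\<close>: it pulls back regular functions on \<open>Q \<noteq> 0\<close> to regular
  functions, i.e. holomorphic functions that are meromorphic on the whole of \<open>M\<close>.
\<close>

definition morphism_to_quotient ::
    "(complex ^ 'n ^ 'n) set \<Rightarrow> 'n proj_point set \<Rightarrow> 'a::compact_riemann_surface set \<Rightarrow>
     ('a \<Rightarrow> 'n proj_orbit) \<Rightarrow> bool"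
  where "morphism_to_quotient G C S \<psi> \<longleftrightarrow> (\<forall>z\<in>-S. \<psi> z \<in> proj_orbit G ` C) \<and>
    (\<forall>k F Q. invariant_form G k F \<and> invariant_form G k Q \<longrightarrow>
       (let R = {z \<in> -S. \<forall>p\<in>\<psi> z. \<forall>v\<in>p. v \<noteq> 0 \<longrightarrow> Q v \<noteq> 0}
        in open R \<and> rs_holomorphic_on (form_ratio F Q \<circ> \<psi>) R \<and>
           rs_meromorphic_on (form_ratio F Q \<circ> \<psi>) UNIV))"

definition proj_holomorphic_on :: "('n::finite proj_point \<Rightarrow> complex) \<Rightarrow> 'n proj_point set \<Rightarrow> bool"
  where "proj_holomorphic_on f A \<longleftrightarrow>
    (\<forall>v. v \<noteq> 0 \<and> proj_pt v \<in> A \<longrightarrow>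
       (\<exists>f'. ((\<lambda>w. f (proj_pt w)) has_derivative f') (at v) \<and> (\<forall>c w. f' (c *s w) = c * f' w)))"

definition curve_open :: "'n::finite proj_point set \<Rightarrow> 'n proj_point set \<Rightarrow> bool"
  where "curve_open C T \<longleftrightarrow> (\<exists>A. proj_open A \<and> T = C \<inter> A)"

text \<open>Holomorphic functions on \<open>T \<subseteq> C\<close> locally extend holomorphically to the ambient space.\<close>

definition curve_holomorphic_on ::
    "'n::finite proj_point set \<Rightarrow> ('n proj_point \<Rightarrow> complex) \<Rightarrow> 'n proj_point set \<Rightarrow> bool"
  where "curve_holomorphic_on C f T \<longleftrightarrow>
    (\<forall>p\<in>T. \<exists>A f'. proj_open A \<and> p \<in> A \<and> proj_holomorphic_on f' A \<and> (\<forall>x\<in>T \<inter> A. f x = f' x))"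

definition quotient_open ::
    "(complex ^ 'n ^ 'n) set \<Rightarrow> 'n proj_point set \<Rightarrow> 'n proj_orbit set \<Rightarrow> bool"
  where "quotient_open G C T \<longleftrightarrow> T \<subseteq> proj_orbit G ` C \<and> curve_open C {p \<in> C. proj_orbit G p \<in> T}"

text \<open>
  Holomorphic functions on \<open>\<P>\<^sup>n\<^sup>-\<^sup>1/G\<close> are the invariant holomorphic functions on invariant open subsets
  of \<open>\<P>\<^sup>n\<^sup>-\<^sup>1\<close>; those on \<open>C/G\<close> are locally restrictions of such functions.
\<close>

definition quotient_holomorphic_on ::
    "(complex ^ 'n ^ 'n) set \<Rightarrow> 'n proj_point set \<Rightarrow> ('n proj_orbit \<Rightarrow> complex) \<Rightarrow>
     'n proj_orbit set \<Rightarrow> bool"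
  where "quotient_holomorphic_on G C f T \<longleftrightarrow>
    (\<forall>\<Omega>\<in>T. \<exists>A f'. proj_open A \<and> group_invariant G A \<and> \<Omega> \<subseteq> A \<and> proj_holomorphic_on f' A \<and>
       (\<forall>g\<in>G. \<forall>p\<in>A. f' (proj_act g p) = f' p) \<and>
       (\<forall>p\<in>C \<inter> A. proj_orbit G p \<in> T \<longrightarrow> f (proj_orbit G p) = f' p))"

definition quotient_local_isomorphism_at ::
    "(complex ^ 'n ^ 'n) set \<Rightarrow> 'n proj_point set \<Rightarrow> 'n proj_point \<Rightarrow> bool"
  where "quotient_local_isomorphism_at G C p \<longleftrightarrow>
    (\<exists>W. curve_open C W \<and> p \<in> W \<and> inj_on (proj_orbit G) W \<and>
       (\<forall>T\<subseteq>W. curve_open C T \<longleftrightarrow> quotient_open G C (proj_orbit G ` T)) \<and>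
       (\<forall>T\<subseteq>W. curve_open C T \<longrightarrow>
          (\<forall>f. quotient_holomorphic_on G C f (proj_orbit G ` T) \<longleftrightarrow>
               curve_holomorphic_on C (f \<circ> proj_orbit G) T)))"

definition quotient_unramified_over ::
    "(complex ^ 'n ^ 'n) set \<Rightarrow> 'n proj_point set \<Rightarrow> 'n proj_orbit set \<Rightarrow> bool"
  where "quotient_unramified_over G C B \<longleftrightarrow>
    (\<forall>p\<in>C. proj_orbit G p \<in> B \<longrightarrow> quotient_local_isomorphism_at G C p)"


section \<open>Schwarz maps\<close>

definition holomorphic_to_proj :: "('a::riemann_surface \<Rightarrow> 'n::finite proj_point) \<Rightarrow> 'a set \<Rightarrow> bool"
  where "holomorphic_to_proj \<Phi> W \<longleftrightarrow> open W \<and>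
    (\<forall>p\<in>W. \<exists>T v. open T \<and> p \<in> T \<and> T \<subseteq> W \<and> (\<forall>i. rs_holomorphic_on (\<lambda>z. v z $ i) T) \<and>
       (\<forall>z\<in>T. v z \<noteq> 0 \<and> \<Phi> z = proj_pt (v z)))"

text \<open>
  The function elements \<open>(W, \<Phi>)\<close> of the (multivalued) Schwarz map, obtained from \<open>[y]\<close> by analytic
  continuation along chains of connected open sets.
\<close>

inductive schwarz_element ::
    "'a::riemann_surface set \<Rightarrow> ('a \<Rightarrow> complex ^ 'n) \<Rightarrow> 'a set \<Rightarrow> ('a \<Rightarrow> 'n proj_point) \<Rightarrow> bool"
  for U y where
    base: "holomorphic_to_proj \<Phi> W \<Longrightarrow> connected W \<Longrightarrow> open T \<Longrightarrow> T \<noteq> {} \<Longrightarrow> T \<subseteq> U \<inter> W \<Longrightarrow>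
      (\<And>z. z \<in> T \<Longrightarrow> y z \<noteq> 0 \<and> \<Phi> z = proj_pt (y z)) \<Longrightarrow> schwarz_element U y W \<Phi>"
  | continuation: "schwarz_element U y W \<Phi> \<Longrightarrow> holomorphic_to_proj \<Phi>' W' \<Longrightarrow> connected W' \<Longrightarrow>
      open T \<Longrightarrow> T \<noteq> {} \<Longrightarrow> T \<subseteq> W \<inter> W' \<Longrightarrow> (\<And>z. z \<in> T \<Longrightarrow> \<Phi>' z = \<Phi> z) \<Longrightarrow>
      schwarz_element U y W' \<Phi>'"

definition schwarz_values ::
    "'a::riemann_surface set \<Rightarrow> ('a \<Rightarrow> complex ^ 'n) \<Rightarrow> 'a \<Rightarrow> 'n proj_point set"
  where "schwarz_values U y z = {\<Phi> z | W \<Phi>. schwarz_element U y W \<Phi> \<and> z \<in> W}"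

definition schwarz_image ::
    "'a::riemann_surface set \<Rightarrow> ('a \<Rightarrow> complex ^ 'n) \<Rightarrow> 'n proj_point set"
  where "schwarz_image U y = (\<Union>z. schwarz_values U y z)"

text \<open>On \<open>R\<close>, the Schwarz map followed by the quotient by \<open>G\<close> is the single-valued map \<open>\<Psi>\<close>.\<close>

definition quotient_schwarz_map ::
    "(complex ^ 'n ^ 'n) set \<Rightarrow> 'a::riemann_surface set \<Rightarrow> ('a \<Rightarrow> complex ^ 'n) \<Rightarrow> 'a set \<Rightarrow>
     ('a \<Rightarrow> 'n proj_orbit) \<Rightarrow> bool"
  where "quotient_schwarz_map G U y R \<Psi> \<longleftrightarrow>
    (\<forall>z\<in>R. proj_orbit G ` schwarz_values U y z = {\<Psi> z})"

end

theory Submission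
  imports Defs
begin

text \<open>
  Let \<open>L\<close> be the LODE \<open>l\<close> of order \<open>n\<close>, and let \<open>M = 1 + f\<^sub>1 \<delta> + \<dots> + f\<^bsub>n-2\<^esub> \<delta>\<^bsup>n-2\<^esup>\<close>, so that the given relation
  reads \<open>M x\<^sub>i = r * (y\<^sub>i \<circ> h)\<close>. As \<open>C\<close> is a curve, \<open>n\<close> is at least 2. The
  operator \<open>M\<close> is not zero and its order is below \<open>n - 1\<close>, hence it does not vanish on \<open>n - 1\<close> independent solutions of \<open>L\<close>, and the functions \<open>M x\<^sub>i\<close> cannot all be constant
  multiples of one function (\<open>low_order_image_not_rank_one\<close>). Therefore \<open>h\<close> is not constant and \<open>r\<close> is not
  0. Then the functions \<open>y\<^sub>i \<circ> h\<close>, and with them the functions \<open>M x\<^sub>i\<close>, are linearly independent over the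
  complex numbers.

  This makes the class of \<open>M\<close> a cyclic vector of the differential module of \<open>L\<close> over the field
  \<open>E\<close>: a relation between \<open>M, \<delta> M, \<dots>, \<delta>\<^bsup>n-1\<^esup> M\<close> modulo \<open>L\<close> would be an equation of order below \<open>n\<close> with the
  \<open>n\<close> independent solutions \<open>M x\<^sub>i\<close> (\<open>cyclic_data_of_independent_solutions\<close>). Expressing the class of 1
  in the basis \<open>M, \<delta> M, \<dots>, \<delta>\<^bsup>n-1\<^esup> M\<close> gives the coefficients \<open>g\<^sub>j\<close>, and expressing \<open>\<delta>\<^sup>n M\<close> in it gives an LODE
  \<open>b\<close> over \<open>E\<close> with solutions \<open>M x\<^sub>i\<close>. The change of basis is invertible, so that \<open>L\<close> and \<open>b\<close> are gauge
  equivalent (\<open>cyclic_solution_converse\<close>). The pullback \<open>c\<close> of the LODE \<open>a\<close> by \<open>h\<close> is obtained by the same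
  construction, starting from the chain rule \<open>\<delta> (u \<circ> h) = \<kappa> * (\<delta>\<^sub>C u \<circ> h)\<close>. Finally, \<open>b\<close>
  and \<open>c\<close> are projectively equivalent since dividing the solutions of \<open>b\<close> by \<open>r\<close> gives a monic LODE of
  order \<open>n\<close> that shares the \<open>n\<close> independent solutions \<open>y\<^sub>i \<circ> h\<close> with \<open>c\<close>.

  All of this is linear algebra over differential fields, while the statement speaks about functions on
  open sets and identities off sparse sets. The two are linked by germs: a meromorphic function has at every
  point a Laurent series in a fixed chart, the derivation \<open>\<delta>\<close> acts on these series as a non-zero multiple
  of the formal derivative (\<open>D_meromorphic\<close>), and the constants for it are the complex numbers. An identity
  holds off a sparse subset of an open set iff it holds for the germs at all its points.
\<close>

section \<open>Solutions of a linear equation over a differential field\<close>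

lemma homogeneous_system_nontrivial_solution:
  fixes A :: "nat \<Rightarrow> 'i \<Rightarrow> 'f::field"
  assumes "finite I" "m < card I"
  shows "\<exists>c. (\<exists>i\<in>I. c i \<noteq> 0) \<and> (\<forall>j<m. (\<Sum>i\<in>I. c i * A j i) = 0)"
  using assms
proof (induction m arbitrary: I A)
  case 0
  then obtain i where "i \<in> I" by fastforce
  then show ?case by (intro exI[of _ "\<lambda>_. 1"]) auto
next
  case (Suc m)
  show ?case
  proof (cases "\<forall>i\<in>I. A m i = 0")
    case True
    obtain c where "\<exists>i\<in>I. c i \<noteq> 0" "\<forall>j<m. (\<Sum>i\<in>I. c i * A j i) = 0"
      using Suc.IH[of I A] Suc.prems by auto
    with True show ?thesis by (intro exI[of _ c]) (auto simp: less_Suc_eq)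
  next
    case False
    then obtain k where k: "k \<in> I" "A m k \<noteq> 0" by blast
    define J where "J = I - {k}"
    have J: "finite J" "m < card J" "k \<notin> J" and I: "I = insert k J"
      using Suc.prems k by (auto simp: J_def)
    let ?B = "\<lambda>j i. A j i - A j k * A m i / A m k"
    obtain c where c: "\<exists>i\<in>J. c i \<noteq> 0" "\<forall>j<m. (\<Sum>i\<in>J. c i * ?B j i) = 0"
      using Suc.IH[of J ?B] J by auto
    define c' where "c' = c(k := - (\<Sum>i\<in>J. c i * A m i) / A m k)"
    have sum: "(\<Sum>i\<in>I. c' i * A j i) = (\<Sum>i\<in>J. c i * ?B j i)" for j
    proof -
      have "(\<Sum>i\<in>I. c' i * A j i) = c' k * A j k + (\<Sum>i\<in>J. c' i * A j i)"
        using J by (simp add: I)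
      also have "(\<Sum>i\<in>J. c' i * A j i) = (\<Sum>i\<in>J. c i * A j i)"
        using J by (intro sum.cong) (auto simp: c'_def)
      also have "c' k * A j k = - (\<Sum>i\<in>J. c i * (A j k * A m i / A m k))"
        by (simp add: c'_def sum_divide_distrib sum_distrib_left mult_ac)
      finally show ?thesis
        by (simp add: right_diff_distrib sum_subtractf)
    qed
    have "(\<Sum>i\<in>I. c' i * A j i) = 0" if "j < Suc m" for j
    proof (cases "j = m")
      case True
      with k show ?thesis by (simp add: sum)
    next
      case False
      with that c show ?thesis by (simp add: sum)
    qed
    moreover have "\<exists>i\<in>I. c' i \<noteq> 0"
      using c(1) J by (auto simp: c'_def I)
    ultimately show ?thesis by blast
  qed
qed

locale field_derivation =
  fixes d :: "'f::field \<Rightarrow> 'f"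
  assumes d_add: "d (a + b) = d a + d b"
    and d_mult: "d (a * b) = d a * b + a * d b"
begin

lemma d_zero [simp]: "d 0 = 0"
  using d_add[of 0 0] by (metis add_0 add_cancel_right_right)

lemma d_one [simp]: "d 1 = 0"
  using d_mult[of 1 1] by (metis add_cancel_right_right mult_1 mult.right_neutral)

lemma d_uminus: "d (- a) = - d a"
  using d_add[of a "- a"] by (simp add: eq_neg_iff_add_eq_0 add.commute)

lemma d_sum: "d (sum u I) = (\<Sum>i\<in>I. d (u i))"
  by (induction I rule: infinite_finite_induct) (auto simp: d_add)

lemma d_power: "d (a ^ n) = of_nat n * a ^ (n - 1) * d a"
proof (induction n)
  case (Suc n)
  then show ?case by (cases n) (simp_all add: d_mult algebra_simps)
qed simp

lemma d_divide_const:
  assumes "d a = 0" "d b = 0"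
  shows "d (a / b) = 0"
proof (cases "b = 0")
  case False
  have "d a = d (a / b * b)" using False by simp
  also have "\<dots> = d (a / b) * b" using assms(2) unfolding d_mult by simp
  finally show ?thesis using assms(1) False by auto
qed simp

lemma iterate_zero [simp]: "(d ^^ k) 0 = 0"
  by (induction k) auto

lemma iterate_add: "(d ^^ k) (a + b) = (d ^^ k) a + (d ^^ k) b"
  by (induction k) (auto simp: d_add)

lemma iterate_const_mult:
  assumes "d c = 0"
  shows "(d ^^ k) (c * a) = c * (d ^^ k) a"
  by (induction k) (auto simp: d_mult assms)

definition const_independent :: "'i set \<Rightarrow> ('i \<Rightarrow> 'f) \<Rightarrow> bool"
  where "const_independent I u \<longleftrightarrow>
    (\<forall>c. (\<forall>i\<in>I. d (c i) = 0) \<and> (\<Sum>i\<in>I. c i * u i) = 0 \<longrightarrow> (\<forall>i\<in>I. c i = 0))"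

lemma const_independent_scale:
  assumes "const_independent I u" "\<rho> \<noteq> 0"
  shows "const_independent I (\<lambda>i. \<rho> * u i)"
  unfolding const_independent_def
proof (intro allI impI, elim conjE)
  fix c assume c: "\<forall>i\<in>I. d (c i) = 0" "(\<Sum>i\<in>I. c i * (\<rho> * u i)) = 0"
  have "\<rho> * (\<Sum>i\<in>I. c i * u i) = 0" using c(2) by (simp add: sum_distrib_left mult.left_commute)
  then have "(\<Sum>i\<in>I. c i * u i) = 0" using assms(2) by simp
  with c(1) assms(1) show "\<forall>i\<in>I. c i = 0" unfolding const_independent_def by blast
qed

text \<open>
  An equation of order at most \<open>m\<close> has no more than \<open>m\<close> solutions that are independent over the
  constants. If \<open>k\<close> is its exact order, the \<open>k\<close>-jets of the solutions are too many vectors for their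
  space and satisfy a linear relation; such a relation with minimal support and one coefficient equal
  to 1 has constant coefficients, since differentiating it gives a relation with smaller support.
\<close>

lemma solutions_const_dependent:
  assumes "finite I" "m < card I" "\<exists>j\<le>m. a j \<noteq> 0"
    and "\<And>i. i \<in> I \<Longrightarrow> (\<Sum>j\<le>m. a j * (d ^^ j) (u i)) = 0"
  shows "\<not> const_independent I u"
proof -
  let ?S = "{j. j \<le> m \<and> a j \<noteq> 0}"
  define k where "k = Max ?S"
  have "finite ?S" "?S \<noteq> {}" using assms(3) by auto
  then have k: "k \<le> m" "a k \<noteq> 0" and k_max: "\<And>j. j \<le> m \<Longrightarrow> k < j \<Longrightarrow> a j = 0"
    unfolding k_def using Max_in[of ?S] Max_ge[of ?S] by (auto simp: leD)
  \<comment> \<open>The equation extends a relation between the derivatives of order below \<open>k\<close> to order \<open>k\<close>.\<close>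
  have top: "(\<Sum>i\<in>I. c i * (d ^^ k) (u i)) = 0"
    if c: "\<And>j. j < k \<Longrightarrow> (\<Sum>i\<in>I. c i * (d ^^ j) (u i)) = 0" for c
  proof -
    have "(\<Sum>j\<le>m. a j * (\<Sum>i\<in>I. c i * (d ^^ j) (u i))) =
        (\<Sum>j\<in>{k}. a j * (\<Sum>i\<in>I. c i * (d ^^ j) (u i)))"
    proof (rule sum.mono_neutral_right)
      show "\<forall>j\<in>{..m} - {k}. a j * (\<Sum>i\<in>I. c i * (d ^^ j) (u i)) = 0"
      proof
        fix j assume "j \<in> {..m} - {k}"
        then consider "j < k" | "j \<le> m" "k < j" by fastforce
        then show "a j * (\<Sum>i\<in>I. c i * (d ^^ j) (u i)) = 0"
          by cases (simp_all add: c k_max)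
      qed
    qed (use k in auto)
    moreover have "(\<Sum>j\<le>m. a j * (\<Sum>i\<in>I. c i * (d ^^ j) (u i))) =
        (\<Sum>i\<in>I. c i * (\<Sum>j\<le>m. a j * (d ^^ j) (u i)))"
      unfolding sum_distrib_left by (subst sum.swap) (simp add: mult_ac)
    ultimately show ?thesis using assms(4) k by simp
  qed
  define rel where "rel c \<longleftrightarrow> (\<exists>i\<in>I. c i \<noteq> 0) \<and> (\<forall>j<k. (\<Sum>i\<in>I. c i * (d ^^ j) (u i)) = 0)" for c
  let ?supp = "\<lambda>c. {i \<in> I. c i \<noteq> (0::'f)}"
  have "\<exists>c. rel c"
    unfolding rel_def
    using homogeneous_system_nontrivial_solution[OF assms(1), of k "\<lambda>j i. (d ^^ j) (u i)"] k(1) assms(2)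
    by simp
  then obtain c where c: "rel c" and min: "\<And>c'. rel c' \<Longrightarrow> card (?supp c) \<le> card (?supp c')"
    using ex_has_least_nat[of rel _ "\<lambda>c. card (?supp c)"] by blast
  from c obtain i0 where i0: "i0 \<in> I" "c i0 \<noteq> 0" by (auto simp: rel_def)
  define e where "e i = c i / c i0" for i
  have e: "(\<Sum>i\<in>I. e i * (d ^^ j) (u i)) = 0" if "j \<le> k" for j
  proof -
    have *: "(\<Sum>i\<in>I. e i * (d ^^ j) (u i)) = (\<Sum>i\<in>I. c i * (d ^^ j) (u i)) / c i0" for j
      by (simp add: e_def sum_divide_distrib)
    have "(\<Sum>i\<in>I. c i * (d ^^ j) (u i)) = 0"
      using that c top[of c] by (cases "j = k") (auto simp: rel_def)
    then show ?thesis by (simp add: *)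
  qed
  \<comment> \<open>The coefficients of the derived relation vanish wherever those of \<open>e\<close> do, and also at \<open>i0\<close>,
    where \<open>e\<close> takes the constant value 1: by minimality the derived relation is trivial.\<close>
  have "(\<Sum>i\<in>I. d (e i) * (d ^^ j) (u i)) = 0" if "j < k" for j
  proof -
    have "0 = d (\<Sum>i\<in>I. e i * (d ^^ j) (u i))" using e that by simp
    also have "\<dots> = (\<Sum>i\<in>I. d (e i) * (d ^^ j) (u i)) + (\<Sum>i\<in>I. e i * (d ^^ Suc j) (u i))"
      by (simp add: d_sum d_mult sum.distrib)
    finally show ?thesis using e[of "Suc j"] that by simp
  qed
  moreover have "\<not> rel (\<lambda>i. d (e i))"
  proof
    assume "rel (\<lambda>i. d (e i))"
    then have "card (?supp c) \<le> card (?supp (\<lambda>i. d (e i)))" by (rule min)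
    moreover have "?supp (\<lambda>i. d (e i)) \<subset> ?supp c"
    proof -
      have "d (e i) = 0" if "c i = 0" for i using that by (simp add: e_def)
      moreover have "d (e i0) = 0" using i0 by (simp add: e_def)
      ultimately show ?thesis using i0 by blast
    qed
    ultimately show False
      using psubset_card_mono[of "?supp c" "?supp (\<lambda>i. d (e i))"] assms(1) by simp
  qed
  ultimately have "\<forall>i\<in>I. d (e i) = 0" by (auto simp: rel_def)
  moreover have "(\<Sum>i\<in>I. e i * u i) = 0" using e[of 0] by simp
  moreover have "e i0 \<noteq> 0" using i0 by (simp add: e_def)
  ultimately show ?thesis using i0 unfolding const_independent_def by blast
qed

text \<open>
  If an operator maps \<open>n + 1\<close> functions to constant multiples of a single function, then \<open>n\<close> independent
  combinations of them lie in its kernel, which is too small for this if the order is below \<open>n\<close>.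
\<close>

lemma low_order_image_not_rank_one:
  fixes u w :: "'i \<Rightarrow> 'f"
  assumes "finite I" "card I = Suc n" "a 0 \<noteq> 0" "\<And>i. i \<in> I \<Longrightarrow> d (c i) = 0"
    and w: "\<And>i. i \<in> I \<Longrightarrow> (\<Sum>j<n. a j * (d ^^ j) (u i)) = c i * \<rho>"
    and "0 < n"
  shows "\<not> const_independent I u"
proof
  assume indep: "const_independent I u"
  have "I \<noteq> {}" using assms(2) by auto
  \<comment> \<open>If all images vanish, any \<open>i0\<close> will do: the quotients \<open>c i / c i0\<close> below are then 0.\<close>
  then obtain i0 where i0: "i0 \<in> I" "c i0 = 0 \<longrightarrow> (\<forall>i\<in>I. c i = 0)" by blast
  define J where "J = I - {i0}"
  have J: "finite J" "card J = n" "i0 \<notin> J" and I: "I = insert i0 J"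
    using assms(1,2) i0 by (auto simp: J_def)
  define t where "t i = c i / c i0" for i
  define v where "v i = u i + - t i * u i0" for i
  have t: "d (- t i) = 0" if "i \<in> J" for i
    using that i0 assms(4) by (simp add: t_def d_divide_const I d_uminus)
  have "(\<Sum>j\<le>n - 1. a j * (d ^^ j) (v i)) = 0" if "i \<in> J" for i
  proof -
    have "{..n - 1} = {..<n}" using assms(6) by auto
    then have "(\<Sum>j\<le>n - 1. a j * (d ^^ j) (v i)) =
        (\<Sum>j<n. a j * (d ^^ j) (u i)) + - t i * (\<Sum>j<n. a j * (d ^^ j) (u i0))"
      unfolding v_def iterate_add iterate_const_mult[OF t[OF that]]
      by (simp add: algebra_simps sum.distrib sum_distrib_left sum_subtractf sum_negf)
    also have "\<dots> = c i * \<rho> - t i * c i0 * \<rho>" using w[of i] w[of i0] that by (simp add: I)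
    also have "t i * c i0 = c i" using i0 that by (auto simp: t_def I)
    finally show ?thesis by simp
  qed
  moreover have "\<exists>j\<le>n - 1. a j \<noteq> 0" using assms(3) by blast
  ultimately have "\<not> const_independent J v"
    using solutions_const_dependent[of J "n - 1" a v] J assms(6) by auto
  then obtain b where b: "\<forall>i\<in>J. d (b i) = 0" "(\<Sum>i\<in>J. b i * v i) = 0" "\<exists>i\<in>J. b i \<noteq> 0"
    unfolding const_independent_def by blast
  define b' where "b' = b(i0 := \<Sum>i\<in>J. b i * (- t i))"
  have "(\<Sum>i\<in>J. b' i * u i) = (\<Sum>i\<in>J. b i * u i)"
    using J by (intro sum.cong) (auto simp: b'_def)
  then have "(\<Sum>i\<in>I. b' i * u i) = (\<Sum>i\<in>J. b i * v i)"
    using J by (simp add: I b'_def v_def algebra_simps sum.distrib sum_distrib_left sum_negf sum_subtractf)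
  then have "(\<Sum>i\<in>I. b' i * u i) = 0" using b by simp
  moreover have "d (b i * - t i) = 0" if "i \<in> J" for i
    using b(1) t[OF that] that unfolding d_mult by simp
  then have "d (\<Sum>i\<in>J. b i * - t i) = 0" unfolding d_sum by simp
  then have "d (b' i) = 0" if "i \<in> I" for i
    using b(1) that unfolding I b'_def by auto
  ultimately have "\<forall>i\<in>I. b' i = 0" using indep unfolding const_independent_def by blast
  then have "b i = 0" if "i \<in> J" for i
    using that J(3) by (auto simp: I b'_def split: if_splits)
  with b(3) show False by blast
qed

end

section \<open>Homomorphisms of differential fields\<close>

locale differential_field_hom = K: field_derivation dK + F: field_derivation dF
  for dK :: "'k::field \<Rightarrow> 'k" and dF :: "'f::field \<Rightarrow> 'f" +
  fixes \<iota> :: "'k \<Rightarrow> 'f"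
  assumes hom_one [simp]: "\<iota> 1 = 1"
    and hom_add: "\<iota> (a + b) = \<iota> a + \<iota> b"
    and hom_mult: "\<iota> (a * b) = \<iota> a * \<iota> b"
    and hom_d: "\<iota> (dK a) = dF (\<iota> a)"
begin

lemma hom_zero [simp]: "\<iota> 0 = 0"
  using hom_add[of 0 0] by (metis add_0 add_cancel_right_right)

lemma hom_uminus: "\<iota> (- a) = - \<iota> a"
  using hom_add[of a "- a"] by (simp add: eq_neg_iff_add_eq_0 add.commute)

lemma hom_diff: "\<iota> (a - b) = \<iota> a - \<iota> b"
  using hom_add[of a "- b"] by (simp add: hom_uminus)

lemma hom_sum: "\<iota> (sum u I) = (\<Sum>i\<in>I. \<iota> (u i))"
  by (induction I rule: infinite_finite_induct) (auto simp: hom_add)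

lemma hom_of_nat: "\<iota> (of_nat n) = of_nat n"
  by (induction n) (auto simp: hom_add)

lemma hom_eq_0_iff [simp]: "\<iota> a = 0 \<longleftrightarrow> a = 0"
proof
  assume "\<iota> a = 0"
  show "a = 0"
  proof (rule ccontr)
    assume "a \<noteq> 0"
    then have "\<iota> a * \<iota> (inverse a) = 1" by (simp flip: hom_mult)
    with \<open>\<iota> a = 0\<close> show False by simp
  qed
qed simp

lemma hom_divide: "\<iota> (a / b) = \<iota> a / \<iota> b"
proof (cases "b = 0")
  case False
  then have "\<iota> (a / b) * \<iota> b = \<iota> a" by (simp flip: hom_mult)
  with False show ?thesis by (simp add: field_simps)
qed simp

end

section \<open>Cyclic vectors\<close>

text \<open>
  Let \<open>X 0, \<dots>, X (n - 1)\<close> satisfy \<open>d (X j) = \<kappa> * X (j + 1)\<close>, where \<open>X n\<close> stands for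
  \<open>- (l 0 * X 0 + \<dots> + l (n - 1) * X (n - 1))\<close>. For \<open>\<kappa> = 1\<close> these are the derivatives of a solution of the LODE
  \<open>l\<close>; other values of \<open>\<kappa>\<close> arise from a change of variable. A row \<open>v\<close> stands for the combination
  \<open>v 0 * X 0 + \<dots> + v (n - 1) * X (n - 1)\<close>, and \<open>row_step\<close> gives the row of its derivative.
\<close>

definition row_step :: "('k::field \<Rightarrow> 'k) \<Rightarrow> 'k \<Rightarrow> nat \<Rightarrow> (nat \<Rightarrow> 'k) \<Rightarrow> (nat \<Rightarrow> 'k) \<Rightarrow> nat \<Rightarrow> 'k"
  where "row_step d \<kappa> n l v j = d (v j) + \<kappa> * ((if j = 0 then 0 else v (j - 1)) - l j * v (n - 1))"

definition row_iterate :: "('k::field \<Rightarrow> 'k) \<Rightarrow> 'k \<Rightarrow> nat \<Rightarrow> (nat \<Rightarrow> 'k) \<Rightarrow> (nat \<Rightarrow> 'k) \<Rightarrow> nat \<Rightarrow> nat \<Rightarrow> 'k"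
  where "row_iterate d \<kappa> n l v k = (row_step d \<kappa> n l ^^ k) v"

lemma row_iterate_0 [simp]: "row_iterate d \<kappa> n l v 0 = v"
  by (simp add: row_iterate_def)

lemma row_iterate_Suc [simp]:
  "row_iterate d \<kappa> n l v (Suc k) = row_step d \<kappa> n l (row_iterate d \<kappa> n l v k)"
  by (simp add: row_iterate_def)

text \<open>
  The rows \<open>P 0, \<dots>, P (n - 1)\<close> of the successive derivatives form a basis, with inverse matrix \<open>Q\<close>,
  and \<open>b\<close> are the coefficients of the monic LODE of order \<open>n\<close> expressing \<open>P n\<close> in this basis.
\<close>

definition cyclic_data ::
    "nat \<Rightarrow> (nat \<Rightarrow> nat \<Rightarrow> 'k::field) \<Rightarrow> (nat \<Rightarrow> 'k) \<Rightarrow> (nat \<Rightarrow> nat \<Rightarrow> 'k) \<Rightarrow> bool"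
  where "cyclic_data n P b Q \<longleftrightarrow> (\<forall>j<n. P n j = - (\<Sum>k<n. b k * P k j)) \<and>
    (\<forall>i<n. \<forall>j<n. (\<Sum>k<n. Q i k * P k j) = (if i = j then 1 else 0)) \<and>
    (\<forall>i<n. \<forall>j<n. (\<Sum>k<n. P i k * Q k j) = (if i = j then 1 else 0))"

lemma independent_rows_span:
  fixes P :: "nat \<Rightarrow> nat \<Rightarrow> 'k::field"
  assumes indep: "\<And>s. (\<And>j. j < n \<Longrightarrow> (\<Sum>k<n. s k * P k j) = 0) \<Longrightarrow> \<forall>k<n. s k = 0"
  obtains c where "\<And>j. j < n \<Longrightarrow> v j = (\<Sum>k<n. c k * P k j)"
proof -
  obtain s where s: "\<exists>i\<in>{..n}. s i \<noteq> 0"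
      "\<forall>j<n. (\<Sum>i\<le>n. s i * (if i < n then P i j else v j)) = 0"
    using homogeneous_system_nontrivial_solution[of "{..n}" n "\<lambda>j i. if i < n then P i j else v j"]
    by auto
  have eq: "(\<Sum>k<n. s k * P k j) + s n * v j = 0" if "j < n" for j
    using s(2) that by (simp flip: lessThan_Suc_atMost)
  \<comment> \<open>The rows and \<open>v\<close> are \<open>n + 1\<close> vectors of length \<open>n\<close>; by independence, a relation involves \<open>v\<close>.\<close>
  have "s n \<noteq> 0"
  proof
    assume 0: "s n = 0"
    then have "\<forall>k<n. s k = 0" using eq by (intro indep) auto
    with 0 s(1) show False by (metis atMost_iff le_eq_less_or_eq)
  qed
  then have "v j = (\<Sum>k<n. (- s k / s n) * P k j)" if "j < n" for j
    using eq[OF that]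
    by (simp add: sum_negf flip: sum_divide_distrib) (simp add: field_simps add_eq_0_iff2)
  then show thesis by (rule that)
qed

lemma cyclic_data_exists:
  fixes P :: "nat \<Rightarrow> nat \<Rightarrow> 'k::field"
  assumes indep: "\<And>s. (\<And>j. j < n \<Longrightarrow> (\<Sum>k<n. s k * P k j) = 0) \<Longrightarrow> \<forall>k<n. s k = 0"
  obtains b Q where "cyclic_data n P b Q"
proof -
  obtain b where b: "\<And>j. j < n \<Longrightarrow> - P n j = (\<Sum>k<n. b k * P k j)"
    using independent_rows_span[of n P "\<lambda>j. - P n j"] indep by blast
  have "\<exists>c. \<forall>j<n. (if i = j then 1 else 0) = (\<Sum>k<n. c k * P k j)" for i
    using independent_rows_span[of n P "\<lambda>j. if i = j then 1 else 0"] indep by metis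
  then obtain Q where Q: "\<And>i j. j < n \<Longrightarrow> (if i = j then 1 else 0) = (\<Sum>k<n. Q i k * P k j)"
    by metis
  \<comment> \<open>The left inverse \<open>Q\<close> is a right inverse: \<open>(P Q - 1) P = 0\<close>, and the rows of \<open>P\<close> are independent.\<close>
  have "(\<Sum>k<n. P i k * Q k j) = (if i = j then 1 else 0)" if ij: "i < n" "j < n" for i j
  proof -
    let ?s = "\<lambda>m. (\<Sum>k<n. P i k * Q k m) - (if i = m then 1 else 0)"
    have "(\<Sum>m<n. ?s m * P m j) = 0" if j: "j < n" for j
    proof -
      have "(\<Sum>m<n. (\<Sum>k<n. P i k * Q k m) * P m j) = (\<Sum>k<n. P i k * (\<Sum>m<n. Q k m * P m j))"
        unfolding sum_distrib_left sum_distrib_right by (subst sum.swap) (simp add: mult_ac)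
      also have "\<dots> = (\<Sum>k<n. P i k * (if k = j then 1 else 0))" using j by (simp flip: Q)
      also have "\<dots> = P i j" using j by (simp add: if_distrib[of "(*) _"] cong: if_cong)
      also have "P i j = (\<Sum>m<n. (if i = m then 1 else 0) * P m j)"
        using ij by (simp add: if_distrib[of "\<lambda>x. x * _"] cong: if_cong)
      finally show ?thesis by (simp add: left_diff_distrib sum_subtractf)
    qed
    then have "?s j = 0" using indep[of ?s] ij by blast
    then show ?thesis by simp
  qed
  then have "cyclic_data n P b Q" using b Q unfolding cyclic_data_def
    by (simp add: eq_neg_iff_add_eq_0 flip: b)
  then show thesis by (rule that)
qed

context differential_field_hom
begin

lemma row_step_sum:
  assumes "0 < n" "X n + (\<Sum>j<n. \<iota> (l j) * X j) = 0"
  shows "(\<Sum>j<n. \<iota> (row_step dK \<kappa> n l v j) * X j) =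
    (\<Sum>j<n. dF (\<iota> (v j)) * X j + \<iota> (v j) * (\<iota> \<kappa> * X (Suc j)))"
proof -
  obtain m where m: "n = Suc m" using assms(1) gr0_implies_Suc by blast
  have n1: "n - Suc 0 = m" by (simp add: m)
  have X: "X n = - (\<Sum>j<n. \<iota> (l j) * X j)" using assms(2) by (simp add: add_eq_0_iff2)
  have "(\<Sum>j<n. \<iota> (if j = 0 then 0 else v (j - 1)) * X j) = (\<Sum>j<m. \<iota> (v j) * X (Suc j))"
    unfolding m by (simp add: sum.lessThan_Suc_shift del: sum.lessThan_Suc)
  also have "\<dots> = (\<Sum>j<n. \<iota> (v j) * X (Suc j)) - \<iota> (v m) * X n" by (simp add: m)
  also have "\<iota> (v m) * X n = - (\<Sum>j<n. \<iota> (l j * v (n - 1)) * X j)"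
    unfolding X by (simp add: hom_mult sum_distrib_left mult_ac n1)
  finally have "(\<Sum>j<n. \<iota> (v j) * X (Suc j)) =
      (\<Sum>j<n. \<iota> (if j = 0 then 0 else v (j - 1)) * X j - \<iota> (l j * v (n - 1)) * X j)"
    by (simp add: sum_subtractf)
  then have "\<iota> \<kappa> * (\<Sum>j<n. \<iota> (v j) * X (Suc j)) =
      (\<Sum>j<n. \<iota> (\<kappa> * ((if j = 0 then 0 else v (j - 1)) - l j * v (n - 1))) * X j)"
    by (simp add: sum_distrib_left hom_mult hom_diff algebra_simps)
  then show ?thesis
    unfolding row_step_def hom_add hom_d distrib_right sum.distrib
    by (simp add: sum_distrib_left mult.left_commute)
qed

definition companion :: "'k \<Rightarrow> nat \<Rightarrow> (nat \<Rightarrow> 'k) \<Rightarrow> (nat \<Rightarrow> 'f) \<Rightarrow> bool"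
  where "companion \<kappa> n l X \<longleftrightarrow> 0 < n \<and> (\<forall>j<n. dF (X j) = \<iota> \<kappa> * X (Suc j)) \<and>
    X n + (\<Sum>j<n. \<iota> (l j) * X j) = 0"

lemma iterate_row:
  assumes "companion \<kappa> n l X"
  shows "(dF ^^ k) (\<Sum>j<n. \<iota> (v j) * X j) = (\<Sum>j<n. \<iota> (row_iterate dK \<kappa> n l v k j) * X j)"
proof (induction k)
  case (Suc k)
  have "(dF ^^ Suc k) (\<Sum>j<n. \<iota> (v j) * X j) = dF (\<Sum>j<n. \<iota> (row_iterate dK \<kappa> n l v k j) * X j)"
    by (simp add: Suc)
  also have "\<dots> = (\<Sum>j<n. dF (\<iota> (row_iterate dK \<kappa> n l v k j)) * X j +
      \<iota> (row_iterate dK \<kappa> n l v k j) * (\<iota> \<kappa> * X (Suc j)))"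
    using assms by (simp add: F.d_sum F.d_mult companion_def)
  also have "\<dots> = (\<Sum>j<n. \<iota> (row_iterate dK \<kappa> n l v (Suc k) j) * X j)"
    using assms by (simp add: row_step_sum companion_def)
  finally show ?case .
qed simp

text \<open>
  A linear relation over \<open>K\<close> between the rows of the first \<open>n\<close> derivatives would be an equation of order
  below \<open>n\<close> with \<open>n\<close> independent solutions. The solutions lie in an extension \<open>F\<close> of \<open>K\<close>, but the
  resulting data are defined over \<open>K\<close>.
\<close>

lemma cyclic_data_of_independent_solutions:
  assumes "finite I" "card I = n" "\<And>i. i \<in> I \<Longrightarrow> companion \<kappa> n l (X i)"
    and indep: "F.const_independent I (\<lambda>i. \<Sum>j<n. \<iota> (v j) * X i j)"
  obtains b Q where "cyclic_data n (row_iterate dK \<kappa> n l v) b Q"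
proof (rule cyclic_data_exists[of n "row_iterate dK \<kappa> n l v"])
  let ?P = "row_iterate dK \<kappa> n l v"
  fix s :: "nat \<Rightarrow> 'k"
  assume s: "\<And>j. j < n \<Longrightarrow> (\<Sum>k<n. s k * ?P k j) = 0"
  show "\<forall>k<n. s k = 0"
  proof (rule ccontr)
    assume "\<not> (\<forall>k<n. s k = 0)"
    then obtain k where k: "k < n" "s k \<noteq> 0" by blast
    then have n: "{..n - 1} = {..<n}" "k \<le> n - 1" "n - 1 < card I" using assms(2) by auto
    have "(\<Sum>k\<le>n - 1. \<iota> (s k) * (dF ^^ k) (\<Sum>j<n. \<iota> (v j) * X i j)) = 0" if "i \<in> I" for i
    proof -
      have "(\<Sum>k<n. \<iota> (s k) * (dF ^^ k) (\<Sum>j<n. \<iota> (v j) * X i j)) =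
          (\<Sum>k<n. \<Sum>j<n. \<iota> (s k * ?P k j) * X i j)"
        by (simp add: iterate_row[OF assms(3)[OF that]] hom_mult sum_distrib_left mult.assoc)
      also have "\<dots> = (\<Sum>j<n. \<iota> (\<Sum>k<n. s k * ?P k j) * X i j)"
        unfolding hom_sum sum_distrib_right by (rule sum.swap)
      also have "\<dots> = 0" using s by simp
      finally show ?thesis unfolding n .
    qed
    moreover have "\<exists>k\<le>n - 1. \<iota> (s k) \<noteq> 0" using k n by auto
    ultimately have "\<not> F.const_independent I (\<lambda>i. \<Sum>j<n. \<iota> (v j) * X i j)"
      by (intro F.solutions_const_dependent[OF assms(1) n(3)])
    with indep show False by contradiction
  qed
qed (rule that)

lemma cyclic_solution:
  assumes "cyclic_data n (row_iterate dK \<kappa> n l v) b Q" "companion \<kappa> n l X"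
  defines "w \<equiv> \<Sum>j<n. \<iota> (v j) * X j"
  shows "(dF ^^ n) w + (\<Sum>k<n. \<iota> (b k) * (dF ^^ k) w) = 0"
    and "i < n \<Longrightarrow> X i = (\<Sum>k<n. \<iota> (Q i k) * (dF ^^ k) w)"
proof -
  let ?P = "row_iterate dK \<kappa> n l v"
  have w: "(dF ^^ k) w = (\<Sum>j<n. \<iota> (?P k j) * X j)" for k
    unfolding w_def by (rule iterate_row[OF assms(2)])
  have lin: "(\<Sum>k<n. \<iota> (s k) * (dF ^^ k) w) = (\<Sum>j<n. \<iota> (\<Sum>k<n. s k * ?P k j) * X j)" for s
    unfolding w hom_sum sum_distrib_right sum_distrib_left
    by (subst sum.swap) (simp add: hom_mult mult_ac)
  have "(\<Sum>j<n. \<iota> (?P n j) * X j) = (\<Sum>j<n. \<iota> (- (\<Sum>k<n. b k * ?P k j)) * X j)"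
    using assms(1) by (intro sum.cong) (auto simp: cyclic_data_def)
  then show "(dF ^^ n) w + (\<Sum>k<n. \<iota> (b k) * (dF ^^ k) w) = 0"
    unfolding lin w[of n] by (simp add: hom_uminus sum_negf)
  show "X i = (\<Sum>k<n. \<iota> (Q i k) * (dF ^^ k) w)" if "i < n"
  proof -
    have "(\<Sum>k<n. \<iota> (Q i k) * (dF ^^ k) w) = (\<Sum>j<n. (if i = j then 1 else 0) * X j)"
      unfolding lin using assms(1) that by (intro sum.cong) (auto simp: cyclic_data_def)
    also have "\<dots> = X i" using that by (simp add: if_distrib[of "\<lambda>x. x * _"] cong: if_cong)
    finally show ?thesis by simp
  qed
qed

text \<open>
  The case \<open>\<kappa> = 1\<close> is a gauge equivalence in the other direction. Setting \<open>X = Q W\<close> for the vector \<open>W\<close> of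
  derivatives of \<open>w\<close>, the identity \<open>W = P X\<close> and the equation for \<open>w\<close> show that \<open>P\<close> annihilates the
  difference of \<open>d (X j)\<close> and \<open>X (j + 1)\<close>; as \<open>P\<close> is invertible, \<open>X 0\<close> solves the LODE \<open>l\<close>.
\<close>

lemma cyclic_solution_converse:
  assumes "0 < n" "cyclic_data n (row_iterate dK 1 n l v) b Q"
    and w: "(dF ^^ n) w + (\<Sum>k<n. \<iota> (b k) * (dF ^^ k) w) = 0"
  defines "x \<equiv> \<Sum>k<n. \<iota> (Q 0 k) * (dF ^^ k) w"
  shows "(dF ^^ n) x + (\<Sum>j<n. \<iota> (l j) * (dF ^^ j) x) = 0" and "x = 0 \<Longrightarrow> w = 0"
proof -
  let ?P = "row_iterate dK 1 n l v"
  define X where "X j = (if j < n then \<Sum>k<n. \<iota> (Q j k) * (dF ^^ k) w else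
      - (\<Sum>j<n. \<iota> (l j) * (\<Sum>k<n. \<iota> (Q j k) * (dF ^^ k) w)))" for j
  have X: "X n + (\<Sum>j<n. \<iota> (l j) * X j) = 0" by (simp add: X_def)
  have lin: "(\<Sum>j<n. \<iota> (s j) * X j) = (\<Sum>k<n. \<iota> (\<Sum>j<n. s j * Q j k) * (dF ^^ k) w)" for s
  proof -
    have "(\<Sum>j<n. \<iota> (s j) * X j) = (\<Sum>j<n. \<iota> (s j) * (\<Sum>k<n. \<iota> (Q j k) * (dF ^^ k) w))"
      by (simp add: X_def)
    then show ?thesis
      unfolding hom_sum sum_distrib_right sum_distrib_left
      by (subst sum.swap) (simp add: hom_mult mult_ac)
  qed
  have W: "(dF ^^ k) w = (\<Sum>j<n. \<iota> (?P k j) * X j)" if "k < n" for k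
  proof -
    have "(\<Sum>j<n. \<iota> (?P k j) * X j) = (\<Sum>j<n. (if k = j then 1 else 0) * (dF ^^ j) w)"
      unfolding lin using assms(2) that by (intro sum.cong) (auto simp: cyclic_data_def)
    also have "\<dots> = (dF ^^ k) w" using that by (simp add: if_distrib[of "\<lambda>x. x * _"] cong: if_cong)
    finally show ?thesis by simp
  qed
  have Wn: "(dF ^^ n) w = (\<Sum>j<n. \<iota> (?P n j) * X j)"
  proof -
    have "(\<Sum>j<n. \<iota> (?P n j) * X j) = (\<Sum>j<n. \<iota> (- (\<Sum>k<n. b k * ?P k j)) * X j)"
      using assms(2) by (intro sum.cong) (auto simp: cyclic_data_def)
    also have "\<dots> = - (\<Sum>k<n. \<iota> (b k) * (\<Sum>j<n. \<iota> (?P k j) * X j))"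
      unfolding hom_uminus hom_sum sum_distrib_left sum_distrib_right minus_mult_left[symmetric] sum_negf
      by (subst sum.swap) (simp add: hom_mult mult_ac)
    also have "\<dots> = - (\<Sum>k<n. \<iota> (b k) * (dF ^^ k) w)" by (simp add: W)
    finally show ?thesis using w by (simp add: add_eq_0_iff2)
  qed
  have diff: "(\<Sum>j<n. \<iota> (?P k j) * (dF (X j) - X (Suc j))) = 0" if k: "k < n" for k
  proof -
    have "dF ((dF ^^ k) w) = (dF ^^ Suc k) w" by simp
    also have "\<dots> = (\<Sum>j<n. \<iota> (?P (Suc k) j) * X j)"
      using W[of "Suc k"] Wn k by (cases "Suc k = n") auto
    also have "\<dots> = (\<Sum>j<n. dF (\<iota> (?P k j)) * X j + \<iota> (?P k j) * X (Suc j))"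
      using row_step_sum[OF assms(1) X, of 1 "?P k"] by simp
    finally have "dF (\<Sum>j<n. \<iota> (?P k j) * X j) = \<dots>" using W[OF k] by simp
    then show ?thesis by (simp add: F.d_sum F.d_mult sum.distrib right_diff_distrib sum_subtractf)
  qed
  have dX: "dF (X i) = X (Suc i)" if i: "i < n" for i
  proof -
    have "0 = (\<Sum>k<n. \<iota> (Q i k) * (\<Sum>j<n. \<iota> (?P k j) * (dF (X j) - X (Suc j))))"
      using diff by simp
    also have "\<dots> = (\<Sum>j<n. \<iota> (\<Sum>k<n. Q i k * ?P k j) * (dF (X j) - X (Suc j)))"
      unfolding hom_sum sum_distrib_right sum_distrib_left
      by (subst sum.swap) (simp add: hom_mult mult_ac)
    also have "\<dots> = (\<Sum>j<n. (if i = j then 1 else 0) * (dF (X j) - X (Suc j)))"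
      using assms(2) i by (intro sum.cong) (auto simp: cyclic_data_def)
    also have "\<dots> = dF (X i) - X (Suc i)"
      using i by (simp add: if_distrib[of "\<lambda>x. x * _"] cong: if_cong)
    finally show ?thesis by simp
  qed
  have x: "x = X 0" using assms(1) by (simp add: x_def X_def)
  have iter: "(dF ^^ j) x = X j" if "j \<le> n" for j
    using that by (induction j) (auto simp: x dX)
  then show "(dF ^^ n) x + (\<Sum>j<n. \<iota> (l j) * (dF ^^ j) x) = 0" using X by simp
  show "w = 0" if "x = 0"
  proof -
    have "X j = 0" if "j < n" for j using iter[of j] that \<open>x = 0\<close> by simp
    then show ?thesis using W[OF assms(1)] by simp
  qed
qed

end

section \<open>Multiplying solutions by a solution of a first order equation\<close>

text \<open>
  If \<open>d \<rho> = - e * \<rho>\<close>, then \<open>twist d e k j\<close> is the coefficient of \<open>\<rho> * d\<^sup>j u\<close> in \<open>d\<^sup>k (\<rho> * u)\<close>.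
\<close>

primrec twist :: "('k::field \<Rightarrow> 'k) \<Rightarrow> 'k \<Rightarrow> nat \<Rightarrow> nat \<Rightarrow> 'k"
  where
    "twist d e 0 = (\<lambda>j. if j = 0 then 1 else 0)"
  | "twist d e (Suc k) = (\<lambda>j. d (twist d e k j) - e * twist d e k j + (if j = 0 then 0 else twist d e k (j - 1)))"

definition twisted_lode :: "('k::field \<Rightarrow> 'k) \<Rightarrow> 'k \<Rightarrow> nat \<Rightarrow> (nat \<Rightarrow> 'k) \<Rightarrow> nat \<Rightarrow> 'k"
  where "twisted_lode d e n b j = twist d e n j + (\<Sum>k<n. b k * twist d e k j)"

context differential_field_hom
begin

lemma twist_above: "k < j \<Longrightarrow> twist dK e k j = 0"
  by (induction k arbitrary: j) auto

lemma twist_diagonal: "twist dK e k k = 1"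
  by (induction k) (auto simp: twist_above)

lemma iterate_twist:
  assumes "dF \<rho> = - \<iota> e * \<rho>"
  shows "(dF ^^ k) (\<rho> * u) = \<rho> * (\<Sum>j\<le>k. \<iota> (twist dK e k j) * (dF ^^ j) u)"
proof (induction k)
  case (Suc k)
  let ?T = "twist dK e" and ?u = "\<lambda>j. (dF ^^ j) u"
  let ?s = "\<Sum>j\<le>k. \<iota> (?T k j) * ?u j"
  have "dF ?s = (\<Sum>j\<le>k. \<iota> (dK (?T k j)) * ?u j) + (\<Sum>j\<le>k. \<iota> (?T k j) * ?u (Suc j))"
    by (simp add: F.d_sum F.d_mult hom_d sum.distrib)
  also have "(\<Sum>j\<le>k. \<iota> (dK (?T k j)) * ?u j) = (\<Sum>j\<le>Suc k. \<iota> (dK (?T k j)) * ?u j)"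
    by (simp add: twist_above)
  also have "(\<Sum>j\<le>k. \<iota> (?T k j) * ?u (Suc j)) =
      (\<Sum>j\<le>Suc k. \<iota> (if j = 0 then 0 else ?T k (j - 1)) * ?u j)"
    by (simp add: sum.atMost_Suc_shift del: sum.atMost_Suc)
  finally have d: "dF ?s = (\<Sum>j\<le>Suc k. \<iota> (dK (?T k j)) * ?u j) +
      (\<Sum>j\<le>Suc k. \<iota> (if j = 0 then 0 else ?T k (j - 1)) * ?u j)" .
  have s: "?s = (\<Sum>j\<le>Suc k. \<iota> (?T k j) * ?u j)"
    by (simp add: twist_above)
  have "(dF ^^ Suc k) (\<rho> * u) = \<rho> * (dF ?s - \<iota> e * ?s)"
    by (simp add: Suc F.d_mult assms algebra_simps)
  also have "dF ?s - \<iota> e * ?s = (\<Sum>j\<le>Suc k. \<iota> (?T (Suc k) j) * ?u j)"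
    unfolding d unfolding s sum_distrib_left sum.distrib[symmetric] sum_subtractf[symmetric]
    by (intro sum.cong refl) (simp add: hom_add hom_diff hom_mult algebra_simps)
  finally show ?case .
qed simp

lemma twisted_lode_operator:
  assumes "dF \<rho> = - \<iota> e * \<rho>"
  shows "(dF ^^ n) (\<rho> * u) + (\<Sum>k<n. \<iota> (b k) * (dF ^^ k) (\<rho> * u)) =
    \<rho> * ((dF ^^ n) u + (\<Sum>j<n. \<iota> (twisted_lode dK e n b j) * (dF ^^ j) u))"
proof -
  let ?T = "twist dK e" and ?u = "\<lambda>j. (dF ^^ j) u"
  have ext: "(\<Sum>j\<le>k. \<iota> (?T k j) * ?u j) = (\<Sum>j<n. \<iota> (?T k j) * ?u j)" if "k < n" for k
    using that by (intro sum.mono_neutral_left) (auto simp: twist_above)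
  have "(\<Sum>k<n. \<iota> (b k) * (dF ^^ k) (\<rho> * u)) =
      (\<Sum>k<n. \<Sum>j<n. \<rho> * (\<iota> (b k * ?T k j) * ?u j))"
  proof (intro sum.cong refl)
    fix k assume "k \<in> {..<n}"
    then have "(dF ^^ k) (\<rho> * u) = \<rho> * (\<Sum>j<n. \<iota> (?T k j) * ?u j)"
      by (simp only: iterate_twist[OF assms] ext lessThan_iff)
    then show "\<iota> (b k) * (dF ^^ k) (\<rho> * u) = (\<Sum>j<n. \<rho> * (\<iota> (b k * ?T k j) * ?u j))"
      by (simp add: sum_distrib_left hom_mult mult_ac)
  qed
  also have "\<dots> = \<rho> * (\<Sum>j<n. \<iota> (\<Sum>k<n. b k * ?T k j) * ?u j)"
    unfolding hom_sum sum_distrib_left sum_distrib_right by (rule sum.swap)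
  finally have 1: "(\<Sum>k<n. \<iota> (b k) * (dF ^^ k) (\<rho> * u)) = \<dots>" .
  have 2: "(dF ^^ n) (\<rho> * u) = \<rho> * (?u n + (\<Sum>j<n. \<iota> (?T n j) * ?u j))"
    unfolding iterate_twist[OF assms] by (simp add: twist_diagonal flip: lessThan_Suc_atMost)
  show ?thesis
    unfolding 1 2 twisted_lode_def hom_add
    by (simp add: algebra_simps sum.distrib)
qed

text \<open>
  The difference of two such monic equations has order below \<open>n\<close> and still has the \<open>n\<close> solutions.
\<close>

lemma lode_determined_by_independent_solutions:
  assumes "finite I" "card I = n" "F.const_independent I u"
    and "\<And>i. i \<in> I \<Longrightarrow> (dF ^^ n) (u i) + (\<Sum>k<n. \<iota> (a k) * (dF ^^ k) (u i)) = 0"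
    and "\<And>i. i \<in> I \<Longrightarrow> (dF ^^ n) (u i) + (\<Sum>k<n. \<iota> (b k) * (dF ^^ k) (u i)) = 0"
    and "j < n"
  shows "a j = b j"
proof (rule ccontr)
  assume "a j \<noteq> b j"
  then have "\<iota> (a j - b j) \<noteq> 0" by simp
  then have ex: "\<exists>k\<le>n - 1. \<iota> (a k - b k) \<noteq> 0" using assms(6) by (intro exI[of _ j]) auto
  have n: "{..n - 1} = {..<n}" "n - 1 < card I" using assms(2,6) by auto
  have "(\<Sum>k\<le>n - 1. \<iota> (a k - b k) * (dF ^^ k) (u i)) = 0" if "i \<in> I" for i
    using assms(4,5)[OF that] unfolding n
    by (simp add: hom_diff left_diff_distrib sum_subtractf) (metis add_left_cancel)
  then have "\<not> F.const_independent I u"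
    by (intro F.solutions_const_dependent[OF assms(1) n(2) ex])
  with assms(3) show False by contradiction
qed

end

section \<open>Meromorphic functions near a point\<close>

text \<open>
  The same choice as in \<^const>\<open>chart_deriv\<close>, so that \<^const>\<open>chart_deriv\<close> at \<open>z\<close> is taken in this chart.
\<close>

definition surface_chart :: "'a::riemann_surface \<Rightarrow> 'a set \<times> ('a \<Rightarrow> complex)"
  where "surface_chart z = (SOME c. c \<in> atlas \<and> z \<in> fst c)"

lemma surface_chart: "surface_chart z \<in> atlas" "z \<in> fst (surface_chart z)"
proof -
  have "\<exists>c. c \<in> atlas \<and> z \<in> fst c" using chart_cover[of z] by auto
  from someI_ex[OF this] show "surface_chart z \<in> atlas" "z \<in> fst (surface_chart z)"
    unfolding surface_chart_def by blast+
qed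

lemma surface_chart_obtain:
  obtains D \<phi> where "surface_chart z = (D, \<phi>)" "(D, \<phi>) \<in> atlas" "z \<in> D"
  using surface_chart[of z] by (cases "surface_chart z") auto

lemma chart_inverse:
  assumes "(D, \<phi>) \<in> atlas" "z \<in> D"
  shows "inv_into D \<phi> (\<phi> z) = z"
  using chart_inj[OF assms(1)] assms(2) by simp

lemma chart_image_open:
  assumes "(D, \<phi>) \<in> atlas" "open A" "A \<subseteq> D"
  shows "open (\<phi> ` A)"
  using chart_open_iff[OF assms(1,3)] assms(2) by simp

lemma eventually_at_chart:
  assumes "(D, \<phi>) \<in> atlas" "z \<in> D"
  shows "eventually P (at z) \<longleftrightarrow> eventually (\<lambda>w. P (inv_into D \<phi> w)) (at (\<phi> z))"
  by (simp flip: chart_filtermap[OF assms] add: eventually_filtermap)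

lemma eventually_at_chart':
  assumes "(D, \<phi>) \<in> atlas" "z \<in> D"
  shows "eventually Q (at (\<phi> z)) \<longleftrightarrow> eventually (\<lambda>x. Q (\<phi> x)) (at z)"
proof -
  have "eventually (\<lambda>w. w \<in> \<phi> ` D) (at (\<phi> z))"
    using assms by (intro eventually_at_in_open' chart_image_open[OF assms(1)] chart_open[OF assms(1)]) auto
  then have "eventually (\<lambda>w. \<phi> (inv_into D \<phi> w) = w) (at (\<phi> z))"
    by (rule eventually_mono) (auto simp: f_inv_into_f)
  then have "eventually (\<lambda>w. Q (\<phi> (inv_into D \<phi> w)) = Q w) (at (\<phi> z))"
    by (rule eventually_mono) simp
  then have "eventually Q (at (\<phi> z)) \<longleftrightarrow> eventually (\<lambda>w. Q (\<phi> (inv_into D \<phi> w))) (at (\<phi> z))"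
    by (intro iffI) (auto elim: eventually_elim2)
  then show ?thesis by (simp add: eventually_at_chart[OF assms])
qed

lemma eventually_at_surface_not_False:
  fixes z :: "'a::riemann_surface"
  assumes "eventually P (at z)" "eventually (\<lambda>x. \<not> P x) (at z)"
  shows False
  using eventually_conj[OF assms] at_surface_neq_bot[of z] by (simp add: eventually_False)

lemma rs_meromorphic_on_pointwise:
  fixes u :: "'a::riemann_surface \<Rightarrow> complex"
  shows "rs_meromorphic_on u U \<longleftrightarrow> (\<forall>z\<in>U. rs_meromorphic_on u {z})"
proof
  show "\<forall>z\<in>U. rs_meromorphic_on u {z}" if "rs_meromorphic_on u U"
    using that unfolding rs_meromorphic_on_def by (fast intro: meromorphic_on_subset)
  assume *: "\<forall>z\<in>U. rs_meromorphic_on u {z}"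
  show "rs_meromorphic_on u U"
    unfolding rs_meromorphic_on_def
  proof (clarify, subst meromorphic_on_meromorphic_at, rule ballI)
    fix D :: "'a set" and \<phi> w assume "(D, \<phi>) \<in> atlas" "w \<in> \<phi> ` (D \<inter> U)"
    then obtain z where z: "z \<in> D" "z \<in> U" "w = \<phi> z" by blast
    with * have "(u \<circ> inv_into D \<phi>) meromorphic_on \<phi> ` (D \<inter> {z})"
      using \<open>(D, \<phi>) \<in> atlas\<close> unfolding rs_meromorphic_on_def by blast
    then show "(u \<circ> inv_into D \<phi>) meromorphic_on {w}" using z by simp
  qed
qed

lemma rs_meromorphic_on_subset:
  assumes "rs_meromorphic_on u U" "T \<subseteq> U"
  shows "rs_meromorphic_on u T"
proof (rule rs_meromorphic_on_pointwise[THEN iffD2], rule ballI)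
  fix z assume "z \<in> T"
  then show "rs_meromorphic_on u {z}"
    using assms rs_meromorphic_on_pointwise[THEN iffD1, OF assms(1)] by blast
qed

lemma rs_meromorphic_onI: "(\<And>z. rs_meromorphic_on u {z}) \<Longrightarrow> rs_meromorphic_on u U"
  using rs_meromorphic_on_pointwise[of u U] by simp

lemma rs_meromorphic_at_iff:
  "rs_meromorphic_on u {z} \<longleftrightarrow> (\<forall>D \<phi>. (D, \<phi>) \<in> atlas \<longrightarrow> z \<in> D \<longrightarrow> (u \<circ> inv_into D \<phi>) meromorphic_on {\<phi> z})"
proof -
  have "(u \<circ> inv_into D \<phi>) meromorphic_on \<phi> ` (D \<inter> {z}) \<longleftrightarrow>
      (z \<in> D \<longrightarrow> (u \<circ> inv_into D \<phi>) meromorphic_on {\<phi> z})" for D \<phi>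
    by (cases "z \<in> D") auto
  then show ?thesis by (auto simp: rs_meromorphic_on_def)
qed

lemma rs_meromorphic_atD:
  assumes "rs_meromorphic_on u {z}" "(D, \<phi>) \<in> atlas" "z \<in> D"
  shows "(u \<circ> inv_into D \<phi>) meromorphic_on {\<phi> z}"
  using assms by (simp add: rs_meromorphic_at_iff)

lemma rs_meromorphic_on_sum:
  "(\<And>i. i \<in> I \<Longrightarrow> rs_meromorphic_on (u i) U) \<Longrightarrow> rs_meromorphic_on (\<lambda>z. \<Sum>i\<in>I. u i z) U"
  by (induction I rule: infinite_finite_induct) (auto intro!: rs_meromorphic_intros)

lemma rs_holomorphic_imp_meromorphic_on:
  fixes u :: "'a::riemann_surface \<Rightarrow> complex"
  assumes "rs_holomorphic_on u U" "open U"
  shows "rs_meromorphic_on u U"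
  unfolding rs_meromorphic_on_def
proof clarify
  fix D :: "'a set" and \<phi> assume c: "(D, \<phi>) \<in> atlas"
  have "open (\<phi> ` (D \<inter> U))"
    using chart_open[OF c] assms(2) by (intro chart_image_open[OF c]) auto
  moreover have "(u \<circ> inv_into D \<phi>) holomorphic_on \<phi> ` (D \<inter> U)"
    using assms(1) c unfolding rs_holomorphic_on_def by blast
  ultimately show "(u \<circ> inv_into D \<phi>) meromorphic_on \<phi> ` (D \<inter> U)"
    by (intro analytic_on_imp_meromorphic_on) (simp add: analytic_on_open)
qed

section \<open>Germs\<close>

text \<open>
  Laurent series form a field, so that identities between meromorphic functions, which hold off sparse
  sets only, become equations in a field at every point.
\<close>

definition germ :: "'a::riemann_surface \<Rightarrow> ('a \<Rightarrow> complex) \<Rightarrow> complex fls"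
  where "germ z u = (case surface_chart z of (D, \<phi>) \<Rightarrow> laurent_expansion (u \<circ> inv_into D \<phi>) (\<phi> z))"

lemma germ_expansion:
  assumes "rs_meromorphic_on u {z}" "surface_chart z = (D, \<phi>)"
  shows "(\<lambda>w. (u \<circ> inv_into D \<phi>) (\<phi> z + w)) has_laurent_expansion germ z u"
proof -
  have "(D, \<phi>) \<in> atlas" "z \<in> D" using surface_chart[of z] assms(2) by auto
  from rs_meromorphic_atD[OF assms(1) this] show ?thesis
    using assms(2) by (simp add: germ_def meromorphic_on_def')
qed

lemma germ_eqI:
  assumes "surface_chart z = (D, \<phi>)" "(\<lambda>w. (u \<circ> inv_into D \<phi>) (\<phi> z + w)) has_laurent_expansion F"
  shows "germ z u = F"
  using laurent_expansion_eqI[of "u \<circ> inv_into D \<phi>" "\<phi> z" F] assms by (simp add: germ_def)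

lemma germ_cong:
  assumes "eventually (\<lambda>x. u x = v x) (at z)"
  shows "germ z u = germ z v"
proof -
  obtain D \<phi> where c: "surface_chart z = (D, \<phi>)" "(D, \<phi>) \<in> atlas" "z \<in> D"
    by (rule surface_chart_obtain)
  then show ?thesis
    using assms by (auto simp: germ_def eventually_at_chart[OF c(2,3)] intro!: laurent_expansion_cong)
qed

lemma germ_const: "germ z (\<lambda>_. c) = fls_const c"
  by (rule surface_chart_obtain[of z], rule germ_eqI) (auto simp: o_def)

lemma germ_add:
  assumes "rs_meromorphic_on u {z}" "rs_meromorphic_on v {z}"
  shows "germ z (\<lambda>x. u x + v x) = germ z u + germ z v"
proof -
  obtain D \<phi> where c: "surface_chart z = (D, \<phi>)" by force
  show ?thesis
    using has_laurent_expansion_add[OF germ_expansion[OF assms(1) c] germ_expansion[OF assms(2) c]]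
    by (intro germ_eqI[OF c]) (simp add: o_def)
qed

lemma germ_diff:
  assumes "rs_meromorphic_on u {z}" "rs_meromorphic_on v {z}"
  shows "germ z (\<lambda>x. u x - v x) = germ z u - germ z v"
proof -
  obtain D \<phi> where c: "surface_chart z = (D, \<phi>)" by force
  show ?thesis
    using has_laurent_expansion_diff[OF germ_expansion[OF assms(1) c] germ_expansion[OF assms(2) c]]
    by (intro germ_eqI[OF c]) (simp add: o_def)
qed

lemma germ_mult:
  assumes "rs_meromorphic_on u {z}" "rs_meromorphic_on v {z}"
  shows "germ z (\<lambda>x. u x * v x) = germ z u * germ z v"
proof -
  obtain D \<phi> where c: "surface_chart z = (D, \<phi>)" by force
  show ?thesis
    using has_laurent_expansion_mult[OF germ_expansion[OF assms(1) c] germ_expansion[OF assms(2) c]]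
    by (intro germ_eqI[OF c]) (simp add: o_def)
qed

lemma germ_sum:
  assumes "\<And>i. i \<in> I \<Longrightarrow> rs_meromorphic_on (u i) {z}"
  shows "germ z (\<lambda>x. \<Sum>i\<in>I. u i x) = (\<Sum>i\<in>I. germ z (u i))"
  using assms
proof (induction I rule: infinite_finite_induct)
  case (insert i I)
  then show ?case by (simp add: germ_add rs_meromorphic_on_sum)
qed (simp_all add: germ_const)

lemma germ_power:
  assumes "rs_meromorphic_on u {z}"
  shows "rs_meromorphic_on (\<lambda>x. u x ^ k) {z}" "germ z (\<lambda>x. u x ^ k) = germ z u ^ k"
proof -
  have "rs_meromorphic_on (\<lambda>x. u x ^ k) {z} \<and> germ z (\<lambda>x. u x ^ k) = germ z u ^ k"
    by (induction k) (simp_all add: germ_const rs_meromorphic_intros germ_mult assms)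
  then show "rs_meromorphic_on (\<lambda>x. u x ^ k) {z}" "germ z (\<lambda>x. u x ^ k) = germ z u ^ k" by auto
qed

lemma germ_eq_0_iff:
  assumes "rs_meromorphic_on u {z}"
  shows "germ z u = 0 \<longleftrightarrow> eventually (\<lambda>x. u x = 0) (at z)"
proof
  show "germ z u = 0" if "eventually (\<lambda>x. u x = 0) (at z)"
    using germ_cong[OF that] by (simp add: germ_const)
  assume 0: "germ z u = 0"
  obtain D \<phi> where c: "surface_chart z = (D, \<phi>)" "(D, \<phi>) \<in> atlas" "z \<in> D"
    by (rule surface_chart_obtain)
  have "eventually (\<lambda>w. (u \<circ> inv_into D \<phi>) (\<phi> z + w) = 0) (at 0)"
    using germ_expansion[OF assms c(1)] 0 by (auto simp: has_laurent_expansion_def elim: eventually_mono)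
  then have "eventually (\<lambda>w. (u \<circ> inv_into D \<phi>) w = 0) (at (\<phi> z))"
    by (subst eventually_at_to_0) (simp add: add.commute)
  then show "eventually (\<lambda>x. u x = 0) (at z)"
    by (simp add: eventually_at_chart[OF c(2,3)])
qed

lemma germ_eq_iff:
  assumes "rs_meromorphic_on u {z}" "rs_meromorphic_on v {z}"
  shows "germ z u = germ z v \<longleftrightarrow> eventually (\<lambda>x. u x = v x) (at z)"
proof -
  have "germ z u = germ z v \<longleftrightarrow> germ z (\<lambda>x. u x - v x) = 0"
    using germ_diff[OF assms] by simp
  also have "\<dots> \<longleftrightarrow> eventually (\<lambda>x. u x = v x) (at z)"
    by (subst germ_eq_0_iff) (simp_all add: rs_meromorphic_on_diff assms)
  finally show ?thesis .
qed

lemma germ_neq_0_iff: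
  assumes "rs_meromorphic_on u {z}"
  shows "germ z u \<noteq> 0 \<longleftrightarrow> eventually (\<lambda>x. u x \<noteq> 0) (at z)"
proof -
  obtain D \<phi> where c: "surface_chart z = (D, \<phi>)" "(D, \<phi>) \<in> atlas" "z \<in> D"
    by (rule surface_chart_obtain)
  show ?thesis
    using has_laurent_expansion_eventually_nonzero_iff[OF germ_expansion[OF assms c(1)]]
    by (simp add: eventually_at_chart[OF c(2,3)])
qed

lemma meromorphic_connected_dichotomy:
  fixes u :: "'a::riemann_surface \<Rightarrow> complex"
  assumes "rs_meromorphic_on u V" "connected V" "open V"
  shows "(\<forall>z\<in>V. germ z u = 0) \<or> (\<forall>z\<in>V. germ z u \<noteq> 0)"
proof -
  let ?A = "{z. eventually (\<lambda>x. u x = 0) (at z)}" and ?B = "{z. eventually (\<lambda>x. u x \<noteq> 0) (at z)}"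
  have mero: "rs_meromorphic_on u {z}" if "z \<in> V" for z
    using assms(1) that rs_meromorphic_on_pointwise by blast
  have *: "germ z u = 0 \<longleftrightarrow> z \<in> ?A" "germ z u \<noteq> 0 \<longleftrightarrow> z \<in> ?B" if "z \<in> V" for z
    using germ_eq_0_iff[OF mero[OF that]] germ_neq_0_iff[OF mero[OF that]] by auto
  have "open ?A" "open ?B" by (rule open_eventually_at)+
  moreover have "V \<subseteq> ?A \<union> ?B" using * by blast
  moreover have "?A \<inter> ?B \<inter> V = {}" using * by blast
  ultimately have "?A \<inter> V = {} \<or> ?B \<inter> V = {}"
    using assms(2) unfolding connected_def by blast
  then show ?thesis using * by blast
qed

section \<open>Derivatives in charts\<close>

lemma eventually_nhds_chart:
  assumes "(D, \<phi>) \<in> atlas" "z \<in> D"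
  shows "eventually P (nhds z) \<longleftrightarrow> eventually (\<lambda>w. P (inv_into D \<phi> w)) (nhds (\<phi> z))"
  by (simp add: eventually_nhds_conv_at eventually_at_chart[OF assms] chart_inverse[OF assms])

text \<open>
  The chain rule for \<open>u = g \<circ> k\<close>. With a coordinate \<open>k\<close>, it compares \<^const>\<open>chart_deriv\<close>, whose chart varies
  from point to point, with the derivative in one fixed chart.
\<close>

lemma chart_deriv_compose:
  assumes g: "g analytic_on {k z}"
    and k: "surface_chart z = (D, \<phi>)" "(k \<circ> inv_into D \<phi>) analytic_on {\<phi> z}"
    and u: "eventually (\<lambda>x. u x = g (k x)) (nhds z)"
  shows "chart_deriv u z = deriv g (k z) * chart_deriv k z"
proof -
  have c: "(D, \<phi>) \<in> atlas" "z \<in> D" using surface_chart[of z] k(1) by auto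
  have cd: "chart_deriv v z = deriv (v \<circ> inv_into D \<phi>) (\<phi> z)" for v
    using k(1) unfolding chart_deriv_def surface_chart_def by simp
  have "eventually (\<lambda>w. (u \<circ> inv_into D \<phi>) w = (g \<circ> (k \<circ> inv_into D \<phi>)) w) (nhds (\<phi> z))"
    using u by (simp add: eventually_nhds_chart[OF c])
  then have "deriv (u \<circ> inv_into D \<phi>) (\<phi> z) = deriv (g \<circ> (k \<circ> inv_into D \<phi>)) (\<phi> z)"
    by (intro deriv_cong_ev refl)
  also have "\<dots> = deriv g (k z) * deriv (k \<circ> inv_into D \<phi>) (\<phi> z)"
    using g k(2) chart_inverse[OF c]
    by (subst deriv_chain) (auto intro: analytic_on_imp_differentiable_at)
  finally show ?thesis by (simp add: cd)
qed

lemma holomorphic_on_chart_imp_analytic_at: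
  assumes "(D, \<phi>) \<in> atlas" "(k \<circ> inv_into D \<phi>) holomorphic_on \<phi> ` (D \<inter> T)" "open T" "z \<in> D" "z \<in> T"
  shows "(k \<circ> inv_into D \<phi>) analytic_on {\<phi> z}"
proof -
  have "open (\<phi> ` (D \<inter> T))"
    using chart_open[OF assms(1)] assms(3) by (intro chart_image_open[OF assms(1)]) auto
  then show ?thesis
    using assms by (auto simp: analytic_at)
qed

lemma chart_transition_regular:
  assumes "(D, \<phi>) \<in> atlas" "z \<in> D" "surface_chart z = (D', \<phi>')"
  shows "(\<phi> \<circ> inv_into D' \<phi>') analytic_on {\<phi>' z}" "chart_deriv \<phi> z \<noteq> 0"
proof -
  have c: "(D', \<phi>') \<in> atlas" "z \<in> D'" using surface_chart[of z] assms(3) by auto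
  have hol: "(\<phi> \<circ> inv_into D' \<phi>') holomorphic_on \<phi>' ` (D' \<inter> D)"
    by (rule chart_transition[OF c(1) assms(1)])
  show "(\<phi> \<circ> inv_into D' \<phi>') analytic_on {\<phi>' z}"
    by (rule holomorphic_on_chart_imp_analytic_at[OF c(1) hol chart_open[OF assms(1)] c(2) assms(2)])
  have "open (\<phi>' ` (D' \<inter> D))"
    using chart_open[OF c(1)] chart_open[OF assms(1)] by (intro chart_image_open[OF c(1)]) auto
  moreover have "inj_on (\<phi> \<circ> inv_into D' \<phi>') (\<phi>' ` (D' \<inter> D))"
    using chart_inj[OF c(1)] chart_inj[OF assms(1)] by (auto simp: inj_on_def)
  ultimately have "deriv (\<phi> \<circ> inv_into D' \<phi>') (\<phi>' z) \<noteq> 0"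
    using holomorphic_injective_imp_regular[OF hol] c assms(2) by blast
  then show "chart_deriv \<phi> z \<noteq> 0"
    using assms(3) unfolding chart_deriv_def surface_chart_def by simp
qed

lemma eventually_in_chart:
  assumes "(D, \<phi>) \<in> atlas" "z \<in> D"
  shows "eventually (\<lambda>x. x \<in> D) (at z)"
  using chart_open[OF assms(1)] assms(2) by (rule eventually_at_in_open')

lemma rs_meromorphic_at_imp_analytic_nearby:
  assumes "rs_meromorphic_on u {z}" "(D, \<phi>) \<in> atlas" "z \<in> D"
  shows "eventually (\<lambda>x. (u \<circ> inv_into D \<phi>) analytic_on {\<phi> x}) (at z)"
proof -
  have "isolated_singularity_at (u \<circ> inv_into D \<phi>) (\<phi> z)"
    using rs_meromorphic_atD[OF assms] by (simp add: meromorphic_at_iff)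
  then show ?thesis
    by (simp add: isolated_singularity_at_altdef eventually_at_chart'[OF assms(2,3)])
qed

lemma chart_deriv_in_chart:
  assumes "rs_meromorphic_on u {z}" "(D, \<phi>) \<in> atlas" "z \<in> D"
  shows "eventually (\<lambda>x. chart_deriv u x = deriv (u \<circ> inv_into D \<phi>) (\<phi> x) * chart_deriv \<phi> x \<and>
    chart_deriv \<phi> x \<noteq> 0) (at z)"
  using rs_meromorphic_at_imp_analytic_nearby[OF assms] eventually_in_chart[OF assms(2,3)]
proof eventually_elim
  case (elim x)
  obtain D' \<phi>' where c: "surface_chart x = (D', \<phi>')" by force
  have "eventually (\<lambda>y. y \<in> D) (nhds x)"
    using chart_open[OF assms(2)] elim(2) by (rule eventually_nhds_in_open)
  then have "eventually (\<lambda>y. u y = (u \<circ> inv_into D \<phi>) (\<phi> y)) (nhds x)"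
    by (rule eventually_mono) (simp add: chart_inverse[OF assms(2)])
  from chart_deriv_compose[OF elim(1) c chart_transition_regular(1)[OF assms(2) elim(2) c] this]
  show ?case using chart_transition_regular(2)[OF assms(2) elim(2) c] by blast
qed

lemma germ_deriv_expansion:
  assumes "rs_meromorphic_on u {z}" "surface_chart z = (D, \<phi>)"
  shows "(\<lambda>w. deriv (u \<circ> inv_into D \<phi>) (\<phi> z + w)) has_laurent_expansion fls_deriv (germ z u)"
proof -
  have "((\<lambda>w. g (a + w)) has_field_derivative E) (at w) \<longleftrightarrow> (g has_field_derivative E) (at (a + w))"
    for g :: "complex \<Rightarrow> complex" and a E w
    using DERIV_shift[of g E w a] by (simp add: add.commute)
  then have "deriv (\<lambda>w. (u \<circ> inv_into D \<phi>) (\<phi> z + w)) = (\<lambda>w. deriv (u \<circ> inv_into D \<phi>) (\<phi> z + w))"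
    unfolding deriv_def by presburger
  then show ?thesis
    using has_laurent_expansion_deriv[OF germ_expansion[OF assms]] by simp
qed

text \<open>
  The factor \<open>chart_deriv \<phi> x\<close> relating the two charts at \<open>x\<close> cancels in a quotient.
\<close>

lemma chart_deriv_ratio:
  assumes u: "rs_meromorphic_on u {z}" and v: "rs_meromorphic_on v {z}"
  shows "rs_meromorphic_on (\<lambda>x. chart_deriv u x / chart_deriv v x) {z}"
    and "germ z (\<lambda>x. chart_deriv u x / chart_deriv v x) = fls_deriv (germ z u) / fls_deriv (germ z v)"
proof -
  let ?f = "\<lambda>x. chart_deriv u x / chart_deriv v x"
  have eq: "eventually (\<lambda>w. (?f \<circ> inv_into D \<phi>) w =
      deriv (u \<circ> inv_into D \<phi>) w / deriv (v \<circ> inv_into D \<phi>) w) (at (\<phi> z))"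
    if c: "(D, \<phi>) \<in> atlas" "z \<in> D" for D \<phi>
    unfolding eventually_at_chart'[OF c]
    using chart_deriv_in_chart[OF u c] chart_deriv_in_chart[OF v c] eventually_in_chart[OF c]
    by eventually_elim (simp add: chart_inverse[OF c(1)])
  show "rs_meromorphic_on ?f {z}"
    unfolding rs_meromorphic_at_iff
  proof (intro allI impI)
    fix D \<phi> assume c: "(D, \<phi>) \<in> atlas" "z \<in> D"
    have "(\<lambda>w. deriv (u \<circ> inv_into D \<phi>) w / deriv (v \<circ> inv_into D \<phi>) w) meromorphic_on {\<phi> z}"
      using rs_meromorphic_atD[OF u c] rs_meromorphic_atD[OF v c] by (intro meromorphic_intros)
    then show "(?f \<circ> inv_into D \<phi>) meromorphic_on {\<phi> z}"
      by (subst meromorphic_on_cong[OF _ refl]) (use eq[OF c] in auto)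
  qed
  obtain D \<phi> where c: "surface_chart z = (D, \<phi>)" "(D, \<phi>) \<in> atlas" "z \<in> D"
    by (rule surface_chart_obtain)
  have "germ z ?f = laurent_expansion (\<lambda>w. deriv (u \<circ> inv_into D \<phi>) w / deriv (v \<circ> inv_into D \<phi>) w) (\<phi> z)"
    using eq[OF c(2,3)] c(1) by (auto simp: germ_def intro!: laurent_expansion_cong)
  also have "\<dots> = fls_deriv (germ z u) / fls_deriv (germ z v)"
    by (rule laurent_expansion_eqI, rule has_laurent_expansion_divide)
       (rule germ_deriv_expansion[OF u c(1)], rule germ_deriv_expansion[OF v c(1)])
  finally show "germ z ?f = fls_deriv (germ z u) / fls_deriv (germ z v)" .
qed

lemma chart_deriv_nonzero_nearby:
  assumes "rs_meromorphic_on u {z}" "\<And>c. germ z u \<noteq> fls_const c"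
  shows "eventually (\<lambda>x. chart_deriv u x \<noteq> 0) (at z)"
proof -
  obtain D \<phi> where c: "surface_chart z = (D, \<phi>)" "(D, \<phi>) \<in> atlas" "z \<in> D"
    by (rule surface_chart_obtain)
  have "fls_deriv (germ z u) \<noteq> 0" 
    using assms(2)[of "fls_nth (germ z u) 0"] fls_deriv_eq_0_iff[of "germ z u"] by blast
  then have "eventually (\<lambda>w. deriv (u \<circ> inv_into D \<phi>) w \<noteq> 0) (at (\<phi> z))"
    by (rule has_laurent_expansion_eventually_nonzero_iff[OF germ_deriv_expansion[OF assms(1) c(1)], THEN iffD2])
  then have "eventually (\<lambda>x. deriv (u \<circ> inv_into D \<phi>) (\<phi> x) \<noteq> 0) (at z)"
    by (simp add: eventually_at_chart'[OF c(2,3)])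
  then show ?thesis
    using chart_deriv_in_chart[OF assms(1) c(2,3)] by eventually_elim simp
qed

lemma germ_eq_const_iff:
  assumes "rs_meromorphic_on u {z}"
  shows "germ z u = fls_const c \<longleftrightarrow> eventually (\<lambda>x. u x = c) (at z)"
  using germ_eq_iff[OF assms rs_meromorphic_on_const[of c]] by (simp add: germ_const)

section \<open>Morphisms\<close>

lemma rs_morphism_in_charts:
  assumes "rs_morphism h" "(D, \<phi>) \<in> atlas" "(D', \<phi>') \<in> atlas" "z \<in> D" "h z \<in> D'"
  shows "((\<phi>' \<circ> h) \<circ> inv_into D \<phi>) analytic_on {\<phi> z}"
proof (rule holomorphic_on_chart_imp_analytic_at[OF assms(2)])
  show "(\<phi>' \<circ> h \<circ> inv_into D \<phi>) holomorphic_on \<phi> ` (D \<inter> h -` D')"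
    using assms(1-3) unfolding rs_morphism_def by blast
  show "open (h -` D')"
    using assms(1) chart_open[OF assms(3)] unfolding rs_morphism_def
    by (auto intro: open_vimage)
qed (use assms in auto)

lemma rs_morphism_eventually_in_open:
  assumes "rs_morphism h" "open T" "h z \<in> T"
  shows "eventually (\<lambda>x. h x \<in> T) (nhds z)"
proof -
  have "open (h -` T)" using assms unfolding rs_morphism_def by (auto intro: open_vimage)
  then show ?thesis using assms(3) eventually_nhds_in_open[of "h -` T" z] by simp
qed

lemma rs_meromorphic_at_compose:
  assumes h: "rs_morphism h" and u: "rs_meromorphic_on u {h z}"
  shows "rs_meromorphic_on (u \<circ> h) {z}"
  unfolding rs_meromorphic_at_iff
proof (intro allI impI)
  fix D \<phi> assume c: "(D, \<phi>) \<in> atlas" "z \<in> D"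
  obtain D' \<phi>' where c': "surface_chart (h z) = (D', \<phi>')" "(D', \<phi>') \<in> atlas" "h z \<in> D'"
    by (rule surface_chart_obtain)
  have "(\<lambda>w. (u \<circ> inv_into D' \<phi>') (((\<phi>' \<circ> h) \<circ> inv_into D \<phi>) w)) meromorphic_on {\<phi> z}"
    by (rule meromorphic_on_compose[OF rs_meromorphic_atD[OF u c'(2,3)] rs_morphism_in_charts[OF h c(1) c'(2) c(2) c'(3)]])
       (simp add: chart_inverse[OF c])
  moreover have "eventually (\<lambda>w. (u \<circ> h \<circ> inv_into D \<phi>) w =
      (u \<circ> inv_into D' \<phi>') (((\<phi>' \<circ> h) \<circ> inv_into D \<phi>) w)) (at (\<phi> z))"
  proof -
    have "eventually (\<lambda>x. h x \<in> D') (at z)"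
      using rs_morphism_eventually_in_open[OF h chart_open[OF c'(2)] c'(3)]
      by (simp add: eventually_nhds_conv_at)
    then have "eventually (\<lambda>x. u (h x) = u (inv_into D' \<phi>' (\<phi>' (h x)))) (at z)"
      by (rule eventually_mono) (simp add: chart_inverse[OF c'(2)])
    then show ?thesis by (simp add: eventually_at_chart[OF c])
  qed
  ultimately show "(u \<circ> h \<circ> inv_into D \<phi>) meromorphic_on {\<phi> z}"
    using meromorphic_on_cong[OF _ refl, of "{\<phi> z}" "u \<circ> h \<circ> inv_into D \<phi>"
        "\<lambda>w. (u \<circ> inv_into D' \<phi>') (((\<phi>' \<circ> h) \<circ> inv_into D \<phi>) w)"] by simp
qed

lemma rs_meromorphic_on_chart:
  assumes "(D, \<phi>) \<in> atlas" "z \<in> D"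
  shows "rs_meromorphic_on \<phi> {z}"
  unfolding rs_meromorphic_at_iff
proof (intro allI impI)
  fix D' \<phi>' assume c: "(D', \<phi>') \<in> atlas" "z \<in> D'"
  have "(\<phi> \<circ> inv_into D' \<phi>') analytic_on {\<phi>' z}"
    by (rule holomorphic_on_chart_imp_analytic_at[OF c(1) chart_transition[OF c(1) assms(1)]
          chart_open[OF assms(1)] c(2) assms(2)])
  then show "(\<phi> \<circ> inv_into D' \<phi>') meromorphic_on {\<phi>' z}"
    by (rule analytic_on_imp_meromorphic_on)
qed

lemma rs_morphism_tendsto:
  assumes "rs_morphism h"
  shows "(h \<longlongrightarrow> h z) (at z)"
  using assms unfolding rs_morphism_def continuous_on_def by auto

lemma chart_isCont:
  assumes "(D, \<phi>) \<in> atlas" "z \<in> D"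
  shows "isCont \<phi> z"
  unfolding isCont_def tendsto_def
proof (intro allI impI)
  fix T assume "open T" "\<phi> z \<in> T"
  then have "eventually (\<lambda>w. w \<in> T) (at (\<phi> z))" by (rule eventually_at_in_open')
  then show "eventually (\<lambda>x. \<phi> x \<in> T) (at z)"
    by (simp add: eventually_at_chart'[OF assms])
qed

text \<open>
  In a chart around \<open>h z\<close>, the alternative is whether the germ of \<open>h\<close> is constant; if it is not, then \<open>h\<close>
  is moreover a local isomorphism at all points near \<open>z\<close>.
\<close>

lemma rs_morphism_local_dichotomy:
  fixes h :: "'a::riemann_surface \<Rightarrow> 'b::riemann_surface"
  assumes h: "rs_morphism h" and c: "(D, \<phi>) \<in> atlas" "h z \<in> D"
  shows "if germ z (\<phi> \<circ> h) = fls_const (\<phi> (h z)) then eventually (\<lambda>x. h x = h z) (nhds z)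
    else eventually (\<lambda>x. h x \<noteq> h z) (at z) \<and> eventually (\<lambda>x. chart_deriv (\<phi> \<circ> h) x \<noteq> 0) (at z)"
proof -
  let ?u = "\<phi> \<circ> h"
  have u: "rs_meromorphic_on ?u {z}"
    by (rule rs_meromorphic_at_compose[OF h rs_meromorphic_on_chart[OF c]])
  have D: "eventually (\<lambda>x. h x \<in> D) (at z)"
    using rs_morphism_eventually_in_open[OF h chart_open[OF c(1)] c(2)]
    by (simp add: eventually_nhds_conv_at)
  show ?thesis
  proof (cases "germ z ?u = fls_const (\<phi> (h z))")
    case True
    then have "eventually (\<lambda>x. ?u x = \<phi> (h z)) (at z)" by (simp add: germ_eq_const_iff[OF u])
    with D have "eventually (\<lambda>x. h x = h z) (at z)"
      by eventually_elim (use chart_inj[OF c(1)] c(2) in \<open>auto simp: inj_on_eq_iff\<close>)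
    with True show ?thesis by (simp add: eventually_nhds_conv_at)
  next
    case False
    have "rs_meromorphic_on (\<lambda>x. ?u x - \<phi> (h z)) {z}"
      using u by (intro rs_meromorphic_intros)
    moreover have "germ z (\<lambda>x. ?u x - \<phi> (h z)) \<noteq> 0"
      using False germ_diff[OF u rs_meromorphic_on_const] by (simp add: germ_const)
    ultimately have "eventually (\<lambda>x. ?u x - \<phi> (h z) \<noteq> 0) (at z)" using germ_neq_0_iff by blast
    then have "eventually (\<lambda>x. h x \<noteq> h z) (at z)" by (rule eventually_mono) auto
    moreover have "eventually (\<lambda>x. chart_deriv ?u x \<noteq> 0) (at z)"
    proof (rule chart_deriv_nonzero_nearby[OF u])
      fix e show "germ z ?u \<noteq> fls_const e"
      proof
        assume e: "germ z ?u = fls_const e"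
        then have ev: "eventually (\<lambda>x. ?u x = e) (at z)" by (simp add: germ_eq_const_iff[OF u])
        have "(?u \<longlongrightarrow> \<phi> (h z)) (at z)"
          unfolding o_def by (rule isCont_tendsto_compose[OF chart_isCont[OF c] rs_morphism_tendsto[OF h]])
        moreover have "(?u \<longlongrightarrow> e) (at z)" using ev by (rule tendsto_eventually)
        ultimately have "e = \<phi> (h z)"
          using tendsto_unique[OF at_surface_neq_bot] by blast
        with e False show False by simp
      qed
    qed
    ultimately show ?thesis using False by simp
  qed
qed

lemma chart_deriv_locally_constant:
  assumes "eventually (\<lambda>x. u x = c) (nhds z)"
  shows "chart_deriv u z = 0"
proof -
  obtain D \<phi> where c: "surface_chart z = (D, \<phi>)" "(D, \<phi>) \<in> atlas" "z \<in> D"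
    by (rule surface_chart_obtain)
  show ?thesis
    using chart_deriv_compose[where g = "\<lambda>_. c" and k = \<phi>, OF _ c(1) chart_transition_regular(1)[OF c(2,3,1)] assms]
    by simp
qed

lemma connected_surface_dichotomy:
  fixes A :: "'a::riemann_surface set"
  assumes "open A" "open (- A)"
  shows "A = {} \<or> A = UNIV"
  using connectedD[OF connected_surface assms] by auto

text \<open>
  The set of points near which \<open>h\<close> is constant is open, and so is its complement, as the derivative of \<open>h\<close>
  does not vanish near a point of the complement. By connectedness, the set is empty or \<open>h\<close> is constant.
\<close>

lemma branched_cover_eventually_neq:
  fixes h :: "'a::compact_riemann_surface \<Rightarrow> 'b::compact_riemann_surface"
  assumes "branched_cover h"
  shows "eventually (\<lambda>x. h x \<noteq> h z) (at z)"
proof -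
  let ?A = "{z. eventually (\<lambda>x. h x = h z) (nhds z)}"
  have h: "rs_morphism h" and nonconst: "\<not> h constant_on UNIV"
    using assms by (auto simp: branched_cover_def)
  have notA: "eventually (\<lambda>x. h x \<noteq> h z) (at z) \<and> eventually (\<lambda>x. x \<notin> ?A) (at z)" if "z \<notin> ?A" for z
  proof -
    obtain D \<phi> where c: "surface_chart (h z) = (D, \<phi>)" "(D, \<phi>) \<in> atlas" "h z \<in> D"
      by (rule surface_chart_obtain)
    have *: "eventually (\<lambda>x. h x \<noteq> h z) (at z)" "eventually (\<lambda>x. chart_deriv (\<phi> \<circ> h) x \<noteq> 0) (at z)"
      using rs_morphism_local_dichotomy[OF h c(2,3)] that by (auto split: if_splits)
    from *(2) have "eventually (\<lambda>x. x \<notin> ?A) (at z)"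
    proof (rule eventually_mono)
      fix x assume x: "chart_deriv (\<phi> \<circ> h) x \<noteq> 0"
      show "x \<notin> ?A"
      proof
        assume "x \<in> ?A"
        then have "eventually (\<lambda>y. h y = h x) (nhds x)" by simp
        then have "eventually (\<lambda>y. (\<phi> \<circ> h) y = \<phi> (h x)) (nhds x)"
          by (rule eventually_mono) simp
        with x show False using chart_deriv_locally_constant by blast
      qed
    qed
    with * show ?thesis by blast
  qed
  have "open ?A"
  proof (subst open_subopen, rule ballI)
    fix z assume "z \<in> ?A"
    then obtain S where S: "open S" "z \<in> S" "\<And>x. x \<in> S \<Longrightarrow> h x = h z"
      by (auto simp: eventually_nhds)
    have "S \<subseteq> ?A"
    proof
      fix x assume "x \<in> S"
      then have "eventually (\<lambda>y. y \<in> S) (nhds x)" using S(1) eventually_nhds_in_open by blast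
      then have "eventually (\<lambda>y. h y = h x) (nhds x)"
        by (rule eventually_mono) (use S(3) \<open>x \<in> S\<close> in simp)
      then show "x \<in> ?A" by simp
    qed
    with S show "\<exists>T. open T \<and> z \<in> T \<and> T \<subseteq> ?A" by blast
  qed
  moreover have "open (- ?A)"
  proof (subst open_subopen, rule ballI)
    fix z assume z: "z \<in> - ?A"
    then have "eventually (\<lambda>x. x \<in> - ?A) (nhds z)"
      using notA[of z] by (auto simp: eventually_nhds_conv_at)
    then show "\<exists>T. open T \<and> z \<in> T \<and> T \<subseteq> - ?A" unfolding eventually_nhds by blast
  qed
  ultimately have "?A = {} \<or> ?A = UNIV"
    by (rule connected_surface_dichotomy)
  moreover have "?A \<noteq> UNIV"
  proof
    assume A: "?A = UNIV"
    let ?L = "{x. h x = h z}"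
    have "open ?L"
    proof (subst open_subopen, rule ballI)
      fix x assume "x \<in> ?L"
      moreover have "eventually (\<lambda>y. h y = h x) (nhds x)" using A by auto
      ultimately show "\<exists>T. open T \<and> x \<in> T \<and> T \<subseteq> ?L" unfolding eventually_nhds by auto
    qed
    moreover have "open (h -` (- {h z}))"
      using h unfolding rs_morphism_def by (intro open_vimage) auto
    then have "open (- ?L)" by (simp add: vimage_def Collect_neg_eq)
    ultimately have "?L = {} \<or> ?L = UNIV" by (intro connected_surface_dichotomy)
    then have "h constant_on UNIV" unfolding constant_on_def by blast
    with nonconst show False by simp
  qed
  ultimately show ?thesis using notA by blast
qed

lemma branched_cover_filterlim:
  assumes "branched_cover h"
  shows "filterlim h (at (h z)) (at z)"
  using branched_cover_eventually_neq[OF assms] assms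
  by (auto simp: filterlim_at branched_cover_def intro: rs_morphism_tendsto)

text \<open>
  Preimages of sparse sets are sparse: identities off sparse sets can be pulled back.
\<close>

lemma branched_cover_eventually:
  assumes "branched_cover h" "eventually P (at (h z))"
  shows "eventually (\<lambda>x. P (h x)) (at z)"
  using branched_cover_filterlim[OF assms(1)] assms(2) by (auto simp: filterlim_iff)

lemma rs_morphism_compose:
  assumes g: "rs_morphism g" and h: "rs_morphism h"
  shows "rs_morphism (g \<circ> h)"
  unfolding rs_morphism_def
proof (rule conjI)
  show "continuous_on UNIV (g \<circ> h)"
    using g h unfolding rs_morphism_def
    by (intro continuous_on_compose) (auto intro: continuous_on_subset)
  have "(\<phi>' \<circ> (g \<circ> h) \<circ> inv_into D \<phi>) analytic_on {\<phi> z}"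
    if c: "(D, \<phi>) \<in> atlas" "(D', \<phi>') \<in> atlas" "z \<in> D" "g (h z) \<in> D'" for D \<phi> D' \<phi>' z
  proof -
    obtain E \<epsilon> where e: "surface_chart (h z) = (E, \<epsilon>)" "(E, \<epsilon>) \<in> atlas" "h z \<in> E"
      by (rule surface_chart_obtain)
    have eq: "eventually (\<lambda>w. (\<phi>' \<circ> (g \<circ> h) \<circ> inv_into D \<phi>) w =
        ((\<phi>' \<circ> g \<circ> inv_into E \<epsilon>) \<circ> (\<epsilon> \<circ> h \<circ> inv_into D \<phi>)) w) (nhds (\<phi> z))"
    proof -
      have "eventually (\<lambda>x. h x \<in> E) (nhds z)"
        by (rule rs_morphism_eventually_in_open[OF h chart_open[OF e(2)] e(3)])
      then have "eventually (\<lambda>x. \<phi>' (g (h x)) = \<phi>' (g (inv_into E \<epsilon> (\<epsilon> (h x))))) (nhds z)"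
        by (rule eventually_mono) (simp add: chart_inverse[OF e(2)])
      then show ?thesis by (simp add: eventually_nhds_chart[OF c(1,3)])
    qed
    have "(\<phi>' \<circ> g \<circ> inv_into E \<epsilon>) analytic_on {\<epsilon> (h z)}"
      by (rule rs_morphism_in_charts[OF g e(2) c(2) e(3) c(4)])
    then have "((\<phi>' \<circ> g \<circ> inv_into E \<epsilon>) \<circ> (\<epsilon> \<circ> h \<circ> inv_into D \<phi>)) analytic_on {\<phi> z}"
      using rs_morphism_in_charts[OF h c(1) e(2) c(3) e(3)]
      by (intro analytic_on_compose) (simp_all add: chart_inverse[OF c(1,3)])
    then show ?thesis
      by (rule analytic_at_cong[OF eq refl, THEN iffD2])
  qed
  then have "(\<phi>' \<circ> (g \<circ> h) \<circ> inv_into D \<phi>) analytic_on \<phi> ` (D \<inter> (g \<circ> h) -` D')"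
    if "(D, \<phi>) \<in> atlas" "(D', \<phi>') \<in> atlas" for D \<phi> D' \<phi>'
    using that by (subst analytic_on_analytic_at) auto
  then show "\<forall>(D, \<phi>)\<in>atlas. \<forall>(D', \<phi>')\<in>atlas.
       (\<phi>' \<circ> (g \<circ> h) \<circ> inv_into D \<phi>) holomorphic_on \<phi> ` (D \<inter> (g \<circ> h) -` D')"
    by (blast intro: analytic_imp_holomorphic)
qed

lemma branched_cover_compose:
  assumes g: "branched_cover g" and h: "branched_cover h"
  shows "branched_cover (g \<circ> h)"
proof -
  have "\<not> (g \<circ> h) constant_on UNIV"
  proof
    assume "(g \<circ> h) constant_on UNIV"
    then obtain c where c: "\<And>x. g (h x) = c" by (auto simp: constant_on_def)
    have "eventually (\<lambda>x. g (h x) \<noteq> g (h undefined)) (at undefined)"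
      by (rule branched_cover_eventually[OF h branched_cover_eventually_neq[OF g]])
    then show False by (simp add: c at_surface_neq_bot)
  qed
  then show ?thesis
    using g h rs_morphism_compose unfolding branched_cover_def by blast
qed

lemma branched_cover_id: "branched_cover (id :: 'a::compact_riemann_surface \<Rightarrow> 'a)"
proof -
  have "rs_morphism (id :: 'a \<Rightarrow> 'a)"
    using chart_transition unfolding rs_morphism_def by (auto simp: continuous_on_id)
  moreover have "\<not> (id :: 'a \<Rightarrow> 'a) constant_on UNIV"
  proof
    assume "(id :: 'a \<Rightarrow> 'a) constant_on UNIV"
    then obtain c where "\<And>x :: 'a. x = c" by (auto simp: constant_on_def)
    then have "(UNIV :: 'a set) = {c}" by auto
    then show False using not_open_singleton[of c] by (metis open_UNIV)
  qed
  ultimately show ?thesis by (simp add: branched_cover_def)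
qed

section \<open>Global meromorphic functions\<close>

lemma rep_mero_meromorphic: "rs_meromorphic_on (rep_mero a) U"
proof -
  have "rs_meromorphic_on (rep_mero a) UNIV"
    using Quotient_rep_reflp[OF Quotient_mero, of a] by simp
  then show ?thesis by (rule rs_meromorphic_on_subset) simp
qed

lemma rep_abs_mero:
  assumes "rs_meromorphic_on u UNIV"
  shows "eventually (\<lambda>x. rep_mero (abs_mero u) x = u x) (at z)"
proof -
  have "\<forall>\<^sub>\<approx>x. rep_mero (abs_mero u) x = u x"
    using Quotient_rep_abs[OF Quotient_mero, of u] assms by simp
  then show ?thesis by (simp add: eventually_cosparse_open_eq)
qed

lemma mero_eqI:
  assumes "\<And>z. eventually (\<lambda>x. rep_mero a x = rep_mero b x) (at z)"
  shows "a = b"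
  using Quotient_rel_rep[OF Quotient_mero, of a b] assms
  by (simp add: eventually_cosparse_open_eq rep_mero_meromorphic)

lemma
  shows rep_mero_add: "eventually (\<lambda>x. rep_mero (a + b) x = rep_mero a x + rep_mero b x) (at z)"
    and rep_mero_mult: "eventually (\<lambda>x. rep_mero (a * b) x = rep_mero a x * rep_mero b x) (at z)"
    and rep_mero_one: "eventually (\<lambda>x. rep_mero 1 x = 1) (at z)"
    and rep_mero_zero: "eventually (\<lambda>x. rep_mero 0 x = 0) (at z)"
    and rep_mero_const: "eventually (\<lambda>x. rep_mero (mero_const c) x = c) (at z)"
  unfolding plus_mero_def times_mero_def one_mero_def zero_mero_def mero_const_def map_fun_def o_def id_def
  by (intro rep_abs_mero rs_meromorphic_intros rep_mero_meromorphic)+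

lemma rep_mero_eq_const_imp:
  assumes "eventually (\<lambda>x. rep_mero a x = c) (at z)"
  shows "a = mero_const c"
proof (rule ccontr)
  assume neq: "a \<noteq> mero_const c"
  have "\<not> (\<forall>\<^sub>\<approx>x. rep_mero a x - c = 0)"
  proof
    assume "\<forall>\<^sub>\<approx>x. rep_mero a x - c = 0"
    then have *: "eventually (\<lambda>x. rep_mero a x = c) (at z)" for z by (simp add: eventually_cosparse_open_eq)
    have "a = mero_const c"
    proof (rule mero_eqI)
      show "eventually (\<lambda>x. rep_mero a x = rep_mero (mero_const c) x) (at z)" for z
        using *[of z] rep_mero_const[of c z] by eventually_elim simp
    qed
    with neq show False by simp
  qed
  then have "\<forall>\<^sub>\<approx>x. rep_mero a x - c \<noteq> 0"
    by (intro rs_meromorphic_identity rs_meromorphic_intros rep_mero_meromorphic)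
  then have "eventually (\<lambda>x. \<not> rep_mero a x = c) (at z)" by (simp add: eventually_cosparse_open_eq)
  with assms show False by (rule eventually_at_surface_not_False)
qed

lemma rs_meromorphic_pullback:
  assumes "branched_cover q"
  shows "rs_meromorphic_on (rep_mero a \<circ> q) U"
  using rs_meromorphic_at_compose[OF _ rep_mero_meromorphic, of q a] assms
  by (intro rs_meromorphic_on_pointwise[THEN iffD2]) (auto simp: branched_cover_def)

lemma rep_pull:
  assumes "branched_cover q"
  shows "eventually (\<lambda>x. rep_mero (pull q a) x = rep_mero a (q x)) (at z)"
  using rep_abs_mero[OF rs_meromorphic_pullback[OF assms]] by (simp add: pull_def)

lemma germ_pullback_eq_0_iff:
  assumes "branched_cover q"
  shows "germ z (rep_mero a \<circ> q) = 0 \<longleftrightarrow> a = 0"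
proof
  assume "a = 0"
  have "eventually (\<lambda>x. (rep_mero a \<circ> q) x = 0) (at z)"
    using branched_cover_eventually[OF assms rep_mero_zero] \<open>a = 0\<close> by simp
  then show "germ z (rep_mero a \<circ> q) = 0"
    by (simp add: germ_eq_0_iff[OF rs_meromorphic_pullback[OF assms]])
next
  assume 0: "germ z (rep_mero a \<circ> q) = 0"
  show "a = 0"
  proof (cases "germ (q z) (rep_mero a) = 0")
    case True
    then have "a = mero_const 0"
      using germ_eq_0_iff[OF rep_mero_meromorphic, of "q z" a] rep_mero_eq_const_imp by blast
    also have "\<dots> = 0" by (simp add: mero_const_def zero_mero_def)
    finally show ?thesis .
  next
    case False
    then have "eventually (\<lambda>x. rep_mero a x \<noteq> 0) (at (q z))"
      using germ_neq_0_iff[OF rep_mero_meromorphic] by blast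
    then have "eventually (\<lambda>x. \<not> (rep_mero a \<circ> q) x = 0) (at z)"
      using branched_cover_eventually[OF assms] by simp
    moreover have "eventually (\<lambda>x. (rep_mero a \<circ> q) x = 0) (at z)"
      using 0 germ_eq_0_iff[OF rs_meromorphic_pullback[OF assms]] by blast
    ultimately show ?thesis using eventually_at_surface_not_False by blast
  qed
qed

section \<open>Derivations on covers\<close>

definition germ_derivation ::
    "('a::compact_riemann_surface \<Rightarrow> 'b::compact_riemann_surface) \<Rightarrow> ('b mero \<Rightarrow> 'b mero) \<Rightarrow> 'a \<Rightarrow>
      complex fls \<Rightarrow> complex fls"
  where "germ_derivation q \<delta> z F = (let t = (SOME t. \<delta> t \<noteq> 0)
    in germ z (rep_mero (\<delta> t) \<circ> q) / fls_deriv (germ z (rep_mero t \<circ> q)) * fls_deriv F)"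

text \<open>
  The restriction of the extended derivation to global functions, where it is an actual derivation of
  the field.
\<close>

definition mero_derivation ::
    "('a::compact_riemann_surface \<Rightarrow> 'b::compact_riemann_surface) \<Rightarrow> ('b mero \<Rightarrow> 'b mero) \<Rightarrow> 'a mero \<Rightarrow> 'a mero"
  where "mero_derivation q \<delta> a = abs_mero (extended_derivation q \<delta> (rep_mero a))"

locale derived_cover =
  fixes q :: "'a::compact_riemann_surface \<Rightarrow> 'b::compact_riemann_surface"
    and \<delta> :: "'b mero \<Rightarrow> 'b mero"
  assumes cover: "branched_cover q" and nontrivial: "nontrivial_derivation \<delta>"
begin

text \<open>
  The variable used in the definition of \<^const>\<open>extended_derivation\<close>.
\<close>

definition "t = (SOME t. \<delta> t \<noteq> 0)"

lemma delta_t: "\<delta> t \<noteq> 0"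
  unfolding t_def by (rule someI_ex) (use nontrivial in \<open>simp add: nontrivial_derivation_def\<close>)

text \<open>
  A function with non-zero derivative is not constant, and neither is its pullback by a branched cover.
\<close>

lemma derivative_t:
  shows "germ z (rep_mero t \<circ> q) \<noteq> fls_const c"
    and "eventually (\<lambda>x. chart_deriv (rep_mero t \<circ> q) x \<noteq> 0) (at z)"
    and "fls_deriv (germ z (rep_mero t \<circ> q)) \<noteq> 0"
proof -
  show *: "germ z (rep_mero t \<circ> q) \<noteq> fls_const c" for c
  proof
    assume "germ z (rep_mero t \<circ> q) = fls_const c"
    then have c: "eventually (\<lambda>x. (rep_mero t \<circ> q) x = c) (at z)"
      by (simp add: germ_eq_const_iff[OF rs_meromorphic_pullback[OF cover]])
    have "eventually (\<lambda>x. rep_mero t (q x) - rep_mero (mero_const c) (q x) = 0) (at z)"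
      using c branched_cover_eventually[OF cover rep_mero_const[of c]] by eventually_elim simp
    moreover have "eventually (\<lambda>x. rep_mero (t - mero_const c) (q x) + rep_mero (mero_const c) (q x) = rep_mero t (q x)) (at z)"
      using branched_cover_eventually[OF cover rep_mero_add[of "t - mero_const c" "mero_const c"]]
      by (rule eventually_mono) simp
    ultimately have "eventually (\<lambda>x. (rep_mero (t - mero_const c) \<circ> q) x = 0) (at z)"
      by eventually_elim simp
    then have "t - mero_const c = 0"
      using germ_eq_0_iff[OF rs_meromorphic_pullback[OF cover]] germ_pullback_eq_0_iff[OF cover] by blast
    then have "\<delta> t = 0"
      using nontrivial by (simp add: nontrivial_derivation_def derivation_def)
    with delta_t show False by simp
  qed
  then show "eventually (\<lambda>x. chart_deriv (rep_mero t \<circ> q) x \<noteq> 0) (at z)"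
    by (intro chart_deriv_nonzero_nearby rs_meromorphic_pullback[OF cover])
  show "fls_deriv (germ z (rep_mero t \<circ> q)) \<noteq> 0"
    using *[of "fls_nth (germ z (rep_mero t \<circ> q)) 0"] fls_deriv_eq_0_iff[of "germ z (rep_mero t \<circ> q)"] by blast
qed

abbreviation "D \<equiv> extended_derivation q \<delta>"
abbreviation "germ_D \<equiv> germ_derivation q \<delta>"

lemma D_eq: "D u = (\<lambda>x. (rep_mero (\<delta> t) \<circ> q) x * (chart_deriv u x / chart_deriv (rep_mero t \<circ> q) x))"
  by (rule ext) (simp add: extended_derivation_def Let_def flip: t_def)

lemma germ_D_eq: "germ_D z F = germ z (rep_mero (\<delta> t) \<circ> q) / fls_deriv (germ z (rep_mero t \<circ> q)) * fls_deriv F"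
  by (simp add: germ_derivation_def Let_def flip: t_def)

lemma D_meromorphic:
  assumes "rs_meromorphic_on u {z}"
  shows "rs_meromorphic_on (D u) {z}" "germ z (D u) = germ_D z (germ z u)"
proof -
  note t = rs_meromorphic_pullback[OF cover]
  note ratio = chart_deriv_ratio[OF assms t[of t]]
  show "rs_meromorphic_on (D u) {z}"
    unfolding D_eq by (intro rs_meromorphic_intros t ratio)
  show "germ z (D u) = germ_D z (germ z u)"
    unfolding D_eq germ_D_eq using germ_mult[OF t ratio(1)] ratio(2) by simp
qed

lemma D_iterate_meromorphic:
  assumes "rs_meromorphic_on u {z}"
  shows "rs_meromorphic_on ((D ^^ k) u) {z}" "germ z ((D ^^ k) u) = (germ_D z ^^ k) (germ z u)"
proof -
  have "rs_meromorphic_on ((D ^^ k) u) {z} \<and> germ z ((D ^^ k) u) = (germ_D z ^^ k) (germ z u)"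
    by (induction k) (simp_all add: assms D_meromorphic)
  then show "rs_meromorphic_on ((D ^^ k) u) {z}" "germ z ((D ^^ k) u) = (germ_D z ^^ k) (germ z u)"
    by auto
qed

sublocale germ: field_derivation "germ_D z" for z
proof
  fix F G :: "complex fls"
  have "K * (F' + G') = K * F' + K * G'" "K * (F * G' + F' * G) = K * F' * G + F * (K * G')"
    for K F' G' :: "complex fls"
    by (simp_all add: algebra_simps)
  then show "germ_D z (F + G) = germ_D z F + germ_D z G"
    and "germ_D z (F * G) = germ_D z F * G + F * germ_D z G"
    unfolding germ_D_eq fls_deriv_add fls_deriv_mult by blast+
qed

lemma germ_D_eq_0_iff: "germ_D z F = 0 \<longleftrightarrow> (\<exists>c. F = fls_const c)"
proof -
  have "germ z (rep_mero (\<delta> t) \<circ> q) \<noteq> 0" using delta_t germ_pullback_eq_0_iff[OF cover] by blast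
  then have "germ_D z F = 0 \<longleftrightarrow> fls_deriv F = 0" using derivative_t(3) by (simp add: germ_D_eq)
  then show ?thesis using fls_deriv_eq_0_iff[of F] by auto
qed

end

section \<open>The chain rule along morphisms\<close>

lemma chart_deriv_along_morphism:
  assumes h: "branched_cover h" and u: "rs_meromorphic_on u {h z}"
    and c: "(D, \<phi>) \<in> atlas" "h z \<in> D"
  shows "eventually (\<lambda>x. chart_deriv (u \<circ> h) x = deriv (u \<circ> inv_into D \<phi>) (\<phi> (h x)) * chart_deriv (\<phi> \<circ> h) x \<and>
    chart_deriv u (h x) = deriv (u \<circ> inv_into D \<phi>) (\<phi> (h x)) * chart_deriv \<phi> (h x) \<and>
    chart_deriv \<phi> (h x) \<noteq> 0) (at z)"
  using branched_cover_eventually[OF h rs_meromorphic_at_imp_analytic_nearby[OF u c]]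
    branched_cover_eventually[OF h chart_deriv_in_chart[OF u c]]
    branched_cover_eventually[OF h eventually_in_chart[OF c]]
proof eventually_elim
  case (elim x)
  have hm: "rs_morphism h" using h by (simp add: branched_cover_def)
  obtain D' \<phi>' where c': "surface_chart x = (D', \<phi>')" "(D', \<phi>') \<in> atlas" "x \<in> D'"
    by (rule surface_chart_obtain)
  have "eventually (\<lambda>y. h y \<in> D) (nhds x)"
    by (rule rs_morphism_eventually_in_open[OF hm chart_open[OF c(1)] elim(3)])
  then have "eventually (\<lambda>y. (u \<circ> h) y = (u \<circ> inv_into D \<phi>) ((\<phi> \<circ> h) y)) (nhds x)"
    by (rule eventually_mono) (simp add: chart_inverse[OF c(1)])
  moreover have "(u \<circ> inv_into D \<phi>) analytic_on {(\<phi> \<circ> h) x}" using elim(1) by simp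
  ultimately have "chart_deriv (u \<circ> h) x = deriv (u \<circ> inv_into D \<phi>) ((\<phi> \<circ> h) x) * chart_deriv (\<phi> \<circ> h) x"
    by (intro chart_deriv_compose[OF _ c'(1) rs_morphism_in_charts[OF hm c'(2) c(1) c'(3) elim(3)]])
  with elim(2) show ?case by simp
qed

text \<open>
  The factor \<open>\<kappa>\<close> with \<open>\<delta> (u \<circ> h) = \<kappa> * (\<delta>' u \<circ> h)\<close>, found by taking for \<open>u\<close> the variable of \<open>\<delta>'\<close>.
\<close>

definition chain_factor ::
    "('a::compact_riemann_surface \<Rightarrow> 'b::compact_riemann_surface) \<Rightarrow> ('b mero \<Rightarrow> 'b mero) \<Rightarrow>
     ('c::compact_riemann_surface \<Rightarrow> 'd::compact_riemann_surface) \<Rightarrow> ('d mero \<Rightarrow> 'd mero) \<Rightarrow>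
     ('a \<Rightarrow> 'c) \<Rightarrow> 'a mero"
  where "chain_factor q \<delta> q' \<delta>' h = (let t = (SOME t. \<delta>' t \<noteq> 0) in
    abs_mero (\<lambda>x. extended_derivation q \<delta> (rep_mero t \<circ> (q' \<circ> h)) x / (rep_mero (\<delta>' t) \<circ> (q' \<circ> h)) x))"

lemma derived_cover_compose:
  assumes "derived_cover q' \<delta>" "branched_cover q"
  shows "derived_cover (q' \<circ> q) \<delta>"
  using assms branched_cover_compose unfolding derived_cover_def by blast

lemma (in derived_cover) delta_t_nonzero_nearby: "eventually (\<lambda>x. rep_mero (\<delta> t) (q x) \<noteq> 0) (at z)"
  using germ_pullback_eq_0_iff[OF cover, of z "\<delta> t"] delta_t
    germ_neq_0_iff[OF rs_meromorphic_pullback[OF cover], of z "\<delta> t"] by simp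

text \<open>
  Both sides are multiples of \<open>du/dt'\<close> at \<open>h x\<close>: the derivatives of \<open>\<phi> \<circ> h\<close> and of \<open>\<phi>\<close> cancel in quotients.
  The derivative of \<open>\<phi> \<circ> h\<close> is non-zero near \<open>z\<close> because that of \<open>t' \<circ> q' \<circ> h\<close> is.
\<close>

lemma extended_derivation_chain:
  assumes A: "derived_cover q \<delta>" and B: "derived_cover q' \<delta>'" and h: "branched_cover h"
    and u: "rs_meromorphic_on u {h z}"
  shows "eventually (\<lambda>x. extended_derivation q \<delta> (u \<circ> h) x =
    rep_mero (chain_factor q \<delta> q' \<delta>' h) x * extended_derivation q' \<delta>' u (h x)) (at z)"
proof -
  interpret A: derived_cover q \<delta> by (rule A)
  interpret B: derived_cover q' \<delta>' by (rule B)
  interpret C: derived_cover "q' \<circ> h" \<delta>' by (rule derived_cover_compose[OF B h])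
  obtain D \<phi> where c: "surface_chart (h z) = (D, \<phi>)" "(D, \<phi>) \<in> atlas" "h z \<in> D"
    by (rule surface_chart_obtain)
  let ?v = "rep_mero B.t \<circ> q'"
  let ?\<kappa> = "\<lambda>x. A.D (?v \<circ> h) x / rep_mero (\<delta>' B.t) (q' (h x))"
  have v: "rs_meromorphic_on (?v \<circ> h) U" for U
    using rs_meromorphic_pullback[OF C.cover] by (simp add: comp_assoc)
  have "rs_meromorphic_on ?\<kappa> {z}" for z
    using rs_meromorphic_on_divide[OF A.D_meromorphic(1)[OF v] rs_meromorphic_pullback[OF C.cover, of "\<delta>' B.t"]]
    by (simp add: o_def)
  note \<kappa>_mero = this
  have \<kappa>: "eventually (\<lambda>x. rep_mero (chain_factor q \<delta> q' \<delta>' h) x = ?\<kappa> x) (at z)"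
    unfolding chain_factor_def Let_def B.t_def[symmetric] comp_assoc[symmetric] comp_apply
    by (rule rep_abs_mero[OF rs_meromorphic_onI[OF \<kappa>_mero[unfolded comp_apply]]])
  have nz: "eventually (\<lambda>x. chart_deriv (?v \<circ> h) x \<noteq> 0) (at z)"
    using C.derivative_t(2)[of z] by (simp only: comp_assoc)
  have nz': "eventually (\<lambda>x. rep_mero (\<delta>' B.t) (q' (h x)) \<noteq> 0) (at z)"
    using C.delta_t_nonzero_nearby[of z] by (simp only: comp_apply)
  from \<kappa> nz nz' A.derivative_t(2)[of z]
    chart_deriv_along_morphism[OF h u c(2,3)]
    chart_deriv_along_morphism[OF h rs_meromorphic_pullback[OF B.cover] c(2,3), of B.t]
  show ?thesis
  proof eventually_elim
    case (elim x)
    then show ?case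
      unfolding elim(1) A.D_eq B.D_eq by (auto simp: field_simps)
  qed
qed

text \<open>
  For extensions of one derivation \<open>\<delta>\<close> of the base, the factor is 1: both use the same variable \<open>t\<close>.
\<close>

lemma extended_derivation_pullback:
  assumes B: "derived_cover q' \<delta>" and h: "branched_cover h" and u: "rs_meromorphic_on u {h z}"
  shows "eventually (\<lambda>x. extended_derivation (q' \<circ> h) \<delta> (u \<circ> h) x = extended_derivation q' \<delta> u (h x)) (at z)"
proof -
  interpret B: derived_cover q' \<delta> by (rule B)
  interpret C: derived_cover "q' \<circ> h" \<delta> by (rule derived_cover_compose[OF B h])
  obtain D \<phi> where c: "surface_chart (h z) = (D, \<phi>)" "(D, \<phi>) \<in> atlas" "h z \<in> D"
    by (rule surface_chart_obtain)
  have nz: "eventually (\<lambda>x. chart_deriv ((rep_mero B.t \<circ> q') \<circ> h) x \<noteq> 0) (at z)"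
    using C.derivative_t(2)[of z] by (simp only: comp_assoc)
  from nz chart_deriv_along_morphism[OF h u c(2,3)]
    chart_deriv_along_morphism[OF h rs_meromorphic_pullback[OF B.cover] c(2,3), of B.t]
  show ?thesis
    by eventually_elim (auto simp: C.D_eq B.D_eq comp_assoc[symmetric])
qed

lemma germ_pullback_add:
  assumes q: "branched_cover q"
  shows "germ z (rep_mero (a + b) \<circ> q) = germ z (rep_mero a \<circ> q) + germ z (rep_mero b \<circ> q)"
proof -
  have "germ z (rep_mero (a + b) \<circ> q) = germ z (\<lambda>x. (rep_mero a \<circ> q) x + (rep_mero b \<circ> q) x)"
    using branched_cover_eventually[OF q rep_mero_add] by (intro germ_cong) simp
  then show ?thesis by (simp only: germ_add rs_meromorphic_pullback[OF q])
qed

lemma germ_pullback_mult: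
  assumes q: "branched_cover q"
  shows "germ z (rep_mero (a * b) \<circ> q) = germ z (rep_mero a \<circ> q) * germ z (rep_mero b \<circ> q)"
proof -
  have "germ z (rep_mero (a * b) \<circ> q) = germ z (\<lambda>x. (rep_mero a \<circ> q) x * (rep_mero b \<circ> q) x)"
    using branched_cover_eventually[OF q rep_mero_mult] by (intro germ_cong) simp
  then show ?thesis by (simp only: germ_mult rs_meromorphic_pullback[OF q])
qed

lemma germ_pullback_one:
  assumes q: "branched_cover q"
  shows "germ z (rep_mero 1 \<circ> q) = 1"
proof -
  have "germ z (rep_mero 1 \<circ> q) = germ z (\<lambda>_. 1)"
    using branched_cover_eventually[OF q rep_mero_one] by (intro germ_cong) simp
  then show ?thesis by (simp add: germ_const)
qed

lemma germ_pullback_eq_iff: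
  assumes q: "branched_cover q"
  shows "germ z (rep_mero a \<circ> q) = germ z (rep_mero b \<circ> q) \<longleftrightarrow> a = b"
  using germ_pullback_add[OF q, of z "a - b" b] germ_pullback_eq_0_iff[OF q, of z "a - b"] by simp

lemma germ_pull:
  assumes "branched_cover p" "branched_cover q"
  shows "germ z (rep_mero (pull p a) \<circ> q) = germ z (rep_mero a \<circ> (p \<circ> q))"
  using branched_cover_eventually[OF assms(2) rep_pull[OF assms(1)]] by (intro germ_cong) simp

lemma germ_mero_derivation:
  assumes B: "derived_cover q' \<delta>" and q: "branched_cover q"
  shows "germ z (rep_mero (mero_derivation q' \<delta> a) \<circ> q) =
    germ_derivation (q' \<circ> q) \<delta> z (germ z (rep_mero a \<circ> q))"
proof -
  interpret B: derived_cover q' \<delta> by (rule B)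
  interpret C: derived_cover "q' \<circ> q" \<delta> by (rule derived_cover_compose[OF B q])
  have "eventually (\<lambda>x. rep_mero (mero_derivation q' \<delta> a) x = B.D (rep_mero a) x) (at z)" for z
    unfolding mero_derivation_def
    by (rule rep_abs_mero[OF rs_meromorphic_onI[OF B.D_meromorphic(1)[OF rep_mero_meromorphic]]])
  from branched_cover_eventually[OF q this] extended_derivation_pullback[OF B q rep_mero_meromorphic[of a]]
  have "eventually (\<lambda>x. (rep_mero (mero_derivation q' \<delta> a) \<circ> q) x = C.D (rep_mero a \<circ> q) x) (at z)"
    by eventually_elim simp
  then have "germ z (rep_mero (mero_derivation q' \<delta> a) \<circ> q) = germ z (C.D (rep_mero a \<circ> q))"
    by (rule germ_cong)
  also have "\<dots> = C.germ_D z (germ z (rep_mero a \<circ> q))"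
    by (rule C.D_meromorphic(2)[OF rs_meromorphic_pullback[OF q]])
  finally show ?thesis .
qed

text \<open>
  The germs at one point are a differential extension field of the global functions; in particular the
  derivation laws for global functions can be checked on germs.
\<close>

lemma germ_pullback_hom:
  assumes B: "derived_cover q' \<delta>" and q: "branched_cover q"
  shows "differential_field_hom (mero_derivation q' \<delta>) (germ_derivation (q' \<circ> q) \<delta> z)
    (\<lambda>a. germ z (rep_mero a \<circ> q))"
proof -
  interpret C: derived_cover "q' \<circ> q" \<delta> by (rule derived_cover_compose[OF B q])
  note hom = germ_pullback_add[OF q] germ_pullback_mult[OF q] germ_mero_derivation[OF B q]
  show ?thesis
  proof
    show "mero_derivation q' \<delta> (a + b) = mero_derivation q' \<delta> a + mero_derivation q' \<delta> b" for a b
      using germ_pullback_eq_iff[OF q] by (metis hom C.germ.d_add)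
    show "mero_derivation q' \<delta> (a * b) = mero_derivation q' \<delta> a * b + a * mero_derivation q' \<delta> b" for a b
      using germ_pullback_eq_iff[OF q] by (metis hom C.germ.d_mult)
  qed (simp_all add: hom germ_pullback_one[OF q])
qed

lemma germ_hom:
  assumes "derived_cover q \<delta>"
  shows "differential_field_hom (mero_derivation q \<delta>) (germ_derivation q \<delta> z) (\<lambda>a. germ z (rep_mero a))"
  using germ_pullback_hom[OF assms branched_cover_id] by simp

lemma (in derived_cover) germ_operator:
  assumes "rs_meromorphic_on w {z}" "branched_cover q1"
  shows "rs_meromorphic_on (\<lambda>x. \<Sum>k\<in>I. rep_mero (b k) (q1 x) * (D ^^ k) w x) {z}"
    and "germ z (\<lambda>x. \<Sum>k\<in>I. rep_mero (b k) (q1 x) * (D ^^ k) w x) =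
      (\<Sum>k\<in>I. germ z (rep_mero (b k) \<circ> q1) * (germ_D z ^^ k) (germ z w))"
proof -
  note m = rs_meromorphic_pullback[OF assms(2)] and D = D_iterate_meromorphic[OF assms(1)]
  have *: "rs_meromorphic_on (\<lambda>x. (rep_mero (b k) \<circ> q1) x * (D ^^ k) w x) {z}" for k
    by (intro rs_meromorphic_intros m D)
  then show "rs_meromorphic_on (\<lambda>x. \<Sum>k\<in>I. rep_mero (b k) (q1 x) * (D ^^ k) w x) {z}"
    by (intro rs_meromorphic_on_sum) simp
  show "germ z (\<lambda>x. \<Sum>k\<in>I. rep_mero (b k) (q1 x) * (D ^^ k) w x) =
      (\<Sum>k\<in>I. germ z (rep_mero (b k) \<circ> q1) * (germ_D z ^^ k) (germ z w))"
    using germ_sum[where I = I and u = "\<lambda>k x. rep_mero (b k) (q1 x) * (D ^^ k) w x" and z = z] *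
      germ_mult[OF m D(1)] D(2) by simp
qed

lemma (in derived_cover) lode_solution_iff_germ:
  "lode_solution D n b U w \<longleftrightarrow> open U \<and> rs_meromorphic_on w U \<and>
    (\<forall>z\<in>U. (germ_D z ^^ n) (germ z w) + (\<Sum>k<n. germ z (rep_mero (b k)) * (germ_D z ^^ k) (germ z w)) = 0)"
proof -
  have "eventually (\<lambda>x. (D ^^ n) w x + (\<Sum>k<n. rep_mero (b k) x * (D ^^ k) w x) = 0) (at z) \<longleftrightarrow>
      (germ_D z ^^ n) (germ z w) + (\<Sum>k<n. germ z (rep_mero (b k)) * (germ_D z ^^ k) (germ z w)) = 0"
    if "rs_meromorphic_on w U" "z \<in> U" for z
  proof -
    have w: "rs_meromorphic_on w {z}" using that rs_meromorphic_on_subset by blast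
    note D = D_iterate_meromorphic[OF w, of n]
      and op = germ_operator[OF w branched_cover_id, where I = "{..<n}" and b = b, simplified]
    show ?thesis
      using germ_eq_0_iff[OF rs_meromorphic_on_add[OF D(1) op(1)]] germ_add[OF D(1) op(1)] D(2) op(2)
      by simp
  qed
  then show ?thesis
    unfolding lode_solution_def by (auto simp: eventually_cosparse_open_eq)
qed

section \<open>Pulling back solutions\<close>

lemma germ_chain:
  assumes A: "derived_cover q \<delta>" and B: "derived_cover q' \<delta>'" and h: "branched_cover h"
    and u: "rs_meromorphic_on u {h z}"
  shows "germ_derivation q \<delta> z (germ z (u \<circ> h)) =
    germ z (rep_mero (chain_factor q \<delta> q' \<delta>' h)) * germ z (extended_derivation q' \<delta>' u \<circ> h)"
proof -
  interpret A: derived_cover q \<delta> by (rule A)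
  interpret B: derived_cover q' \<delta>' by (rule B)
  have hm: "rs_morphism h" using h by (simp add: branched_cover_def)
  have "germ_derivation q \<delta> z (germ z (u \<circ> h)) = germ z (A.D (u \<circ> h))"
    using A.D_meromorphic(2)[OF rs_meromorphic_at_compose[OF hm u]] by simp
  also have "\<dots> = germ z (\<lambda>x. rep_mero (chain_factor q \<delta> q' \<delta>' h) x * (B.D u \<circ> h) x)"
    using extended_derivation_chain[OF A B h u] by (intro germ_cong) simp
  also have "\<dots> = germ z (rep_mero (chain_factor q \<delta> q' \<delta>' h)) * germ z (B.D u \<circ> h)"
    by (intro germ_mult rep_mero_meromorphic rs_meromorphic_at_compose[OF hm] B.D_meromorphic u)
  finally show ?thesis .
qed

lemma germ_pullback_derivation:
  assumes B: "derived_cover q' \<delta>" and h: "branched_cover h" and u: "rs_meromorphic_on u {h z}"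
  shows "germ_derivation (q' \<circ> h) \<delta> z (germ z (u \<circ> h)) = germ z (extended_derivation q' \<delta> u \<circ> h)"
proof -
  interpret C: derived_cover "q' \<circ> h" \<delta> by (rule derived_cover_compose[OF B h])
  have hm: "rs_morphism h" using h by (simp add: branched_cover_def)
  show ?thesis
    using C.D_meromorphic(2)[OF rs_meromorphic_at_compose[OF hm u]]
      germ_cong[OF extended_derivation_pullback[OF B h u, folded comp_apply[of _ h]]] by (simp add: o_def)
qed

section \<open>Pulling back solutions\<close>

lemma germ_pullback_solution:
  assumes B: "derived_cover q' \<delta>'" and h: "branched_cover h"
    and u: "lode_solution (extended_derivation q' \<delta>') n a U u" "h z \<in> U"
  defines "X \<equiv> \<lambda>j. germ z ((extended_derivation q' \<delta>' ^^ j) u \<circ> h)"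
  shows "X n + (\<Sum>j<n. germ z (rep_mero (a j) \<circ> h) * X j) = 0"
proof -
  interpret B: derived_cover q' \<delta>' by (rule B)
  have hm: "rs_morphism h" using h by (simp add: branched_cover_def)
  have "rs_meromorphic_on u {h z}"
    using u rs_meromorphic_on_subset unfolding lode_solution_def by blast
  then have X: "rs_meromorphic_on ((B.D ^^ j) u \<circ> h) {z}" for j
    by (intro rs_meromorphic_at_compose[OF hm] B.D_iterate_meromorphic)
  note m = rs_meromorphic_on_mult[OF rs_meromorphic_pullback[OF h] X]
  have "eventually (\<lambda>y. (B.D ^^ n) u y + (\<Sum>k<n. rep_mero (a k) y * (B.D ^^ k) u y) = 0) (at (h z))"
    using u by (auto simp: lode_solution_def intro: eventually_cosparse_imp_eventually_at)
  from branched_cover_eventually[OF h this]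
  have "germ z (\<lambda>x. ((B.D ^^ n) u \<circ> h) x + (\<Sum>k<n. (rep_mero (a k) \<circ> h) x * ((B.D ^^ k) u \<circ> h) x)) = germ z (\<lambda>_. 0)"
    by (intro germ_cong) simp
  also have "germ z (\<lambda>x. ((B.D ^^ n) u \<circ> h) x + (\<Sum>k<n. (rep_mero (a k) \<circ> h) x * ((B.D ^^ k) u \<circ> h) x)) =
      X n + (\<Sum>j<n. germ z (\<lambda>x. (rep_mero (a j) \<circ> h) x * ((B.D ^^ j) u \<circ> h) x))"
    unfolding X_def
    by (subst germ_add[OF X rs_meromorphic_on_sum[OF m]], subst germ_sum[OF m]) simp
  also have "(\<Sum>j<n. germ z (\<lambda>x. (rep_mero (a j) \<circ> h) x * ((B.D ^^ j) u \<circ> h) x)) =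
      (\<Sum>j<n. germ z (rep_mero (a j) \<circ> h) * X j)"
    unfolding X_def by (intro sum.cong refl germ_mult rs_meromorphic_pullback[OF h] X)
  finally show ?thesis by (simp add: germ_const)
qed

text \<open>
  The constants of the field of germs are the complex numbers. A combination with complex coefficients
  that vanishes near \<open>z\<close> after pullback vanishes near \<open>h z\<close>, and hence on the connected set \<open>U\<close>.
\<close>

lemma fundamental_system_germs_independent:
  fixes y :: "'c::compact_riemann_surface \<Rightarrow> complex ^ 'n"
  assumes A: "derived_cover q \<delta>" and h: "branched_cover h"
    and y: "fundamental_system D' a U y" "h z \<in> U"
  shows "field_derivation.const_independent (germ_derivation q \<delta> z) UNIV (\<lambda>i. germ z ((\<lambda>x. y x $ i) \<circ> h))"
proof -
  interpret A: derived_cover q \<delta> by (rule A)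
  have hm: "rs_morphism h" using h by (simp add: branched_cover_def)
  have U: "open U" "connected U" and hol: "\<And>i. rs_holomorphic_on (\<lambda>x. y x $ i) U"
    and indep: "\<And>c :: complex ^ 'n. (\<forall>\<^sub>\<approx>x\<in>U. (\<Sum>i\<in>UNIV. c $ i * y x $ i) = 0) \<Longrightarrow> c = 0"
    using y(1) unfolding fundamental_system_def by blast+
  have mero: "rs_meromorphic_on (\<lambda>x. y x $ i) U" for i
    by (rule rs_holomorphic_imp_meromorphic_on[OF hol U(1)])
  show ?thesis
    unfolding A.germ.const_independent_def
  proof (intro allI impI, elim conjE)
    fix c :: "'n \<Rightarrow> complex fls"
    assume "\<forall>i\<in>UNIV. A.germ_D z (c i) = 0"
      and sum: "(\<Sum>i\<in>UNIV. c i * germ z ((\<lambda>x. y x $ i) \<circ> h)) = 0"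
    then have "\<forall>i. \<exists>e. c i = fls_const e" by (simp add: A.germ_D_eq_0_iff)
    then obtain e where c: "\<And>i. c i = fls_const (e i)" by metis
    define g where "g x = (\<Sum>i\<in>UNIV. e i * y x $ i)" for x
    have g: "rs_meromorphic_on g U"
      unfolding g_def by (intro rs_meromorphic_on_sum rs_meromorphic_intros mero)
    have yh: "rs_meromorphic_on ((\<lambda>x. y x $ i) \<circ> h) {z}" for i
      using rs_meromorphic_at_compose[OF hm rs_meromorphic_on_subset[OF mero]] y(2) by blast
    have "germ z (g \<circ> h) = (\<Sum>i\<in>UNIV. germ z (\<lambda>x. e i * ((\<lambda>x. y x $ i) \<circ> h) x))"
      using germ_sum[where I = UNIV and u = "\<lambda>i x. e i * y (h x) $ i" and z = z]
        rs_meromorphic_on_mult[OF rs_meromorphic_on_const yh] by (simp add: g_def o_def)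
    also have "\<dots> = (\<Sum>i\<in>UNIV. c i * germ z ((\<lambda>x. y x $ i) \<circ> h))"
      using germ_mult[OF rs_meromorphic_on_const yh] by (simp add: c germ_const)
    finally have "germ z (g \<circ> h) = 0" using sum by simp
    moreover have "rs_meromorphic_on (g \<circ> h) {z}"
      using rs_meromorphic_at_compose[OF hm rs_meromorphic_on_subset[OF g]] y(2) by blast
    ultimately have zero: "eventually (\<lambda>x. g (h x) = 0) (at z)" using germ_eq_0_iff by force
    have "\<not> (\<forall>x\<in>U. germ x g \<noteq> 0)"
    proof
      assume "\<forall>x\<in>U. germ x g \<noteq> 0"
      then have "eventually (\<lambda>x. g x \<noteq> 0) (at (h z))"
        using y(2) germ_neq_0_iff[OF rs_meromorphic_on_subset[OF g]] by blast
      from branched_cover_eventually[OF h this] zero show False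
        by (rule eventually_at_surface_not_False[rotated])
    qed
    then have "\<forall>x\<in>U. germ x g = 0" using meromorphic_connected_dichotomy[OF g U(2,1)] by blast
    then have "eventually (\<lambda>w. g w = 0) (at x)" if "x \<in> U" for x
      using that germ_eq_0_iff[OF rs_meromorphic_on_subset[OF g]] by blast
    then have "\<forall>\<^sub>\<approx>x\<in>U. g x = 0" by (simp add: eventually_cosparse_open_eq U(1))
    then have "(\<chi> i. e i) = 0" by (intro indep) (simp add: g_def)
    then have "e i = 0" for i by (metis vec_lambda_beta zero_index)
    then show "\<forall>i\<in>UNIV. c i = 0" by (simp add: c)
  qed
qed

section \<open>Curves in projective space\<close>

text \<open>
  The projective space of a line is a single point and has no chain of two irreducible closed subsets.
\<close>

lemma algebraic_curve_dimension_ge_2: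
  fixes C :: "'n::finite proj_point set"
  assumes "algebraic_curve C"
  shows "2 \<le> CARD('n)"
proof (rule ccontr)
  assume "\<not> 2 \<le> CARD('n)"
  moreover have "CARD('n) \<noteq> 0" by simp
  ultimately have "CARD('n) = 1" by linarith
  then obtain i where i: "(UNIV :: 'n set) = {i}" by (rule card_1_singletonE)
  have "proj_pt v = UNIV" if "v \<noteq> 0" for v :: "complex ^ 'n"
  proof -
    have eq: "u = w" if "u $ i = w $ i" for u w :: "complex ^ 'n"
      using that i by (metis UNIV_I singletonD vec_eq_iff)
    have "v $ i \<noteq> 0" using that eq[of v 0] by auto
    then have "w = (w $ i / v $ i) *s v" for w by (intro eq) simp
    then show ?thesis unfolding proj_pt_def vec.span_singleton by blast
  qed
  then have space: "p = UNIV" if "p \<in> proj_space" for p :: "'n proj_point"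
    using that unfolding proj_space_def by blast
  have sub: "Z \<subseteq> proj_space" if "zariski_closed Z" for Z :: "'n proj_point set"
    using that unfolding zariski_closed_def by blast
  have closed: "Z = {UNIV}" if "zariski_closed Z" "Z \<noteq> {}" for Z :: "'n proj_point set"
    using sub[OF that(1)] space that(2) by blast
  have C: "zariski_closed C" "C \<noteq> {}" "C = {UNIV}"
    using assms closed unfolding algebraic_curve_def by blast+
  have "zariski_irreducible C"
    unfolding zariski_irreducible_def
  proof (intro conjI C allI impI)
    fix A B assume AB: "zariski_closed A \<and> zariski_closed B \<and> C = A \<union> B"
    then show "C = A \<or> C = B"
      using closed[of A] closed[of B] C by (cases "A = {}") auto
  qed
  then have "irreducible_component C C" unfolding irreducible_component_def by blast
  then have "has_dimension C 1" using assms unfolding algebraic_curve_def by blast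
  then obtain Y where Y: "irreducible_chain C 1 Y" unfolding has_dimension_def by blast
  then have "zariski_irreducible (Y 0)" "zariski_irreducible (Y 1)" "Y 0 \<subset> Y 1"
    unfolding irreducible_chain_def by auto
  then have "Y 0 = {UNIV}" "Y 1 = {UNIV}" by (auto simp: zariski_irreducible_def closed)
  with \<open>Y 0 \<subset> Y 1\<close> show False by simp
qed

section \<open>The relation between the two equations\<close>

text \<open>
  The two fundamental systems live on different surfaces; the relation links their pullbacks to the
  surface of \<open>E\<^sub>1\<close>.
\<close>

locale solution_transfer =
  fixes \<delta>\<^sub>C :: "'c1::compact_riemann_surface mero \<Rightarrow> 'c1 mero" and a :: "nat \<Rightarrow> 'c1 mero"
    and U\<^sub>C :: "'c1 set" and y :: "'c1 \<Rightarrow> complex ^ 'n"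
    and \<delta> :: "'x0::compact_riemann_surface mero \<Rightarrow> 'x0 mero" and l :: "nat \<Rightarrow> 'x0 mero"
    and U :: "'x0 set" and x :: "'x0 \<Rightarrow> complex ^ 'n"
    and p :: "'e::compact_riemann_surface \<Rightarrow> 'x0" and f\<^sub>E :: "nat \<Rightarrow> 'e mero"
    and q :: "'e1::compact_riemann_surface \<Rightarrow> 'e" and h :: "'e1 \<Rightarrow> 'c1"
    and V :: "'e1 set" and r :: "'e1 \<Rightarrow> complex"
  assumes order_ge_2: "2 \<le> CARD('n)"
    and \<delta>\<^sub>C: "nontrivial_derivation \<delta>\<^sub>C"
    and y: "fundamental_system (extended_derivation id \<delta>\<^sub>C) a U\<^sub>C y"
    and \<delta>: "nontrivial_derivation \<delta>"
    and x: "fundamental_system (extended_derivation id \<delta>) l U x"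
    and p: "branched_cover p" and q: "branched_cover q" and h_morphism: "rs_morphism h"
    and V: "open V" "connected V" "V \<noteq> {}" "V \<subseteq> (p \<circ> q) -` U" "V \<subseteq> h -` U\<^sub>C"
    and r: "rs_holomorphic_on r V"
    and relation: "\<And>i. \<forall>\<^sub>\<approx>z\<in>V. x (p (q z)) $ i
            + (\<Sum>j=1..CARD('n) - 2. rep_mero (f\<^sub>E j) (q z)
              * (extended_derivation (p \<circ> q) \<delta> ^^ j) (\<lambda>z. x (p (q z)) $ i) z)
          = r z * y (h z) $ i"
begin

sublocale X0: derived_cover id \<delta>
  by standard (rule branched_cover_id \<delta>)+

sublocale C1: derived_cover id \<delta>\<^sub>C
  by standard (rule branched_cover_id \<delta>\<^sub>C)+

sublocale E: derived_cover p \<delta>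
  by standard (rule p \<delta>)+

sublocale E1: derived_cover "p \<circ> q" \<delta>
  by standard (rule branched_cover_compose[OF p q] \<delta>)+

abbreviation "x_comp i \<equiv> (\<lambda>z. x z $ i)"
abbreviation "y_comp i \<equiv> (\<lambda>z. y z $ i)"

text \<open>
  The vector of derivatives of the \<open>i\<close>-th solution of \<open>L\<close>, at a point of the top cover.
\<close>

definition X :: "'n \<Rightarrow> nat \<Rightarrow> 'e1 \<Rightarrow> complex fls"
  where "X i j z = germ z ((X0.D ^^ j) (x_comp i) \<circ> (p \<circ> q))"

text \<open>
  Both sides of the given relation, by lemma \<open>w_eq\<close> below.
\<close>

definition w :: "'n \<Rightarrow> 'e1 \<Rightarrow> complex fls"
  where "w i z = germ z r * germ z (y_comp i \<circ> h)"

text \<open>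
  The row of the operator \<open>1 + f\<^sub>1 \<delta> + \<dots> + f\<^bsub>n-2\<^esub> \<delta>\<^bsup>n-2\<^esup>\<close>; its entry at \<open>n - 1\<close> is 0, which makes the kernel of the
  operator have codimension at least 2 in the solution space of \<open>L\<close>.
\<close>

definition v :: "nat \<Rightarrow> 'e mero"
  where "v j = (if j = 0 then 1 else if j \<le> CARD('n) - 2 then f\<^sub>E j else 0)"

lemma x_meromorphic: "z \<in> V \<Longrightarrow> rs_meromorphic_on (x_comp i) {p (q z)}"
  using x V(4) rs_meromorphic_on_subset[of "x_comp i" U "{p (q z)}"]
  by (auto simp: fundamental_system_def lode_solution_def)

lemma x_pullback_meromorphic: "z \<in> V \<Longrightarrow> rs_meromorphic_on (x_comp i \<circ> (p \<circ> q)) {z}"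
  using rs_meromorphic_at_compose[of "p \<circ> q" "x_comp i" z] E1.cover x_meromorphic
  by (auto simp: branched_cover_def)

lemma y_meromorphic: "z \<in> V \<Longrightarrow> rs_meromorphic_on (y_comp i) {h z}"
  using y V(5) rs_meromorphic_on_subset[of "y_comp i" U\<^sub>C "{h z}"]
  by (auto simp: fundamental_system_def lode_solution_def)

lemma y_pullback_meromorphic: "z \<in> V \<Longrightarrow> rs_meromorphic_on (y_comp i \<circ> h) {z}"
  by (rule rs_meromorphic_at_compose[OF h_morphism y_meromorphic])

lemma r_meromorphic: "z \<in> V \<Longrightarrow> rs_meromorphic_on r {z}"
  using rs_holomorphic_imp_meromorphic_on[OF r V(1)] rs_meromorphic_on_subset by blast

lemma X_derivative:
  assumes "z \<in> V"
  shows "E1.germ_D z (X i j z) = X i (Suc j) z"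
  using germ_pullback_derivation[OF X0.derived_cover_axioms E1.cover, of "(X0.D ^^ j) (x_comp i)" z]
    X0.D_iterate_meromorphic(1)[of "x_comp i"] x_meromorphic[OF assms]
  by (simp add: X_def id_comp)

lemma X_iterate:
  assumes "z \<in> V"
  shows "X i j z = (E1.germ_D z ^^ j) (germ z (x_comp i \<circ> (p \<circ> q)))"
proof (induction j)
  case 0
  show ?case by (simp only: X_def funpow_0)
next
  case (Suc j)
  have "(f ^^ Suc j) F = f ((f ^^ j) F)" for f and F :: "complex fls" by simp
  then show ?case unfolding X_derivative[OF assms, symmetric] Suc.IH by (rule sym)
qed

lemma X_solution:
  assumes "z \<in> V"
  shows "X i CARD('n) z + (\<Sum>j<CARD('n). germ z (rep_mero ((pull p \<circ> l) j) \<circ> q) * X i j z) = 0"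
  using germ_pullback_solution[OF X0.derived_cover_axioms E1.cover, of "CARD('n)" l U "x_comp i" z] x assms V(4)
  by (auto simp: fundamental_system_def X_def germ_pull[OF p q])

lemma E_hom: "differential_field_hom (mero_derivation p \<delta>) (E1.germ_D z) (\<lambda>b. germ z (rep_mero b \<circ> q))"
  by (rule germ_pullback_hom[OF E.derived_cover_axioms q])

lemma X_companion:
  assumes "z \<in> V"
  shows "differential_field_hom.companion (E1.germ_D z) (\<lambda>b. germ z (rep_mero b \<circ> q)) 1 CARD('n) (pull p \<circ> l) (\<lambda>j. X i j z)"
proof -
  interpret H: differential_field_hom "mero_derivation p \<delta>" "E1.germ_D z" "\<lambda>b. germ z (rep_mero b \<circ> q)"
    by (rule E_hom)
  show ?thesis
    using X_derivative[OF assms] X_solution[OF assms] by (simp add: H.companion_def)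
qed

lemma w_eq:
  assumes z: "z \<in> V"
  shows "w i z = (\<Sum>j<CARD('n). germ z (rep_mero (v j) \<circ> q) * X i j z)"
proof -
  interpret H: differential_field_hom "mero_derivation p \<delta>" "E1.germ_D z" "\<lambda>b. germ z (rep_mero b \<circ> q)"
    by (rule E_hom)
  let ?x = "x_comp i \<circ> (p \<circ> q)"
  note m = x_pullback_meromorphic[OF z, of i]
  note op = E1.germ_operator[OF m q, where I = "{1..CARD('n) - 2}" and b = f\<^sub>E]
  have "eventually (\<lambda>z. ?x z + (\<Sum>j=1..CARD('n) - 2. rep_mero (f\<^sub>E j) (q z) * (E1.D ^^ j) ?x z)
      = r z * (y_comp i \<circ> h) z) (at z)"
    using eventually_cosparse_imp_eventually_at[OF relation[of i] z] by (simp add: o_def)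
  then have "germ z (\<lambda>z. ?x z + (\<Sum>j=1..CARD('n) - 2. rep_mero (f\<^sub>E j) (q z) * (E1.D ^^ j) ?x z)) = w i z"
    unfolding w_def germ_mult[OF r_meromorphic[OF z] y_pullback_meromorphic[OF z], symmetric]
    by (rule germ_cong)
  then have "w i z = X i 0 z + (\<Sum>j=1..CARD('n) - 2. germ z (rep_mero (f\<^sub>E j) \<circ> q) * X i j z)"
    using germ_add[OF m op(1)] op(2) X_iterate[OF z] by simp
  also have "\<dots> = (\<Sum>j\<in>insert 0 {1..CARD('n) - 2}. germ z (rep_mero (v j) \<circ> q) * X i j z)"
    by (simp add: v_def)
  also have "\<dots> = (\<Sum>j<CARD('n). germ z (rep_mero (v j) \<circ> q) * X i j z)"
    using order_ge_2 by (intro sum.mono_neutral_left) (auto simp: v_def)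
  finally show ?thesis .
qed

lemma x_independent:
  assumes "z \<in> V"
  shows "field_derivation.const_independent (E1.germ_D z) UNIV (\<lambda>i. X i 0 z)"
  using fundamental_system_germs_independent[OF E1.derived_cover_axioms E1.cover x, of z] assms V(4)
  by (auto simp: X_def)

lemma w_not_rank_one:
  assumes z: "z \<in> V"
  shows "\<not> (\<forall>i. w i z = fls_const (c i) * \<rho>)"
proof
  assume w: "\<forall>i. w i z = fls_const (c i) * \<rho>"
  interpret H: differential_field_hom "mero_derivation p \<delta>" "E1.germ_D z" "\<lambda>b. germ z (rep_mero b \<circ> q)"
    by (rule E_hom)
  let ?a = "\<lambda>j. germ z (rep_mero (v j) \<circ> q)"
  have v_top: "v (CARD('n) - 1) = 0" using order_ge_2 by (simp add: v_def)
  have "(\<Sum>j<CARD('n) - 1. ?a j * (E1.germ_D z ^^ j) (X i 0 z)) = fls_const (c i) * \<rho>" for i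
  proof -
    have "w i z = (\<Sum>j<Suc (CARD('n) - 1). ?a j * X i j z)" using w_eq[OF z] order_ge_2 by simp
    also have "\<dots> = (\<Sum>j<CARD('n) - 1. ?a j * X i j z)"
      unfolding sum.lessThan_Suc v_top by simp
    also have "\<dots> = (\<Sum>j<CARD('n) - 1. ?a j * (E1.germ_D z ^^ j) (X i 0 z))"
      by (simp add: X_iterate[OF z])
    finally show ?thesis using w by simp
  qed
  moreover have "E1.germ_D z (fls_const (c i)) = 0" for i by (auto simp: E1.germ_D_eq_0_iff)
  moreover have "?a 0 \<noteq> 0" by (simp add: v_def)
  ultimately have "\<not> E1.germ.const_independent z UNIV (\<lambda>i. X i 0 z)"
    using order_ge_2
    by (intro E1.germ.low_order_image_not_rank_one[where n = "CARD('n) - 1" and a = ?a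
          and c = "\<lambda>i. fls_const (c i)" and \<rho> = \<rho>]) auto
  with x_independent[OF z] show False by simp
qed

text \<open>
  If \<open>h\<close> were constant, all \<open>w i\<close> would be constant multiples of \<open>r\<close>. The same argument shows that \<open>r\<close>
  does not vanish identically.
\<close>

lemma h: "branched_cover h"
proof (rule ccontr)
  assume "\<not> branched_cover h"
  then obtain c where c: "\<And>z. h z = c"
    using h_morphism by (auto simp: branched_cover_def constant_on_def)
  obtain z where z: "z \<in> V" using V(3) by blast
  have "y_comp i \<circ> h = (\<lambda>_. y c $ i)" for i by (rule ext) (simp add: c)
  then have "\<forall>i. w i z = fls_const (y c $ i) * germ z r"
    by (simp add: w_def germ_const mult.commute)
  with w_not_rank_one[OF z] show False by blast
qed

lemma r_nonzero:
  assumes "z \<in> V"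
  shows "germ z r \<noteq> 0"
proof
  assume "germ z r = 0"
  with w_not_rank_one[OF assms, of "\<lambda>_. 0" 0] show False by (simp add: w_def)
qed

lemma y_independent:
  assumes "z \<in> V"
  shows "field_derivation.const_independent (E1.germ_D z) UNIV (\<lambda>i. germ z (y_comp i \<circ> h))"
  using fundamental_system_germs_independent[OF E1.derived_cover_axioms h y, of z] assms V(5) by auto

lemma w_independent:
  assumes "z \<in> V"
  shows "field_derivation.const_independent (E1.germ_D z) UNIV (\<lambda>i. w i z)"
  unfolding w_def by (rule E1.germ.const_independent_scale[OF y_independent[OF assms] r_nonzero[OF assms]])

definition "gauge_rows = row_iterate (mero_derivation p \<delta>) 1 CARD('n) (pull p \<circ> l) v"

text \<open>
  The operator \<open>v\<close> maps the solutions of \<open>L\<close> to independent functions, hence it is a cyclic vector.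
\<close>

lemma gauge_data: obtains b Q where "cyclic_data CARD('n) gauge_rows b Q"
proof -
  obtain z where z: "z \<in> V" using V(3) by blast
  interpret H: differential_field_hom "mero_derivation p \<delta>" "E1.germ_D z" "\<lambda>b. germ z (rep_mero b \<circ> q)"
    by (rule E_hom)
  show thesis
    using H.cyclic_data_of_independent_solutions[of UNIV "CARD('n)" 1 "pull p \<circ> l" "\<lambda>i j. X i j z" v]
      X_companion[OF z] w_independent[OF z] that by (auto simp: w_eq[OF z] gauge_rows_def)
qed

context
  fixes b Q assumes bQ: "cyclic_data CARD('n) gauge_rows b Q"
begin

lemma w_solution:
  assumes z: "z \<in> V"
  shows "(E1.germ_D z ^^ CARD('n)) (w i z) + (\<Sum>k<CARD('n). germ z (rep_mero (b k) \<circ> q) * (E1.germ_D z ^^ k) (w i z)) = 0"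
    and "X i 0 z = (\<Sum>k<CARD('n). germ z (rep_mero (Q 0 k) \<circ> q) * (E1.germ_D z ^^ k) (w i z))"
proof -
  interpret H: differential_field_hom "mero_derivation p \<delta>" "E1.germ_D z" "\<lambda>b. germ z (rep_mero b \<circ> q)"
    by (rule E_hom)
  show "(E1.germ_D z ^^ CARD('n)) (w i z) + (\<Sum>k<CARD('n). germ z (rep_mero (b k) \<circ> q) * (E1.germ_D z ^^ k) (w i z)) = 0"
    using H.cyclic_solution(1)[OF bQ[unfolded gauge_rows_def] X_companion[OF z], of i] by (simp only: w_eq[OF z])
  show "X i 0 z = (\<Sum>k<CARD('n). germ z (rep_mero (Q 0 k) \<circ> q) * (E1.germ_D z ^^ k) (w i z))"
    using H.cyclic_solution(2)[OF bQ[unfolded gauge_rows_def] X_companion[OF z], of 0 i] by (simp only: w_eq[OF z] zero_less_card_finite)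
qed

lemma ry_meromorphic:
  assumes "z \<in> V"
  shows "rs_meromorphic_on (\<lambda>z. r z * y (h z) $ i) {z}" "germ z (\<lambda>z. r z * y (h z) $ i) = w i z"
  using rs_meromorphic_on_mult[OF r_meromorphic[OF assms] y_pullback_meromorphic[OF assms, of i]]
    germ_mult[OF r_meromorphic[OF assms] y_pullback_meromorphic[OF assms, of i]]
  by (simp_all add: w_def)

text \<open>
  The first row of the inverse matrix recovers \<open>x\<^sub>i\<close> from the derivatives of \<open>w i\<close> of order below \<open>n\<close>;
  the coefficient of order \<open>n\<close> can be taken to be 0.
\<close>

lemma x_expansion:
  "\<forall>\<^sub>\<approx>z\<in>V. x (p (q z)) $ i = (\<Sum>j\<le>CARD('n). rep_mero (if j < CARD('n) then Q 0 j else 0) (q z)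
              * (E1.D ^^ j) (\<lambda>z. r z * y (h z) $ i) z)"
proof (subst eventually_cosparse_open_eq[OF V(1)], rule ballI)
  fix z assume z: "z \<in> V"
  let ?g = "\<lambda>j. if j < CARD('n) then Q 0 j else 0"
  note op = E1.germ_operator[OF ry_meromorphic(1)[OF z] q, where I = "{..CARD('n)}" and b = ?g]
  have "germ z (x_comp i \<circ> (p \<circ> q)) = (\<Sum>j<CARD('n). germ z (rep_mero (Q 0 j) \<circ> q) * (E1.germ_D z ^^ j) (w i z))"
    using w_solution(2)[OF z] by (simp add: X_def)
  also have "\<dots> = (\<Sum>j\<le>CARD('n). germ z (rep_mero (?g j) \<circ> q) * (E1.germ_D z ^^ j) (w i z))"
    using germ_pullback_eq_0_iff[OF q, of z 0] by (simp flip: lessThan_Suc_atMost)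
  also have "\<dots> = germ z (\<lambda>z. \<Sum>j\<le>CARD('n). rep_mero (?g j) (q z) * (E1.D ^^ j) (\<lambda>z. r z * y (h z) $ i) z)"
    using op(2) ry_meromorphic(2)[OF z] by simp
  finally show "eventually (\<lambda>z. x (p (q z)) $ i =
      (\<Sum>j\<le>CARD('n). rep_mero (?g j) (q z) * (E1.D ^^ j) (\<lambda>z. r z * y (h z) $ i) z)) (at z)"
    using germ_eq_iff[OF x_pullback_meromorphic[OF z] op(1)] by simp
qed

lemma gauge: "gauge_equivalent E.D CARD('n) (pull p \<circ> l) b"
  unfolding gauge_equivalent_def Let_def
proof (intro exI[of _ "Q 0"] allI impI, elim conjE)
  fix W u assume "connected W" and u: "lode_solution E.D CARD('n) b W u"
  let ?x = "\<lambda>z. \<Sum>j<CARD('n). rep_mero (Q 0 j) z * (E.D ^^ j) u z"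
  have W: "open W" and mero: "\<And>z. z \<in> W \<Longrightarrow> rs_meromorphic_on u {z}"
    using u rs_meromorphic_on_subset unfolding lode_solution_def by blast+
  have op: "rs_meromorphic_on ?x {z}"
      "germ z ?x = (\<Sum>j<CARD('n). germ z (rep_mero (Q 0 j)) * (E.germ_D z ^^ j) (germ z u))" if "z \<in> W" for z
    using E.germ_operator[OF mero[OF that] branched_cover_id, where I = "{..<CARD('n)}" and b = "Q 0"] by simp_all
  have key: "(E.germ_D z ^^ CARD('n)) (germ z ?x) +
        (\<Sum>k<CARD('n). germ z (rep_mero ((pull p \<circ> l) k)) * (E.germ_D z ^^ k) (germ z ?x)) = 0"
      "germ z ?x = 0 \<Longrightarrow> germ z u = 0" if z: "z \<in> W" for z
  proof -
    interpret H: differential_field_hom "mero_derivation p \<delta>" "E.germ_D z" "\<lambda>b. germ z (rep_mero b)"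
      by (rule germ_hom[OF E.derived_cover_axioms])
    have "(E.germ_D z ^^ CARD('n)) (germ z u) + (\<Sum>k<CARD('n). germ z (rep_mero (b k)) * (E.germ_D z ^^ k) (germ z u)) = 0"
      using u z by (simp add: E.lode_solution_iff_germ)
    note * = H.cyclic_solution_converse[OF _ bQ[unfolded gauge_rows_def] this, folded op(2)[OF z]]
    show "(E.germ_D z ^^ CARD('n)) (germ z ?x) +
        (\<Sum>k<CARD('n). germ z (rep_mero ((pull p \<circ> l) k)) * (E.germ_D z ^^ k) (germ z ?x)) = 0"
      by (rule *(1)) simp
    show "germ z u = 0" if "germ z ?x = 0" by (rule *(2)[OF _ that]) simp
  qed
  have "rs_meromorphic_on ?x W" using op(1) by (intro rs_meromorphic_on_pointwise[THEN iffD2]) simp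
  then have "lode_solution E.D CARD('n) (pull p \<circ> l) W ?x"
    using key(1) W by (simp add: E.lode_solution_iff_germ)
  moreover have "\<forall>\<^sub>\<approx>z\<in>W. u z = 0" if "\<forall>\<^sub>\<approx>z\<in>W. ?x z = 0"
  proof (subst eventually_cosparse_open_eq[OF W], rule ballI)
    fix z assume z: "z \<in> W"
    have "eventually (\<lambda>z. ?x z = 0) (at z)" by (rule eventually_cosparse_imp_eventually_at[OF that z])
    then have "germ z u = 0" using germ_eq_0_iff[OF op(1)[OF z]] key(2)[OF z] by blast
    then show "eventually (\<lambda>z. u z = 0) (at z)" using germ_eq_0_iff[OF mero[OF z]] by blast
  qed
  ultimately show "lode_solution E.D CARD('n) (pull p \<circ> l) W ?x \<and>
      ((\<forall>\<^sub>\<approx>z\<in>W. ?x z = 0) \<longrightarrow> (\<forall>\<^sub>\<approx>z\<in>W. u z = 0))" by blast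
qed

end

definition "\<kappa> = chain_factor (p \<circ> q) \<delta> id \<delta>\<^sub>C h"
text \<open>
  The same construction for the unit row: composing with \<open>h\<close> multiplies derivatives by \<open>\<kappa>\<close>, and the
  solutions \<open>y\<^sub>i \<circ> h\<close> themselves are taken as the cyclic vector.
\<close>

definition "pullback_rows =
  row_iterate (mero_derivation (p \<circ> q) \<delta>) \<kappa> CARD('n) (pull h \<circ> a) (\<lambda>j. if j = 0 then 1 else 0)"

lemma E1_hom: "differential_field_hom (mero_derivation (p \<circ> q) \<delta>) (E1.germ_D z) (\<lambda>b. germ z (rep_mero b))"
  by (rule germ_hom[OF E1.derived_cover_axioms])

lemma pullback_companion:
  assumes u: "lode_solution C1.D CARD('n) a W u" "h z \<in> W"
  shows "differential_field_hom.companion (E1.germ_D z) (\<lambda>b. germ z (rep_mero b)) \<kappa> CARD('n) (pull h \<circ> a)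
      (\<lambda>j. germ z ((C1.D ^^ j) u \<circ> h))"
    and "(\<Sum>j<CARD('n). germ z (rep_mero (if j = 0 then 1 else 0)) * germ z ((C1.D ^^ j) u \<circ> h)) = germ z (u \<circ> h)"
proof -
  interpret H: differential_field_hom "mero_derivation (p \<circ> q) \<delta>" "E1.germ_D z" "\<lambda>b. germ z (rep_mero b)"
    by (rule E1_hom)
  have m: "rs_meromorphic_on u {h z}"
    using u rs_meromorphic_on_subset unfolding lode_solution_def by blast
  show "H.companion \<kappa> CARD('n) (pull h \<circ> a) (\<lambda>j. germ z ((C1.D ^^ j) u \<circ> h))"
    using germ_pullback_solution[OF C1.derived_cover_axioms h u] germ_pull[OF h branched_cover_id]
      germ_chain[OF E1.derived_cover_axioms C1.derived_cover_axioms h C1.D_iterate_meromorphic(1)[OF m]]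
    by (simp add: H.companion_def \<kappa>_def)
  have "(\<Sum>j<CARD('n). germ z (rep_mero (if j = 0 then 1 else 0)) * germ z ((C1.D ^^ j) u \<circ> h)) =
      (\<Sum>j<CARD('n). if j = 0 then germ z (u \<circ> h) else 0)"
    by (intro sum.cong) auto
  then show "(\<Sum>j<CARD('n). germ z (rep_mero (if j = 0 then 1 else 0)) * germ z ((C1.D ^^ j) u \<circ> h)) = germ z (u \<circ> h)"
    by simp
qed

lemma y_solution: "lode_solution C1.D CARD('n) a U\<^sub>C (y_comp i)"
  using y unfolding fundamental_system_def by blast

lemma pullback_data: obtains c R where "cyclic_data CARD('n) pullback_rows c R"
proof -
  obtain z where z: "z \<in> V" using V(3) by blast
  then have hz: "h z \<in> U\<^sub>C" using V(5) by blast
  interpret H: differential_field_hom "mero_derivation (p \<circ> q) \<delta>" "E1.germ_D z" "\<lambda>b. germ z (rep_mero b)"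
    by (rule E1_hom)
  have ind: "E1.germ.const_independent z UNIV (\<lambda>i. \<Sum>j<CARD('n). germ z (rep_mero (if j = 0 then 1 else 0)) *
      germ z ((C1.D ^^ j) (y_comp i) \<circ> h))"
    unfolding pullback_companion(2)[OF y_solution hz] by (rule y_independent[OF z])
  show thesis
    by (rule H.cyclic_data_of_independent_solutions[OF finite refl pullback_companion(1)[OF y_solution hz] ind])
       (rule that, unfold pullback_rows_def)
qed

context
  fixes c R assumes cR: "cyclic_data CARD('n) pullback_rows c R"
begin

lemma pullback_solution:
  assumes u: "lode_solution C1.D CARD('n) a W u" "h z \<in> W"
  shows "(E1.germ_D z ^^ CARD('n)) (germ z (u \<circ> h)) +
    (\<Sum>k<CARD('n). germ z (rep_mero (c k)) * (E1.germ_D z ^^ k) (germ z (u \<circ> h))) = 0"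
proof -
  interpret H: differential_field_hom "mero_derivation (p \<circ> q) \<delta>" "E1.germ_D z" "\<lambda>b. germ z (rep_mero b)"
    by (rule E1_hom)
  show ?thesis
    using H.cyclic_solution(1)[OF cR[unfolded pullback_rows_def] pullback_companion(1)[OF u]] by (simp only: pullback_companion(2)[OF u])
qed

lemma pullback: "lode_pullback h CARD('n) E1.D c C1.D a"
  unfolding lode_pullback_def
proof (intro conjI h allI impI)
  fix W u assume u: "lode_solution C1.D CARD('n) a W u"
  have "open (h -` W)"
    using h_morphism u unfolding rs_morphism_def lode_solution_def by (auto intro: open_vimage)
  moreover have "rs_meromorphic_on (u \<circ> h) (h -` W)"
  proof (rule rs_meromorphic_on_pointwise[THEN iffD2], rule ballI, rule rs_meromorphic_at_compose[OF h_morphism])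
    show "rs_meromorphic_on u {h z}" if "z \<in> h -` W" for z
      using u that rs_meromorphic_on_subset unfolding lode_solution_def by blast
  qed
  ultimately show "lode_solution E1.D CARD('n) c (h -` W) (u \<circ> h)"
    using pullback_solution[OF u] by (simp add: E1.lode_solution_iff_germ)
qed

end

text \<open>
  Substituting \<open>r * u\<close> for the unknown in the LODE \<open>b\<close> gives \<open>r\<close> times a monic LODE of order \<open>n\<close> for \<open>u\<close>.
  The functions \<open>y\<^sub>i \<circ> h\<close> solve it as well as the pullback \<open>c\<close>; as they are \<open>n\<close> independent functions, the
  two equations agree.
\<close>

lemma projective_equivalence:
  fixes f :: "'e1 mero" and \<Lambda> :: nat
  assumes bQ: "cyclic_data CARD('n) gauge_rows b Q" and cR: "cyclic_data CARD('n) pullback_rows c R"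
    and \<Lambda>: "0 < \<Lambda>" and root: "\<forall>\<^sub>\<approx>z\<in>V. r z ^ \<Lambda> = rep_mero f z"
  shows "projectively_equivalent_by E1.D CARD('n) V r (pull q \<circ> b) c"
proof -
  \<comment> \<open>The logarithmic derivative of \<open>f\<^bsup>1/\<Lambda>\<^esup>\<close> is that of \<open>f\<close> divided by \<open>\<Lambda>\<close>, so it is defined over \<open>E\<^sub>1\<close>.\<close>
  define e where "e = - mero_derivation (p \<circ> q) \<delta> f / (of_nat \<Lambda> * f)"
  have e: "E1.germ_D z (germ z r) = - germ z (rep_mero e) * germ z r" if z: "z \<in> V" for z
  proof -
    interpret H: differential_field_hom "mero_derivation (p \<circ> q) \<delta>" "E1.germ_D z" "\<lambda>b. germ z (rep_mero b)"
      by (rule E1_hom)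
    let ?\<rho> = "germ z r"
    have "?\<rho> ^ \<Lambda> = germ z (\<lambda>z. r z ^ \<Lambda>)" using germ_power(2)[OF r_meromorphic[OF z]] by simp
    also have "\<dots> = germ z (rep_mero f)"
      by (rule germ_cong, rule eventually_cosparse_imp_eventually_at[OF root z])
    finally have f: "germ z (rep_mero f) = ?\<rho> ^ \<Lambda>" by simp
    have "germ z (rep_mero e) = - (of_nat \<Lambda> * ?\<rho> ^ (\<Lambda> - 1) * E1.germ_D z ?\<rho>) / (of_nat \<Lambda> * ?\<rho> ^ \<Lambda>)"
      unfolding e_def H.hom_divide H.hom_uminus H.hom_d H.hom_mult H.hom_of_nat f E1.germ.d_power ..
    moreover have "?\<rho> ^ \<Lambda> = ?\<rho> * ?\<rho> ^ (\<Lambda> - 1)" using \<Lambda> by (simp flip: power_Suc)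
    ultimately show ?thesis using \<Lambda> r_nonzero[OF z] by simp
  qed
  define c' where "c' = twisted_lode (mero_derivation (p \<circ> q) \<delta>) e CARD('n) (pull q \<circ> b)"
  have twist: "(E1.germ_D z ^^ CARD('n)) (germ z r * F) +
      (\<Sum>k<CARD('n). germ z (rep_mero ((pull q \<circ> b) k)) * (E1.germ_D z ^^ k) (germ z r * F)) =
      germ z r * ((E1.germ_D z ^^ CARD('n)) F + (\<Sum>k<CARD('n). germ z (rep_mero (c' k)) * (E1.germ_D z ^^ k) F))"
    if z: "z \<in> V" for z F
  proof -
    interpret H: differential_field_hom "mero_derivation (p \<circ> q) \<delta>" "E1.germ_D z" "\<lambda>b. germ z (rep_mero b)"
      by (rule E1_hom)
    show ?thesis unfolding c'_def by (rule H.twisted_lode_operator[OF e[OF z]])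
  qed
  have c: "c k = c' k" if "k < CARD('n)" for k
  proof -
    obtain z where z: "z \<in> V" using V(3) by blast
    then have hz: "h z \<in> U\<^sub>C" using V(5) by blast
    interpret H: differential_field_hom "mero_derivation (p \<circ> q) \<delta>" "E1.germ_D z" "\<lambda>b. germ z (rep_mero b)"
      by (rule E1_hom)
    have "germ z r * ((E1.germ_D z ^^ CARD('n)) (germ z (y_comp i \<circ> h)) +
        (\<Sum>k<CARD('n). germ z (rep_mero (c' k)) * (E1.germ_D z ^^ k) (germ z (y_comp i \<circ> h)))) = 0" for i
      using w_solution(1)[OF bQ z, of i] germ_pull[OF q branched_cover_id]
      unfolding twist[OF z, symmetric] w_def by simp
    then have "(E1.germ_D z ^^ CARD('n)) (germ z (y_comp i \<circ> h)) +
        (\<Sum>k<CARD('n). germ z (rep_mero (c' k)) * (E1.germ_D z ^^ k) (germ z (y_comp i \<circ> h))) = 0" for i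
      using r_nonzero[OF z] by simp
    then show ?thesis
      using that by (intro H.lode_determined_by_independent_solutions[OF finite refl y_independent[OF z]
          pullback_solution[OF cR y_solution hz]]) auto
  qed
  have "lode_solution E1.D CARD('n) (pull q \<circ> b) W (\<lambda>z. r z * u z) \<longleftrightarrow> lode_solution E1.D CARD('n) c W u"
    if W: "open W" "W \<subseteq> V" and u: "rs_meromorphic_on u W" for W u
  proof -
    have ru: "rs_meromorphic_on (\<lambda>z. r z * u z) W"
      using rs_meromorphic_on_subset[OF rs_holomorphic_imp_meromorphic_on[OF r V(1)] W(2)] u
      by (intro rs_meromorphic_intros)
    have "(E1.germ_D z ^^ CARD('n)) (germ z (\<lambda>z. r z * u z)) +
        (\<Sum>k<CARD('n). germ z (rep_mero ((pull q \<circ> b) k)) * (E1.germ_D z ^^ k) (germ z (\<lambda>z. r z * u z))) = 0 \<longleftrightarrow>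
        (E1.germ_D z ^^ CARD('n)) (germ z u) + (\<Sum>k<CARD('n). germ z (rep_mero (c k)) * (E1.germ_D z ^^ k) (germ z u)) = 0"
      if z: "z \<in> W" for z
    proof -
      have zV: "z \<in> V" using W(2) z by blast
      have "germ z (\<lambda>z. r z * u z) = germ z r * germ z u"
        using z u rs_meromorphic_on_subset by (intro germ_mult r_meromorphic[OF zV]) blast
      then show ?thesis using twist[OF zV, of "germ z u"] r_nonzero[OF zV] by (simp add: c)
    qed
    then show ?thesis using W(1) u ru by (auto simp: E1.lode_solution_iff_germ)
  qed
  moreover have "lode_solution E1.D 1 (\<lambda>_. e) V r"
    using e V(1) rs_holomorphic_imp_meromorphic_on[OF r V(1)]
    by (simp add: E1.lode_solution_iff_germ)
  moreover have "\<not> (\<forall>\<^sub>\<approx>z\<in>V. r z = 0)"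
  proof
    assume 0: "\<forall>\<^sub>\<approx>z\<in>V. r z = 0"
    obtain z where z: "z \<in> V" using V(3) by blast
    have "eventually (\<lambda>z. r z = 0) (at z)" by (rule eventually_cosparse_imp_eventually_at[OF 0 z])
    then show False using germ_eq_0_iff[OF r_meromorphic[OF z]] r_nonzero[OF z] by blast
  qed
  ultimately show ?thesis
    unfolding projectively_equivalent_by_def using V(2,3) by blast
qed

end

section \<open>Gauge equivalence to a pullback\<close>

theorem corollary8:
  fixes G :: "(complex ^ 'n ^ 'n) set" and C X :: "'n proj_point set" and d \<Lambda> :: nat
    and \<psi> :: "'c0::compact_riemann_surface \<Rightarrow> 'n proj_orbit" and S :: "'c0 set"
    and \<pi> :: "'c1::compact_riemann_surface \<Rightarrow> 'c0"
    and \<delta>\<^sub>C :: "'c1 mero \<Rightarrow> 'c1 mero" and a :: "nat \<Rightarrow> 'c1 mero"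
    and U\<^sub>C :: "'c1 set" and y :: "'c1 \<Rightarrow> complex ^ 'n"
    and \<delta> :: "'x0::compact_riemann_surface mero \<Rightarrow> 'x0 mero" and l :: "nat \<Rightarrow> 'x0 mero"
    and U :: "'x0 set" and x :: "'x0 \<Rightarrow> complex ^ 'n"
    and p :: "'e::compact_riemann_surface \<Rightarrow> 'x0" and f\<^sub>E :: "nat \<Rightarrow> 'e mero"
    and q :: "'e1::compact_riemann_surface \<Rightarrow> 'e" and f :: "'e1 mero" and h :: "'e1 \<Rightarrow> 'c1"
    and V :: "'e1 set" and r :: "'e1 \<Rightarrow> complex"
  assumes "finite G" "linear_group G" "primitive_group G"
    and "algebraic_curve C" "group_invariant G C" "curve_degree C d" "nondegenerate C"
    and "finite S" "morphism_to_quotient G C S \<psi>" "\<not> \<psi> constant_on (- S)"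
    and "quotient_unramified_over G C (\<psi> ` (- S))"
    and "branched_cover \<pi>" "abelian_extension \<pi>"
    and "nontrivial_derivation \<delta>\<^sub>C"
    and "lode_irreducible \<delta>\<^sub>C CARD('n) a"
    and "lode_solutions_algebraic (extended_derivation id \<delta>\<^sub>C) CARD('n) a"
    and "fundamental_system (extended_derivation id \<delta>\<^sub>C) a U\<^sub>C y"
    and "proj_closure (schwarz_image U\<^sub>C y) = C"
    and "quotient_schwarz_map G U\<^sub>C y (- (\<pi> -` S)) (\<psi> \<circ> \<pi>)"
    and "nontrivial_derivation \<delta>"
    and "lode_irreducible \<delta> CARD('n) l"
    and "lode_solutions_algebraic (extended_derivation id \<delta>) CARD('n) l"
    and "fundamental_system (extended_derivation id \<delta>) l U x"
    and "proj_closure (schwarz_image U x) = X"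
    and "algebraic_curve X" "group_invariant G X" "nondegenerate X"
    and "branched_cover p" "extension_degree_le p d"
    and "branched_cover q" "abelian_extension q"
  \<comment> \<open>\<open>r\<close> is a branch on \<open>V\<close> of \<open>f\<close> to the power \<open>1/\<Lambda>\<close>\<close>
    and "rs_morphism h" "0 < \<Lambda>"
    and "open V" "connected V" "V \<noteq> {}" "V \<subseteq> (p \<circ> q) -` U" "V \<subseteq> h -` U\<^sub>C"
    and "rs_holomorphic_on r V" "\<forall>\<^sub>\<approx>z\<in>V. r z ^ \<Lambda> = rep_mero f z"
    and "\<And>i. \<forall>\<^sub>\<approx>z\<in>V. x (p (q z)) $ i
            + (\<Sum>j=1..CARD('n) - 2. rep_mero (f\<^sub>E j) (q z)
              * (extended_derivation (p \<circ> q) \<delta> ^^ j) (\<lambda>z. x (p (q z)) $ i) z)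
          = r z * y (h z) $ i"
  shows "(\<exists>g :: nat \<Rightarrow> 'e mero. \<forall>i. \<forall>\<^sub>\<approx>z\<in>V. x (p (q z)) $ i =
           (\<Sum>j\<le>CARD('n). rep_mero (g j) (q z)
              * (extended_derivation (p \<circ> q) \<delta> ^^ j) (\<lambda>z. r z * y (h z) $ i) z)) \<and>
         (\<exists>(b :: nat \<Rightarrow> 'e mero) (c :: nat \<Rightarrow> 'e1 mero).
           gauge_equivalent (extended_derivation p \<delta>) CARD('n) (pull p \<circ> l) b \<and>
           lode_pullback h CARD('n) (extended_derivation (p \<circ> q) \<delta>) c (extended_derivation id \<delta>\<^sub>C) a \<and>
           projectively_equivalent_by (extended_derivation (p \<circ> q) \<delta>) CARD('n) V r (pull q \<circ> b) c)"
proof -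
  interpret T: solution_transfer \<delta>\<^sub>C a U\<^sub>C y \<delta> l U x p f\<^sub>E q h V r
    by standard (fact algebraic_curve_dimension_ge_2[OF \<open>algebraic_curve C\<close>] | fact)+
  obtain b Q where bQ: "cyclic_data CARD('n) T.gauge_rows b Q" by (rule T.gauge_data)
  obtain c R where cR: "cyclic_data CARD('n) T.pullback_rows c R" by (rule T.pullback_data)
  show ?thesis
  proof (intro conjI exI)
    show "\<forall>i. \<forall>\<^sub>\<approx>z\<in>V. x (p (q z)) $ i =
           (\<Sum>j\<le>CARD('n). rep_mero ((\<lambda>j. if j < CARD('n) then Q 0 j else 0) j) (q z)
              * (extended_derivation (p \<circ> q) \<delta> ^^ j) (\<lambda>z. r z * y (h z) $ i) z)"
      using T.x_expansion[OF bQ] by simp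
    show "gauge_equivalent (extended_derivation p \<delta>) CARD('n) (pull p \<circ> l) b"
      by (rule T.gauge[OF bQ])
    show "lode_pullback h CARD('n) (extended_derivation (p \<circ> q) \<delta>) c (extended_derivation id \<delta>\<^sub>C) a"
      by (rule T.pullback[OF cR])
    show "projectively_equivalent_by (extended_derivation (p \<circ> q) \<delta>) CARD('n) V r (pull q \<circ> b) c"
      by (rule T.projective_equivalence[OF bQ cR \<open>0 < \<Lambda>\<close> \<open>\<forall>\<^sub>\<approx>z\<in>V. r z ^ \<Lambda> = rep_mero f z\<close>])
  qed
qed

end
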